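(* Consider the slow/fast system $$\dot x=f_1(x,y,z),\qquad \dot y=f_2(x,y,z),\qquad \dot z=\varepsilon g(x,y,z),\qquad x,y,z\in\mathbb{R},$$ and its fast system $\dot x=f_1(x,y,z)$, $\dot y=f_2(x,y,z)$, in which $z$ is a parameter. Assume that for $z=0$ the fast system has a non-degenerate periodic solution $\tilde\Gamma$ (that is, a periodic solution with finite period), that the Floquet multiplier of this periodic orbit at $z=0$ is one, and that the non-degeneracy conditions $$\frac{d\lambda_0}{dz}(0)\neq0,\qquad \lambda_2(0)\neq0$$ hold, where $\lambda_0(z)$ and $\lambda_2(z)$ are the coefficient functions of the fast system near $\tilde\Gamma$ defined in the context. Then, for $\varepsilon$ sufficiently small, the slow/fast system is locally (in a small neighborhood of $\tilde\Gamma$) orbitally equivalent to $$\dot\rho=z-\rho^2+O(\rho^3)+O(\varepsilon),\qquad \dot\theta=1,\qquad \dot z=\varepsilon\,\tilde g(\rho,\theta,z),\qquad \rho,z,\theta\in\mathbb{R},$$ where $\tilde g$ is $2\pi$-periodic in $\theta$, and where $z$ and $\rho$ are small.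
   Context: The functions $f_1,f_2,g$ are assumed sufficiently smooth, and $0<\varepsilon\ll1$. "The Floquet multiplier" means the nontrivial multiplier of $\tilde\Gamma$ as a periodic orbit of the planar fast system at $z=0$. Two systems are orbitally equivalent if they are related by a change of coordinates and a rescaling of time by a nonvanishing function. The function $\tilde g$ in the transformed system may also depend on $\varepsilon$. Definition of the coefficient functions $\lambda_j$. Rectify the fast system so that $\tilde\Gamma$ becomes the unit circle, introduce coordinates $x=(1+r)\cos\theta$, $y=(1+r)\sin\theta$, and rescale time; near $\tilde\Gamma$ and for $z$ near $0$ the fast system then becomes $$\dot r=F(r,\theta,z),\qquad \dot\theta=1,$$ with $F$ $2\pi$-periodic in $\theta$ and $F(0,\theta,0)=0$. (In these terms the assumption on the Floquet multiplier is $\int_0^{2\pi}F_r(0,\theta,0)\,d\theta=0$.) Fix an integer $N\ge3$. For $z$ near $0$ there is a coordinate change $$r=\phi_0+\rho e^{\phi_1}+\rho^2\phi_2+\dots+\rho^N\phi_N,$$ where $\phi_i=\phi_i(\theta,z)$ are $2\pi$-periodic in $\theta$ and are normalized by $\phi_i(0,z)=0$ for $i=0,\dots,N$, which brings the fast system to the form $\dot\rho=G(\rho,z)+O(\rho^{N+1})$, $\dot\theta=1$, with $G$ independent of $\theta$ and polynomial in $\rho$. The functions $\lambda_j(z)$ are the coefficients of $G$: $G(\rho,z)=\sum_j\lambda_j(z)\rho^j$. The first two hypotheses of the theorem imply $\lambda_0(0)=\lambda_1(0)=0$. *)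

theory Defs
  imports "HOL-Analysis.Analysis"
begin

section \<open>Finite smoothness\<close>

text \<open>
  Class \<open>C\<^sup>k\<close> on a set \<open>S\<close>, which is meant to be open; it is only used for functions on
  finite-dimensional spaces.
\<close>

primrec Ck_on :: "nat \<Rightarrow> ('a::real_normed_vector \<Rightarrow> 'b::real_normed_vector) \<Rightarrow> 'a set \<Rightarrow> bool" where
  "Ck_on 0 f S \<longleftrightarrow> continuous_on S f"
| "Ck_on (Suc k) f S \<longleftrightarrow>
     (\<forall>x\<in>S. f differentiable (at x)) \<and> (\<forall>v. Ck_on k (\<lambda>x. frechet_derivative f (at x) v) S)"


section \<open>The slow/fast system and its fast periodic orbit\<close>

text \<open>
  Points of the phase space are triples \<open>(x, y, z)\<close>. The planar fast system is written as
  the field \<open>fast_field\<close> on this space, with its parameter \<open>z\<close> carried along as a constant.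
\<close>

definition slow_fast_field ::
  "(real \<times> real \<times> real \<Rightarrow> real) \<Rightarrow> (real \<times> real \<times> real \<Rightarrow> real) \<Rightarrow> (real \<times> real \<times> real \<Rightarrow> real) \<Rightarrow>
   real \<Rightarrow> real \<times> real \<times> real \<Rightarrow> real \<times> real \<times> real" where
  "slow_fast_field f1 f2 g \<epsilon> p = (f1 p, f2 p, \<epsilon> * g p)"

definition fast_field ::
  "(real \<times> real \<times> real \<Rightarrow> real) \<Rightarrow> (real \<times> real \<times> real \<Rightarrow> real) \<Rightarrow>
   real \<times> real \<times> real \<Rightarrow> real \<times> real \<times> real" where
  "fast_field f1 f2 p = (f1 p, f2 p, 0)"

definition at_zero :: "real \<times> real \<Rightarrow> real \<times> real \<times> real" where
  "at_zero w = (fst w, snd w, 0)"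

text \<open>
  \<open>T\<close> is the minimal period; minimality excludes equilibria.
\<close>

definition fast_periodic_solution ::
  "(real \<times> real \<times> real \<Rightarrow> real) \<Rightarrow> (real \<times> real \<times> real \<Rightarrow> real) \<Rightarrow>
   (real \<Rightarrow> real \<times> real) \<Rightarrow> real \<Rightarrow> bool" where
  "fast_periodic_solution f1 f2 \<gamma> T \<longleftrightarrow>
     (\<forall>t. (\<gamma> has_vector_derivative (f1 (at_zero (\<gamma> t)), f2 (at_zero (\<gamma> t)))) (at t)) \<and>
     0 < T \<and> (\<forall>t. \<gamma> (t + T) = \<gamma> t) \<and> (\<forall>t. 0 < t \<and> t < T \<longrightarrow> \<gamma> t \<noteq> \<gamma> 0)"

definition fast_jacobian ::
  "(real \<times> real \<times> real \<Rightarrow> real) \<Rightarrow> (real \<times> real \<times> real \<Rightarrow> real) \<Rightarrow> real \<times> real \<Rightarrow> real^2^2" where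
  "fast_jacobian f1 f2 w =
     vector [vector [frechet_derivative f1 (at (at_zero w)) (1, 0, 0),
                     frechet_derivative f1 (at (at_zero w)) (0, 1, 0)],
             vector [frechet_derivative f2 (at (at_zero w)) (1, 0, 0),
                     frechet_derivative f2 (at (at_zero w)) (0, 1, 0)]]"

text \<open>
  \<open>X\<close> is the principal fundamental matrix of the variational equation along \<open>\<gamma>\<close>, so \<open>X T\<close> is the
  monodromy matrix. One of its eigenvalues is the trivial multiplier \<open>1\<close>; the nontrivial multiplier
  \<open>\<mu>\<close> is the other root of the characteristic polynomial, counted with multiplicity.
\<close>

definition nontrivial_floquet_multiplier ::
  "(real \<times> real \<times> real \<Rightarrow> real) \<Rightarrow> (real \<times> real \<times> real \<Rightarrow> real) \<Rightarrow>
   (real \<Rightarrow> real \<times> real) \<Rightarrow> real \<Rightarrow> real \<Rightarrow> bool" where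
  "nontrivial_floquet_multiplier f1 f2 \<gamma> T \<mu> \<longleftrightarrow>
     (\<exists>X :: real \<Rightarrow> real^2^2. X 0 = mat 1 \<and>
        (\<forall>t. (X has_vector_derivative (fast_jacobian f1 f2 (\<gamma> t) ** X t)) (at t)) \<and>
        (\<forall>s. det (mat s - X T) = (s - 1) * (s - \<mu>)))"


section \<open>Coordinates near a closed curve and orbital equivalence\<close>

text \<open>
  The angle \<open>\<theta>\<close> runs through the reals; objects on the circle are represented by
  \<open>2\<pi>\<close>-periodic ones.
\<close>

definition tube :: "real \<Rightarrow> (real \<times> real \<times> real) set" where
  "tube \<delta> = {(\<rho>, \<theta>, z). \<bar>\<rho>\<bar> < \<delta> \<and> \<bar>z\<bar> < \<delta>}"

definition angle_periodic :: "real \<Rightarrow> (real \<times> real \<times> real \<Rightarrow> 'b) \<Rightarrow> bool" where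
  "angle_periodic \<delta> f \<longleftrightarrow> (\<forall>(\<rho>, \<theta>, z) \<in> tube \<delta>. f (\<rho>, \<theta> + 2 * pi, z) = f (\<rho>, \<theta>, z))"

text \<open>
  \<open>\<Phi>\<close> induces a \<open>C\<^sup>m\<close> diffeomorphism of \<open>{\<bar>\<rho>\<bar> < \<delta>} \<times> (\<real>/2\<pi>\<int>) \<times> {\<bar>z\<bar> < \<delta>}\<close> onto an open
  neighbourhood of the closed curve \<open>\<Gamma>\<close>, which corresponds to \<open>\<rho> = z = 0\<close>.
\<close>

definition coordinates_near ::
  "nat \<Rightarrow> real \<Rightarrow> (real \<times> real \<times> real) set \<Rightarrow>
   (real \<times> real \<times> real \<Rightarrow> real \<times> real \<times> real) \<Rightarrow> bool" where
  "coordinates_near m \<delta> \<Gamma> \<Phi> \<longleftrightarrow>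
     Ck_on m \<Phi> (tube \<delta>) \<and> angle_periodic \<delta> \<Phi> \<and>
     (\<forall>p\<in>tube \<delta>. bij (frechet_derivative \<Phi> (at p))) \<and>
     (\<forall>(\<rho>, \<theta>, z) \<in> tube \<delta>. \<forall>(\<rho>', \<theta>', z') \<in> tube \<delta>. \<Phi> (\<rho>, \<theta>, z) = \<Phi> (\<rho>', \<theta>', z') \<longrightarrow>
        \<rho> = \<rho>' \<and> z = z' \<and> (\<exists>n::int. \<theta>' = \<theta> + 2 * pi * of_int n)) \<and>
     range (\<lambda>\<theta>. \<Phi> (0, \<theta>, 0)) = \<Gamma>"

text \<open>
  \<open>\<Phi>\<close> expresses the old coordinates through the new ones: after the substitution and a rescaling of
  time by \<open>\<mu>\<close>, the field \<open>X\<close> becomes \<open>Y\<close> on \<open>D\<close>.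
\<close>

definition orbital_equivalence ::
  "nat \<Rightarrow> ('a::real_normed_vector) set \<Rightarrow> ('a \<Rightarrow> 'b::real_normed_vector) \<Rightarrow>
   ('b \<Rightarrow> 'b) \<Rightarrow> ('a \<Rightarrow> 'a) \<Rightarrow> bool" where
  "orbital_equivalence m D \<Phi> X Y \<longleftrightarrow>
     (\<exists>\<mu> :: 'a \<Rightarrow> real. Ck_on m \<mu> D \<and>
        (\<forall>p\<in>D. \<mu> p \<noteq> 0 \<and> frechet_derivative \<Phi> (at p) (Y p) = \<mu> p *\<^sub>R X (\<Phi> p)))"


section \<open>The coefficient functions\<close>

definition annulus :: "real \<Rightarrow> (real \<times> real \<times> real) set" where
  "annulus \<delta> = {(u, v, z). \<bar>sqrt (u\<^sup>2 + v\<^sup>2) - 1\<bar> < \<delta> \<and> \<bar>z\<bar> < \<delta>}"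

definition polar :: "real \<times> real \<times> real \<Rightarrow> real \<times> real \<times> real" where
  "polar = (\<lambda>(r, \<theta>, z). ((1 + r) * cos \<theta>, (1 + r) * sin \<theta>, z))"

text \<open>
  \<open>H\<close> is the inverse of the rectifying map: for every parameter value \<open>z\<close> near \<open>0\<close> it is a
  diffeomorphism from a neighbourhood of the unit circle into the plane, and at \<open>z = 0\<close> it maps the
  unit circle onto the periodic orbit.
\<close>

definition rectification ::
  "nat \<Rightarrow> real \<Rightarrow> (real \<times> real \<times> real \<Rightarrow> real) \<Rightarrow> (real \<times> real \<times> real \<Rightarrow> real) \<Rightarrow>
   (real \<Rightarrow> real \<times> real) \<Rightarrow> (real \<times> real \<times> real \<Rightarrow> real \<times> real \<times> real) \<Rightarrow>
   (real \<times> real \<times> real \<Rightarrow> real) \<Rightarrow> bool" where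
  "rectification k \<delta> f1 f2 \<gamma> H F \<longleftrightarrow>
     0 < \<delta> \<and> \<delta> < 1 \<and>
     Ck_on k H (annulus \<delta>) \<and> inj_on H (annulus \<delta>) \<and>
     (\<forall>q\<in>annulus \<delta>. bij (frechet_derivative H (at q))) \<and>
     (\<forall>(u, v, z) \<in> annulus \<delta>. snd (snd (H (u, v, z))) = z) \<and>
     range (\<lambda>\<theta>. H (cos \<theta>, sin \<theta>, 0)) = range (\<lambda>t. at_zero (\<gamma> t)) \<and>
     Ck_on k F (tube \<delta>) \<and> angle_periodic \<delta> F \<and> (\<forall>\<theta>. F (0, \<theta>, 0) = 0) \<and>
     orbital_equivalence k (tube \<delta>) (H \<circ> polar) (fast_field f1 f2) (\<lambda>p. (F p, 1, 0))"

definition radial_change ::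
  "nat \<Rightarrow> (nat \<Rightarrow> real \<times> real \<Rightarrow> real) \<Rightarrow> real \<times> real \<times> real \<Rightarrow> real" where
  "radial_change N \<phi> = (\<lambda>(\<rho>, \<theta>, z).
     \<phi> 0 (\<theta>, z) + \<rho> * exp (\<phi> 1 (\<theta>, z)) + (\<Sum>i=2..N. \<rho> ^ i * \<phi> i (\<theta>, z)))"

text \<open>
  With \<open>R = radial_change N \<phi>\<close>, the last conjunct says that \<open>r = R(\<rho>, \<theta>, z)\<close> turns
  \<open>r' = F\<close>, \<open>\<theta>' = 1\<close> into \<open>\<rho>' = G + E\<close>, \<open>\<theta>' = 1\<close>, that is
  \<open>R\<^sub>\<rho> (G + E) + R\<^sub>\<theta> = F(R, \<theta>, z)\<close>, where \<open>G = \<Sum>\<^sub>j \<lambda>\<^sub>j(z) \<rho>\<^sup>j\<close> and \<open>E = O(\<rho>\<^sup>N\<^sup>+\<^sup>1)\<close>.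
\<close>

definition fast_normal_form ::
  "nat \<Rightarrow> nat \<Rightarrow> real \<Rightarrow> (real \<times> real \<times> real \<Rightarrow> real) \<Rightarrow> (nat \<Rightarrow> real \<Rightarrow> real) \<Rightarrow> bool" where
  "fast_normal_form k N \<delta> F lam \<longleftrightarrow>
     (\<exists>\<eta> \<phi> E C. 0 < \<eta> \<and> \<eta> \<le> \<delta> \<and>
        (\<forall>i\<le>N. Ck_on k (\<phi> i) (UNIV \<times> {-\<eta><..<\<eta>}) \<and>
           (\<forall>z\<in>{-\<eta><..<\<eta>}. \<phi> i (0, z) = 0 \<and> (\<forall>\<theta>. \<phi> i (\<theta> + 2 * pi, z) = \<phi> i (\<theta>, z)))) \<and>
        (\<forall>j\<le>N. Ck_on k (lam j) {-\<eta><..<\<eta>}) \<and>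
        (\<forall>(\<rho>, \<theta>, z) \<in> tube \<eta>.
           \<bar>radial_change N \<phi> (\<rho>, \<theta>, z)\<bar> < \<delta> \<and>
           0 < frechet_derivative (radial_change N \<phi>) (at (\<rho>, \<theta>, z)) (1, 0, 0) \<and>
           \<bar>E (\<rho>, \<theta>, z)\<bar> \<le> C * \<bar>\<rho>\<bar> ^ (N + 1) \<and>
           frechet_derivative (radial_change N \<phi>) (at (\<rho>, \<theta>, z))
             ((\<Sum>j\<le>N. lam j z * \<rho> ^ j) + E (\<rho>, \<theta>, z), 1, 0)
           = F (radial_change N \<phi> (\<rho>, \<theta>, z), \<theta>, z)))"

definition coefficient_functions ::
  "nat \<Rightarrow> nat \<Rightarrow> (real \<times> real \<times> real \<Rightarrow> real) \<Rightarrow> (real \<times> real \<times> real \<Rightarrow> real) \<Rightarrow>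
   (real \<Rightarrow> real \<times> real) \<Rightarrow> (nat \<Rightarrow> real \<Rightarrow> real) \<Rightarrow> bool" where
  "coefficient_functions k N f1 f2 \<gamma> lam \<longleftrightarrow>
     (\<exists>\<delta> H F. rectification k \<delta> f1 f2 \<gamma> H F \<and> fast_normal_form k N \<delta> F lam)"

end

theory Submission
  imports Defs
begin

text \<open>
  On the cylinder around the periodic orbit the fast system has the normal form
  \<open>\<rho>' = \<lambda>\<^sub>0(z) + \<lambda>\<^sub>1(z) \<rho> + \<lambda>\<^sub>2(z) \<rho>\<^sup>2 + \<dots> + E\<close>, \<open>\<theta>' = 1\<close>, with \<open>E = O(\<rho>\<^sup>N\<^sup>+\<^sup>1)\<close>
  depending on the angle. The proof has three ingredients.

  First, \<open>\<lambda>\<^sub>0(0) = \<lambda>\<^sub>1(0) = 0\<close> (\<open>low_coefficients_vanish\<close>). The coefficient \<open>\<lambda>\<^sub>0(0)\<close> is the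
  obstruction to the base curve \<open>\<phi>\<^sub>0(\<cdot>, 0)\<close> closing up (\<open>base_curve_vanishes\<close>). For \<open>\<lambda>\<^sub>1(0)\<close>, the
  area spanned by the radial vector and the fast field satisfies a linear equation along the orbit whose
  rate is the divergence minus the radial rate \<open>F\<^sub>r\<close> (\<open>orbit_area_derivative\<close>); the multiplier
  being one, the divergence integrates to zero by Liouville's formula (\<open>divergence_potential\<close>), and
  periodicity of the area leaves \<open>exp(2 \<pi> \<lambda>\<^sub>1(0)) = 1\<close> (\<open>linear_coefficient_vanishes\<close>).

  Second, a cubic substitution \<open>\<rho> = b\<^sub>1(z) \<sigma> + b\<^sub>2(z) \<sigma>\<^sup>2 + b\<^sub>3(z) \<sigma>\<^sup>3\<close> together with
  \<open>Z = \<kappa> z\<close> brings the fast equation to \<open>\<sigma>' = Z - \<sigma>\<^sup>2 + O(\<sigma>\<^sup>3)\<close>, uniformly in \<open>Z\<close>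
  (\<open>cubic_substitution\<close>). Comparing coefficients gives \<open>b\<^sub>1 = \<lambda>\<^sub>0 / Z\<close>, \<open>b\<^sub>2 = \<lambda>\<^sub>1 b\<^sub>1 / (2 Z)\<close> and
  \<open>b\<^sub>3 = (b\<^sub>1 + \<lambda>\<^sub>1 b\<^sub>2 + \<lambda>\<^sub>2 b\<^sub>1\<^sup>2) / (3 Z)\<close>; since the numerators vanish at \<open>z = 0\<close> for the
  right constant \<open>\<kappa>\<close>, these quotients are smooth (\<open>cubic_normalization\<close>). The curve \<open>\<rho> = 0\<close> is not
  moved, so the error \<open>E\<close>, and with it the dependence on the angle, remains of higher order at every
  parameter value.

  Third, for \<open>\<epsilon> > 0\<close> the slow component adds \<open>\<epsilon> g\<close> times the vertical vector field, which is
  smooth in the new coordinates (\<open>vertical_field\<close>); normalising the angular speed to one yields the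
  terms \<open>O(\<epsilon>)\<close> and \<open>\<epsilon> gt\<close> (\<open>slow_drift_perturbation\<close>).
\<close>

section \<open>Functions of class \<open>C\<^sup>k\<close>\<close>

lemma has_derivative_frechet:
  "f differentiable (at x) \<Longrightarrow> (f has_derivative frechet_derivative f (at x)) (at x)"
  using frechet_derivative_works by blast

lemma frechet_derivative_eqI:
  "(f has_derivative D) (at x) \<Longrightarrow> frechet_derivative f (at x) = D"
  using frechet_derivative_at by metis

lemma Ck_on_subset: "Ck_on k f T \<Longrightarrow> S \<subseteq> T \<Longrightarrow> Ck_on k f S"
  by (induction k arbitrary: f) (auto intro: continuous_on_subset)

lemma Ck_on_SucD:
  assumes "Ck_on (Suc k) f S"
  shows "Ck_on k f S"
  using assms
proof (induction k arbitrary: f)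
  case 0
  then show ?case
    by (auto intro!: continuous_at_imp_continuous_on differentiable_imp_continuous_within)
next
  case (Suc k)
  then show ?case by (metis Ck_on.simps(2))
qed

lemma Ck_on_le: "Ck_on k f S \<Longrightarrow> j \<le> k \<Longrightarrow> Ck_on j f S"
  by (induction k) (auto simp: le_Suc_eq simp del: Ck_on.simps dest: Ck_on_SucD)

lemma Ck_on_continuous: "Ck_on k f S \<Longrightarrow> continuous_on S f"
  using Ck_on_le[of k f S 0] by simp

lemma Ck_on_differentiable:
  "Ck_on k f S \<Longrightarrow> 1 \<le> k \<Longrightarrow> x \<in> S \<Longrightarrow> f differentiable (at x)"
  using Ck_on_le[of k f S 1] by simp

lemma Ck_on_has_derivative:
  "Ck_on k f S \<Longrightarrow> 1 \<le> k \<Longrightarrow> x \<in> S \<Longrightarrow>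
   (f has_derivative frechet_derivative f (at x)) (at x)"
  by (rule has_derivative_frechet[OF Ck_on_differentiable])

lemma Ck_on_frechet:
  "Ck_on (Suc k) f S \<Longrightarrow> Ck_on k (\<lambda>x. frechet_derivative f (at x) v) S"
  by simp

text \<open>
  Openness is what makes the class a local property: the derivatives at a point of \<open>S\<close> depend
  on values in a full neighbourhood.
\<close>

lemma Ck_on_cong:
  assumes "open S" "\<And>x. x \<in> S \<Longrightarrow> f x = g x" "Ck_on k f S"
  shows "Ck_on k g S"
  using assms(2,3)
proof (induction k arbitrary: f g)
  case 0
  then show ?case by (simp cong: continuous_on_cong)
next
  case (Suc k)
  have d: "(g has_derivative frechet_derivative f (at x)) (at x)" if "x \<in> S" for x
    using has_derivative_transform_within_open[OF _ assms(1) that]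
      Ck_on_has_derivative[OF Suc.prems(2) _ that] Suc.prems(1) by auto
  have "Ck_on k (\<lambda>x. frechet_derivative g (at x) v) S" for v
    by (rule Suc.IH[OF _ Ck_on_frechet[OF Suc.prems(2), of v]])
      (simp add: frechet_derivative_eqI[OF d])
  then show ?case using d by (auto simp: differentiable_def)
qed

lemma Ck_on_SucI:
  assumes "open S" "\<And>x. x \<in> S \<Longrightarrow> (f has_derivative D x) (at x)"
    "\<And>v. Ck_on k (\<lambda>x. D x v) S"
  shows "Ck_on (Suc k) f S"
proof -
  have "Ck_on k (\<lambda>x. frechet_derivative f (at x) v) S" for v
    by (rule Ck_on_cong[OF assms(1) _ assms(3)[of v]])
      (simp add: frechet_derivative_eqI[OF assms(2)])
  then show ?thesis
    using assms(2) by (auto simp: differentiable_def)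
qed

lemma Ck_on_const: "Ck_on k (\<lambda>x. c) S"
  by (induction k arbitrary: c) auto

lemma Ck_on_linear:
  assumes "bounded_linear L" "open S" "Ck_on k f S"
  shows "Ck_on k (\<lambda>x. L (f x)) S"
  using assms(3)
proof (induction k arbitrary: f)
  case 0
  then show ?case using assms(1) by (simp add: bounded_linear.continuous_on)
next
  case (Suc k)
  show ?case
    by (rule Ck_on_SucI[OF assms(2) bounded_linear.has_derivative[OF assms(1)
            Ck_on_has_derivative[OF Suc.prems]]])
      (use Suc in \<open>auto intro!: Suc.IH\<close>)
qed

lemma Ck_on_ident: 
  assumes "open S"
  shows "Ck_on k (\<lambda>x. x) S"
proof (cases k)
  case (Suc j)
  show ?thesis unfolding Suc
    by (rule Ck_on_SucI[OF assms has_derivative_ident Ck_on_const])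
qed simp

lemma Ck_on_add:
  assumes "open S" "Ck_on k f S" "Ck_on k g S"
  shows "Ck_on k (\<lambda>x. f x + g x) S"
  using assms(2,3)
proof (induction k arbitrary: f g)
  case 0
  then show ?case by (simp add: continuous_intros)
next
  case (Suc k)
  show ?case
    by (rule Ck_on_SucI[OF assms(1) has_derivative_add[OF
            Ck_on_has_derivative[OF Suc.prems(1)] Ck_on_has_derivative[OF Suc.prems(2)]]])
      (use Suc.prems in \<open>auto intro!: Suc.IH\<close>)
qed

lemma Ck_on_minus: "open S \<Longrightarrow> Ck_on k f S \<Longrightarrow> Ck_on k (\<lambda>x. - f x) S"
  by (rule Ck_on_linear[OF bounded_linear_minus[OF bounded_linear_ident]])

lemma Ck_on_diff:
  "open S \<Longrightarrow> Ck_on k f S \<Longrightarrow> Ck_on k g S \<Longrightarrow> Ck_on k (\<lambda>x. f x - g x) S"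
  using Ck_on_add[OF _ _ Ck_on_minus, of S k f g] by simp

lemma Ck_on_sum:
  assumes "open S" "\<And>i. i \<in> I \<Longrightarrow> Ck_on k (f i) S"
  shows "Ck_on k (\<lambda>x. \<Sum>i\<in>I. f i x) S"
  using assms(2)
  by (induction I rule: infinite_finite_induct) (auto intro: Ck_on_const Ck_on_add assms(1))

lemma Ck_on_bilinear:
  assumes "bounded_bilinear B" "open S" "Ck_on k f S" "Ck_on k g S"
  shows "Ck_on k (\<lambda>x. B (f x) (g x)) S"
  using assms(3,4)
proof (induction k arbitrary: f g)
  case 0
  then show ?case by (simp add: bounded_bilinear.continuous_on[OF assms(1)])
next
  case (Suc k)
  note IH = Suc.IH[OF Ck_on_SucD[OF Suc.prems(1)] Ck_on_frechet[OF Suc.prems(2)]]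
    Suc.IH[OF Ck_on_frechet[OF Suc.prems(1)] Ck_on_SucD[OF Suc.prems(2)]]
  show ?case
    by (rule Ck_on_SucI[OF assms(2) bounded_bilinear.FDERIV[OF assms(1)
          Ck_on_has_derivative[OF Suc.prems(1)] Ck_on_has_derivative[OF Suc.prems(2)]]])
      (auto intro!: Ck_on_add[OF assms(2)] IH)
qed

lemmas Ck_on_scaleR = Ck_on_bilinear[OF bounded_bilinear_scaleR]

lemmas Ck_on_mult = Ck_on_bilinear[OF bounded_bilinear_mult]

lemma Ck_on_power:
  fixes f :: "'a::real_normed_vector \<Rightarrow> real"
  shows "open S \<Longrightarrow> Ck_on k f S \<Longrightarrow> Ck_on k (\<lambda>x. f x ^ n) S"
  by (induction n) (auto intro: Ck_on_mult Ck_on_const)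

lemma Ck_on_fst: "open S \<Longrightarrow> Ck_on k f S \<Longrightarrow> Ck_on k (\<lambda>x. fst (f x)) S"
  by (rule Ck_on_linear[OF bounded_linear_fst])

lemma Ck_on_snd: "open S \<Longrightarrow> Ck_on k f S \<Longrightarrow> Ck_on k (\<lambda>x. snd (f x)) S"
  by (rule Ck_on_linear[OF bounded_linear_snd])

lemma Ck_on_Pair:
  assumes "open S" "Ck_on k f S" "Ck_on k g S"
  shows "Ck_on k (\<lambda>x. (f x, g x)) S"
proof -
  have "bounded_linear (\<lambda>x::'b. (x, 0::'c))" "bounded_linear (\<lambda>x::'c. (0::'b, x))"
    by (auto intro!: bounded_linear_Pair bounded_linear_ident bounded_linear_zero)
  from Ck_on_add[OF assms(1) Ck_on_linear[OF this(1) assms(1,2)] Ck_on_linear[OF this(2) assms(1,3)]]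
  show ?thesis by simp
qed

text \<open>
  The chain rule expresses the derivative of \<open>g \<circ> f\<close> through finitely many directional
  derivatives of \<open>g\<close>, those along the basis vectors; this is where the middle space of a
  composition has to be finite-dimensional.
\<close>

lemma linear_eq_sum_Basis:
  fixes L :: "'a::euclidean_space \<Rightarrow> 'b::real_normed_vector"
  assumes "linear L"
  shows "L v = (\<Sum>b\<in>Basis. (v \<bullet> b) *\<^sub>R L b)"
proof -
  have "L v = L (\<Sum>b\<in>Basis. (v \<bullet> b) *\<^sub>R b)" by (simp add: euclidean_representation)
  also have "\<dots> = (\<Sum>b\<in>Basis. (v \<bullet> b) *\<^sub>R L b)"
    by (simp add: linear_sum[OF assms] linear_cmul[OF assms])
  finally show ?thesis .
qed

lemma Ck_on_compose:
  fixes f :: "'a::real_normed_vector \<Rightarrow> 'b::euclidean_space" and g :: "'b \<Rightarrow> 'c::real_normed_vector"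
  assumes "open S" "open T" "Ck_on k g T" "Ck_on k f S" "\<And>x. x \<in> S \<Longrightarrow> f x \<in> T"
  shows "Ck_on k (\<lambda>x. g (f x)) S"
  using assms(3,4)
proof (induction k arbitrary: g)
  case 0
  then show ?case using assms(5) by (auto intro!: continuous_on_compose2[of T g])
next
  case (Suc k)
  define D where "D = (\<lambda>x v. \<Sum>b\<in>Basis. (frechet_derivative f (at x) v \<bullet> b) *\<^sub>R
      frechet_derivative g (at (f x)) b)"
  show ?case
  proof (rule Ck_on_SucI[OF assms(1)])
    fix x assume x: "x \<in> S"
    have "linear (frechet_derivative g (at (f x)))"
      using Ck_on_differentiable[OF Suc.prems(1)] assms(5)[OF x]
      by (simp add: linear_frechet_derivative)
    then have D: "D x = frechet_derivative g (at (f x)) \<circ> frechet_derivative f (at x)"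
      unfolding D_def o_def by (intro ext linear_eq_sum_Basis[symmetric])
    show "((\<lambda>x. g (f x)) has_derivative D x) (at x)"
      unfolding D using diff_chain_at[OF Ck_on_has_derivative[OF Suc.prems(2)]
          Ck_on_has_derivative[OF Suc.prems(1)], of x] x assms(5)[OF x]
      by (simp add: o_def)
  next
    fix v
    show "Ck_on k (\<lambda>x. D x v) S"
      unfolding D_def
      by (intro Ck_on_sum Ck_on_scaleR assms(1) Ck_on_linear[OF bounded_linear_inner_left]
          Ck_on_frechet[OF Suc.prems(2)]
          Suc.IH[OF Ck_on_frechet[OF Suc.prems(1)] Ck_on_SucD[OF Suc.prems(2)]])
  qed
qed

text \<open>
  The four inductions are run together because the derivatives of \<open>sin\<close> and \<open>cos\<close> refer to
  each other.
\<close>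

lemma Ck_on_real_functions:
  shows Ck_on_exp_UNIV: "Ck_on k (exp :: real \<Rightarrow> real) UNIV"
    and Ck_on_sin_UNIV: "Ck_on k (sin :: real \<Rightarrow> real) UNIV"
    and Ck_on_cos_UNIV: "Ck_on k (cos :: real \<Rightarrow> real) UNIV"
    and Ck_on_inverse_UNIV: "Ck_on k (inverse :: real \<Rightarrow> real) (-{0})"
proof (induction k)
  case 0
  { case 1 show ?case by (simp add: continuous_intros) }
  { case 2 show ?case by (simp add: continuous_intros) }
  { case 3 show ?case by (simp add: continuous_intros) }
  { case 4 show ?case by (auto intro!: continuous_intros) }
next
  case (Suc k)
  { case 1 show ?case
      by (rule Ck_on_SucI[of _ _ "\<lambda>x v. v * exp x"])
        (auto intro!: derivative_eq_intros Ck_on_mult Ck_on_const Suc) }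
  { case 2 show ?case
      by (rule Ck_on_SucI[of _ _ "\<lambda>x v. v * cos x"])
        (auto intro!: derivative_eq_intros Ck_on_mult Ck_on_const Suc) }
  { case 3 show ?case
      by (rule Ck_on_SucI[of _ _ "\<lambda>x v. v * - sin x"])
        (auto intro!: derivative_eq_intros Ck_on_mult Ck_on_minus Ck_on_const Suc) }
  { case 4 show ?case
    by (rule Ck_on_SucI[of _ _ "\<lambda>x v. - (inverse x * v * inverse x)"])
      (auto intro!: derivative_eq_intros Ck_on_mult Ck_on_minus Ck_on_const Suc) }
qed

lemma Ck_on_exp:
  fixes f :: "'a::real_normed_vector \<Rightarrow> real"
  shows "open S \<Longrightarrow> Ck_on k f S \<Longrightarrow> Ck_on k (\<lambda>x. exp (f x)) S"
  by (rule Ck_on_compose[OF _ open_UNIV Ck_on_exp_UNIV]) auto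

lemma Ck_on_sin:
  fixes f :: "'a::real_normed_vector \<Rightarrow> real"
  shows "open S \<Longrightarrow> Ck_on k f S \<Longrightarrow> Ck_on k (\<lambda>x. sin (f x)) S"
  by (rule Ck_on_compose[OF _ open_UNIV Ck_on_sin_UNIV]) auto

lemma Ck_on_cos:
  fixes f :: "'a::real_normed_vector \<Rightarrow> real"
  shows "open S \<Longrightarrow> Ck_on k f S \<Longrightarrow> Ck_on k (\<lambda>x. cos (f x)) S"
  by (rule Ck_on_compose[OF _ open_UNIV Ck_on_cos_UNIV]) auto

lemma Ck_on_divide:
  fixes f g :: "'a::real_normed_vector \<Rightarrow> real"
  assumes "open S" "Ck_on k f S" "Ck_on k g S" "\<And>x. x \<in> S \<Longrightarrow> g x \<noteq> 0"
  shows "Ck_on k (\<lambda>x. f x / g x) S"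
  unfolding divide_inverse
  by (rule Ck_on_mult[OF assms(1,2) Ck_on_compose[OF assms(1) _ Ck_on_inverse_UNIV assms(3)]])
    (use assms(4) in auto)

lemmas Ck_on_intros = Ck_on_const Ck_on_ident Ck_on_add Ck_on_minus Ck_on_diff Ck_on_sum
  Ck_on_mult Ck_on_scaleR Ck_on_power Ck_on_fst Ck_on_snd Ck_on_Pair Ck_on_exp Ck_on_sin Ck_on_cos

section \<open>Hadamard quotients\<close>

lemma Ck_on_has_real_derivative:
  fixes f :: "real \<Rightarrow> real"
  assumes "Ck_on k f S" "1 \<le> k" "x \<in> S"
  shows "(f has_real_derivative frechet_derivative f (at x) 1) (at x)"
proof -
  note d = Ck_on_has_derivative[OF assms]
  have "frechet_derivative f (at x) = (\<lambda>v. frechet_derivative f (at x) 1 * v)"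
  proof
    show "frechet_derivative f (at x) v = frechet_derivative f (at x) 1 * v" for v
      using linear_cmul[OF has_derivative_linear[OF d], of v 1] by simp
  qed
  then show ?thesis using d by (simp add: has_field_derivative_def)
qed

lemma mult_in_symmetric_interval:
  fixes t z :: real
  assumes "z \<in> {-\<eta><..<\<eta>}" "t \<in> {0..1}"
  shows "t * z \<in> {-\<eta><..<\<eta>}"
proof -
  have "\<bar>t * z\<bar> \<le> \<bar>z\<bar>" using assms(2) by (simp add: abs_mult mult_left_le_one_le)
  moreover have "\<bar>z\<bar> < \<eta>" using assms(1) by (simp add: abs_less_iff)
  ultimately have "\<bar>t * z\<bar> < \<eta>" by linarith
  then show ?thesis by (simp add: abs_less_iff)
qed

lemma continuous_on_scaled_argument:
  fixes h :: "real \<Rightarrow> real"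
  assumes "continuous_on {-\<eta><..<\<eta>} h"
  shows "continuous_on ({-\<eta><..<\<eta>} \<times> cbox 0 1) (\<lambda>(z, t). t ^ j * h (t * z))"
proof -
  have "(\<lambda>p. snd p * fst p) ` ({-\<eta><..<\<eta>} \<times> cbox 0 1) \<subseteq> {-\<eta><..<\<eta>}"
    by (rule image_subsetI) (simp only: mem_Times_iff cbox_interval mult_in_symmetric_interval)
  then have "continuous_on ({-\<eta><..<\<eta>} \<times> cbox 0 1) (\<lambda>p. h (snd p * fst p))"
    by (rule continuous_on_compose2[OF assms, rotated]) (intro continuous_intros)
  then show ?thesis unfolding split_beta by (intro continuous_intros)
qed

text \<open>
  Differentiating under the integral reproduces an integral of the same kind, with \<open>h\<close> replaced
  by its derivative and \<open>j\<close> by \<open>j + 1\<close>; hence the free exponent \<open>j\<close>.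
\<close>

lemma Ck_on_integral_scaled:
  fixes h :: "real \<Rightarrow> real"
  assumes "0 < \<eta>" "Ck_on k h {-\<eta><..<\<eta>}"
  shows "Ck_on k (\<lambda>z. integral (cbox 0 1) (\<lambda>t. t ^ j * h (t * z))) {-\<eta><..<\<eta>}"
  using assms(2)
proof (induction k arbitrary: h j)
  case 0
  have "continuous_on {-\<eta><..<\<eta>} h" using 0 by simp
  from integral_continuous_on_param[OF continuous_on_scaled_argument[OF this]]
  show ?case by simp
next
  case (Suc k)
  define h' where "h' = (\<lambda>x. frechet_derivative h (at x) 1)"
  have Ch': "Ck_on k h' {-\<eta><..<\<eta>}" unfolding h'_def using Suc.prems by (rule Ck_on_frechet)
  have h': "(h has_real_derivative h' x) (at x)" if "x \<in> {-\<eta><..<\<eta>}" for x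
    unfolding h'_def by (rule Ck_on_has_real_derivative[OF Suc.prems _ that]) simp
  have ch: "continuous_on {-\<eta><..<\<eta>} h" and ch': "continuous_on {-\<eta><..<\<eta>} h'"
    using Ck_on_continuous Suc.prems Ch' by blast+
  show ?case
  proof (rule Ck_on_SucI)
    fix z assume z: "z \<in> {-\<eta><..<\<eta>}"
    have "((\<lambda>z. integral (cbox 0 1) (\<lambda>t. t ^ j * h (t * z))) has_real_derivative
        integral (cbox 0 1) (\<lambda>t. t ^ Suc j * h' (t * z))) (at z within {-\<eta><..<\<eta>})"
    proof (rule leibniz_rule_field_derivative)
      fix x t :: real assume x: "x \<in> {-\<eta><..<\<eta>}" and t: "t \<in> cbox 0 1"
      have "((\<lambda>x. h (t * x)) has_real_derivative h' (t * x) * t) (at x)"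
        by (rule DERIV_chain'[where g = h and f = "\<lambda>x. t * x", OF _ h'[OF mult_in_symmetric_interval[OF x]]]) (use t in \<open>auto intro!: derivative_eq_intros\<close>)
      from DERIV_cmult[OF this, of "t ^ j"]
      show "((\<lambda>x. t ^ j * h (t * x)) has_real_derivative t ^ Suc j * h' (t * x))
          (at x within {-\<eta><..<\<eta>})"
        by (auto intro: has_field_derivative_at_within simp: ac_simps)
    next
      fix x :: real assume x: "x \<in> {-\<eta><..<\<eta>}"
      have "continuous_on (cbox 0 1) (\<lambda>t. case (x, t) of (z, t) \<Rightarrow> t ^ j * h (t * z))"
        by (rule continuous_on_compose2[OF continuous_on_scaled_argument[OF ch]])
          (use x in \<open>auto intro!: continuous_intros\<close>)
      then show "(\<lambda>t. t ^ j * h (t * x)) integrable_on cbox 0 1"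
        by (intro integrable_continuous) simp
    next
      show "continuous_on ({-\<eta><..<\<eta>} \<times> cbox 0 1) (\<lambda>(x, t). t ^ Suc j * h' (t * x))"
        by (rule continuous_on_scaled_argument[OF ch'])
    qed (use z in auto)
    then show "((\<lambda>z. integral (cbox 0 1) (\<lambda>t. t ^ j * h (t * z))) has_derivative
        (\<lambda>v. integral (cbox 0 1) (\<lambda>t. t ^ Suc j * h' (t * z)) * v)) (at z)"
      using at_within_open[OF z] by (simp add: has_field_derivative_def)
  next
    fix v :: real
    show "Ck_on k (\<lambda>z. integral (cbox 0 1) (\<lambda>t. t ^ Suc j * h' (t * z)) * v) {-\<eta><..<\<eta>}"
      by (intro Ck_on_mult Ck_on_const Suc.IH Ch') auto
  qed auto
qed

text \<open>
  The quotient is \<open>\<integral>\<^sub>0\<^sup>1 f'(t z) dt\<close>, so dividing by the variable costs one derivative only.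
\<close>

lemma Hadamard_quotient:
  fixes f :: "real \<Rightarrow> real"
  assumes "0 < \<eta>" "Ck_on (Suc k) f {-\<eta><..<\<eta>}" "f 0 = 0"
  obtains q where "Ck_on k q {-\<eta><..<\<eta>}" "\<And>z. z \<in> {-\<eta><..<\<eta>} \<Longrightarrow> f z = z * q z"
    "q 0 = deriv f 0"
proof -
  define f' where "f' = (\<lambda>x. frechet_derivative f (at x) 1)"
  have Cf': "Ck_on k f' {-\<eta><..<\<eta>}" unfolding f'_def using assms(2) by (rule Ck_on_frechet)
  have f': "(f has_real_derivative f' x) (at x)" if "x \<in> {-\<eta><..<\<eta>}" for x
    unfolding f'_def by (rule Ck_on_has_real_derivative[OF assms(2) _ that]) simp
  define q where "q = (\<lambda>z. integral (cbox 0 1) (\<lambda>t. t ^ 0 * f' (t * z)))"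
  show thesis
  proof
    show "Ck_on k q {-\<eta><..<\<eta>}" unfolding q_def by (rule Ck_on_integral_scaled[OF assms(1) Cf'])
    have "deriv f 0 = f' 0" using f'[of 0] assms(1) by (auto intro: DERIV_imp_deriv)
    then show "q 0 = deriv f 0" by (simp add: q_def)
    fix z assume z: "z \<in> {-\<eta><..<\<eta>}"
    have "((\<lambda>t. f' (t * z) * z) has_integral (f (1 * z) - f (0 * z))) {0..1}"
    proof (rule fundamental_theorem_of_calculus)
      fix t :: real assume t: "t \<in> {0..1}"
      have "((\<lambda>t. f (t * z)) has_real_derivative f' (t * z) * z) (at t)"
        by (rule DERIV_chain'[where g = f and f = "\<lambda>t. t * z", OF _ f'[OF mult_in_symmetric_interval[OF z t]]])
          (auto intro!: derivative_eq_intros)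
      then show "((\<lambda>t. f (t * z)) has_vector_derivative f' (t * z) * z) (at t within {0..1})"
        by (simp add: has_real_derivative_iff_has_vector_derivative has_vector_derivative_at_within)
    qed simp
    from integral_unique[OF this] assms(3)
    have "f z = integral {0..1} (\<lambda>t. f' (t * z)) * z" by simp
    then show "f z = z * q z" by (simp add: q_def mult.commute)
  qed
qed

section \<open>Curves, mixed derivatives and Lipschitz bounds\<close>

lemma has_vector_derivative_frechet:
  assumes "f differentiable (at (c t))" "(c has_vector_derivative v) (at t)"
  shows "((\<lambda>t. f (c t)) has_vector_derivative frechet_derivative f (at (c t)) v) (at t)"
  using vector_derivative_diff_chain_within[of c v t UNIV f "frechet_derivative f (at (c t))"]
    has_derivative_frechet[OF assms(1)] assms(2)
  by (auto simp: o_def intro: has_derivative_at_withinI)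

lemma has_vector_derivative_line:
  shows "((\<lambda>r. (r, \<theta>, z)) has_vector_derivative (1, 0, 0)) (at (r::real))"
    and "((\<lambda>t. (\<rho>, t, z)) has_vector_derivative (0, 1, 0)) (at (t::real))"
  by (auto simp: zero_prod_def intro!: derivative_eq_intros has_vector_derivative_Pair)

lemma linear_triple:
  fixes L :: "real \<times> real \<times> real \<Rightarrow> 'b::real_vector"
  assumes "linear L"
  shows "L (a, b, c) = a *\<^sub>R L (1, 0, 0) + b *\<^sub>R L (0, 1, 0) + c *\<^sub>R L (0, 0, 1)"
proof -
  have "(a, b, c) = a *\<^sub>R (1, 0, 0) + b *\<^sub>R (0, 1, 0) + c *\<^sub>R (0::real, 0::real, 1::real)" by simp
  then show ?thesis by (simp only: linear_add[OF assms] linear_cmul[OF assms])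
qed

text \<open>
  Integrating along \<open>v\<close> and differentiating along \<open>u\<close> under the integral gives
  \<open>f\<^sub>u(x + t v) = f\<^sub>u(x - d v) + \<integral> f\<^sub>v\<^sub>u(x + s v) ds\<close>, the integral running from \<open>-d\<close> to
  \<open>t\<close>. The derivative of this identity at \<open>t = 0\<close> is the equality of the mixed derivatives.
\<close>

lemma frechet_derivative_commute:
  fixes f :: "'a::euclidean_space \<Rightarrow> 'b::euclidean_space"
  assumes S: "open S" and f: "Ck_on (Suc (Suc 0)) f S" and x: "x \<in> S"
  shows "frechet_derivative (\<lambda>y. frechet_derivative f (at y) u) (at x) v =
    frechet_derivative (\<lambda>y. frechet_derivative f (at y) v) (at x) u"
proof -
  define fu where "fu = (\<lambda>y. frechet_derivative f (at y) u)"
  define fv where "fv = (\<lambda>y. frechet_derivative f (at y) v)"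
  define fvu where "fvu = (\<lambda>y. frechet_derivative fv (at y) u)"
  have C: "Ck_on (Suc 0) fu S" "Ck_on (Suc 0) fv S" "Ck_on 0 fvu S"
    using Ck_on_frechet[OF f] Ck_on_frechet[OF Ck_on_frechet[OF f]]
    unfolding fu_def fv_def fvu_def by blast+
  define P where "P = (\<lambda>a s. x + a *\<^sub>R u + s *\<^sub>R v)"
  have "open ((\<lambda>q. P (fst q) (snd q)) -` S)"
    by (rule open_vimage[OF S]) (auto simp: P_def intro!: continuous_intros)
  moreover have "(0, 0) \<in> (\<lambda>q. P (fst q) (snd q)) -` S" using x by (simp add: P_def)
  ultimately obtain A B where AB: "open A" "open B" "(0::real) \<in> A" "(0::real) \<in> B"
    "A \<times> B \<subseteq> (\<lambda>q. P (fst q) (snd q)) -` S"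
    by (auto elim!: open_prod_elim)
  obtain e1 where e1: "0 < e1" "ball 0 e1 \<subseteq> A" using AB openE by blast
  obtain e2 where e2: "0 < e2" "ball 0 e2 \<subseteq> B" using AB openE by blast
  define e where "e = min e1 e2"
  define d where "d = e / 2"
  have e: "0 < e" "0 < d" "d < e" using e1 e2 by (auto simp: e_def d_def)
  have P: "P a s \<in> S" if "\<bar>a\<bar> < e" "\<bar>s\<bar> < e" for a s
  proof -
    have "a \<in> A" "s \<in> B" using that e1 e2 by (auto simp: e_def subset_iff)
    then show ?thesis using AB(5) by auto
  qed
  have cP: "continuous_on T (P a)" for T a
    unfolding P_def by (intro continuous_intros)
  have Ps: "((\<lambda>s. P a s) has_vector_derivative v) (at s)" for a s
    unfolding P_def by (auto intro!: derivative_eq_intros)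
  have Pa: "((\<lambda>a. P a s) has_vector_derivative u) (at a)" for a s
    unfolding P_def by (auto intro!: derivative_eq_intros)
  have df: "f differentiable (at y)" "fu differentiable (at y)" "fv differentiable (at y)"
    if "y \<in> S" for y
    using Ck_on_differentiable[OF f _ that] Ck_on_differentiable[OF C(1) _ that]
      Ck_on_differentiable[OF C(2) _ that] by auto
  have FTC: "integral (cbox (-d) t) (\<lambda>s. fv (P a s)) = f (P a t) - f (P a (-d))"
    if "\<bar>a\<bar> < e" "t \<in> {-d..d}" for a t
  proof -
    have "((\<lambda>s. fv (P a s)) has_integral f (P a t) - f (P a (-d))) {-d..t}"
    proof (rule fundamental_theorem_of_calculus)
      fix s assume "s \<in> {-d..t}"
      then have "P a s \<in> S" using P that e by auto
      from has_vector_derivative_frechet[OF df(1)[OF this] Ps]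
      show "((\<lambda>s. f (P a s)) has_vector_derivative fv (P a s)) (at s within {-d..t})"
        unfolding fv_def by (rule has_vector_derivative_at_within)
    qed (use that in auto)
    then show ?thesis by (simp add: integral_unique)
  qed
  have cont: "continuous_on ({-e<..<e} \<times> {-d..d}) (\<lambda>q. P (fst q) (snd q))"
    unfolding P_def by (intro continuous_intros)
  have img: "(\<lambda>q. P (fst q) (snd q)) ` ({-e<..<e} \<times> {-d..d}) \<subseteq> S"
    using P e by (auto intro!: P)
  have fu_eq: "fu (P 0 t) = fu (P 0 (-d)) + integral {-d..t} (\<lambda>s. fvu (P 0 s))"
    if t: "t \<in> {-d..d}" for t
  proof -
    have sub: "{-e<..<e} \<times> cbox (-d) t \<subseteq> {-e<..<e} \<times> {-d..d}" using t by auto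
    have "((\<lambda>a. integral (cbox (-d) t) (\<lambda>s. fv (P a s))) has_vector_derivative
        integral (cbox (-d) t) (\<lambda>s. fvu (P 0 s))) (at 0 within {-e<..<e})"
    proof (rule leibniz_rule_vector_derivative)
      fix a s assume as: "a \<in> {-e<..<e}" "s \<in> cbox (-d) t"
      then have "P a s \<in> S" using P[of a s] t e by auto
      from has_vector_derivative_frechet[OF df(3)[OF this] Pa]
      show "((\<lambda>a. fv (P a s)) has_vector_derivative fvu (P a s)) (at a within {-e<..<e})"
        unfolding fvu_def by (rule has_vector_derivative_at_within)
    next
      fix a assume a: "a \<in> {-e<..<e}"
      have "continuous_on (cbox (-d) t) (\<lambda>s. fv (P a s))"
        by (rule continuous_on_compose2[OF Ck_on_continuous[OF C(2)], of _ "P a"])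
          (use a t P e in \<open>auto simp: cP\<close>)
      then show "(\<lambda>s. fv (P a s)) integrable_on cbox (-d) t" by (rule integrable_continuous)
    next
      show "continuous_on ({-e<..<e} \<times> cbox (-d) t) (\<lambda>(a, s). fvu (P a s))"
        unfolding split_beta
        by (rule continuous_on_compose2[OF Ck_on_continuous[OF C(3)]
              continuous_on_subset[OF cont sub]]) (use img sub in blast)
    qed (use e in auto)
    then have 1: "((\<lambda>a. integral (cbox (-d) t) (\<lambda>s. fv (P a s))) has_vector_derivative
        integral (cbox (-d) t) (\<lambda>s. fvu (P 0 s))) (at 0)"
      using e by (simp add: at_within_open[of "0::real" "{-e<..<e}"])
    have PS: "P 0 t \<in> S" "P 0 (-d) \<in> S" using P t e by auto
    have 2: "((\<lambda>a. f (P a t) - f (P a (-d))) has_vector_derivative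
        (fu (P 0 t) - fu (P 0 (-d)))) (at 0)"
      unfolding fu_def
      by (intro has_vector_derivative_diff has_vector_derivative_frechet[OF df(1) Pa] PS)
    have 3: "((\<lambda>a. integral (cbox (-d) t) (\<lambda>s. fv (P a s))) has_vector_derivative
        (fu (P 0 t) - fu (P 0 (-d)))) (at 0)"
      by (rule has_vector_derivative_transform_within_open[OF 2, of "{-e<..<e}"])
        (use e FTC t in auto)
    show ?thesis using vector_derivative_unique_at[OF 1 3] by simp
  qed
  have "continuous_on {-d..d} (\<lambda>s. fvu (P 0 s))"
    by (rule continuous_on_compose2[OF Ck_on_continuous[OF C(3)] cP]) (use P e in auto)
  from integral_has_vector_derivative[OF this, of 0] e
  have "((\<lambda>t. integral {-d..t} (\<lambda>s. fvu (P 0 s))) has_vector_derivative fvu (P 0 0)) (at 0 within {-d..d})"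
    by simp
  then have "((\<lambda>t. integral {-d..t} (\<lambda>s. fvu (P 0 s))) has_vector_derivative fvu (P 0 0)) (at 0)"
    using e by (simp add: at_within_interior[of "0::real" "{-d..d}"])
  from has_vector_derivative_add[OF has_vector_derivative_const[of "fu (P 0 (-d))"] this]
  have "((\<lambda>t. fu (P 0 t)) has_vector_derivative 0 + fvu (P 0 0)) (at 0)"
  proof (rule has_vector_derivative_transform_within_open)
    show "open {-d<..<d}" "0 \<in> {-d<..<d}" using e by auto
    show "fu (P 0 (-d)) + integral {-d..t} (\<lambda>s. fvu (P 0 s)) = fu (P 0 t)"
      if "t \<in> {-d<..<d}" for t
      by (rule fu_eq[symmetric]) (use that in auto)
  qed
  moreover have "((\<lambda>t. fu (P 0 t)) has_vector_derivative frechet_derivative fu (at (P 0 0)) v) (at 0)"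
    by (rule has_vector_derivative_frechet[OF df(2) Ps]) (use P e in auto)
  ultimately have "0 + fvu (P 0 0) = frechet_derivative fu (at (P 0 0)) v"
    by (rule vector_derivative_unique_at)
  then show ?thesis by (simp add: P_def fvu_def fu_def fv_def)
qed

text \<open>
  On a compact convex set the directional derivatives along the basis vectors are bounded, and
  their sum bounds the operator norm in the mean value inequality.
\<close>

lemma Ck_on_Lipschitz:
  fixes f :: "'a::euclidean_space \<Rightarrow> 'b::real_normed_vector"
  assumes f: "Ck_on (Suc 0) f S" and K: "compact K" "convex K" "K \<subseteq> S"
  obtains B where "0 \<le> B"
    "\<And>x y. x \<in> K \<Longrightarrow> y \<in> K \<Longrightarrow> norm (f x - f y) \<le> B * norm (x - y)"
proof -
  define m where "m = (\<lambda>x. \<Sum>b\<in>Basis. norm (frechet_derivative f (at x) b))"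
  have "continuous_on K (\<lambda>x. frechet_derivative f (at x) b)" for b
    using Ck_on_continuous[OF Ck_on_frechet[OF f]] K(3) continuous_on_subset by blast
  then have "continuous_on K m" unfolding m_def by (intro continuous_intros)
  then have "bounded (m ` K)" by (intro compact_imp_bounded compact_continuous_image K(1))
  then obtain B where B: "0 < B" "\<forall>x\<in>K. norm (m x) \<le> B" by (auto simp: bounded_pos)
  have d: "(f has_derivative frechet_derivative f (at x)) (at x)" if "x \<in> K" for x
    using Ck_on_has_derivative[OF f] that K(3) by auto
  have "onorm (frechet_derivative f (at x)) \<le> B" if x: "x \<in> K" for x
  proof (rule onorm_le)
    fix v
    have "norm (frechet_derivative f (at x) v) =
        norm (\<Sum>b\<in>Basis. (v \<bullet> b) *\<^sub>R frechet_derivative f (at x) b)"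
      by (rule arg_cong[of _ _ norm], rule linear_eq_sum_Basis[OF has_derivative_linear[OF d[OF x]]])
    also have "\<dots> \<le> (\<Sum>b\<in>Basis. norm v * norm (frechet_derivative f (at x) b))"
      by (rule sum_norm_le) (simp add: mult_right_mono Basis_le_norm)
    also have "\<dots> = m x * norm v" by (simp add: m_def sum_distrib_left mult.commute)
    also have "\<dots> \<le> B * norm v" using B(2) x by (intro mult_right_mono) auto
    finally show "norm (frechet_derivative f (at x) v) \<le> B * norm v" .
  qed
  then have "norm (f x - f y) \<le> B * norm (x - y)" if "x \<in> K" "y \<in> K" for x y
    using differentiable_bound[OF K(2) _ _ that(1,2), of f "\<lambda>x. frechet_derivative f (at x)" B]
      d has_derivative_at_withinI by blast
  with B(1) show thesis by (intro that[of B]) auto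
qed

section \<open>Uniqueness and comparison for differential equations\<close>

text \<open>
  Gronwall's argument: \<open>\<bar>w\<bar>\<^sup>2 e\<^sup>-\<^sup>2\<^sup>K\<^sup>t\<close> is nonincreasing, nonnegative and starts at zero.
\<close>

lemma zero_of_linear_growth:
  fixes w :: "real \<Rightarrow> 'a::real_inner"
  assumes w: "\<And>t. t \<in> {a..b} \<Longrightarrow> (w has_vector_derivative e t) (at t)"
    and e: "\<And>t. t \<in> {a..b} \<Longrightarrow> norm (e t) \<le> K * norm (w t)"
    and "w a = 0" and t: "t \<in> {a..b}"
  shows "w t = 0"
proof -
  define g where "g = (\<lambda>t. (w t \<bullet> w t) * exp (- 2 * K * t))"
  have "g t \<le> g a"
  proof (rule DERIV_nonpos_imp_nonincreasing[where f = g and a = a and b = t])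
    fix s assume "a \<le> s" "s \<le> t"
    then have s: "s \<in> {a..b}" using t by auto
    have "((\<lambda>t. w t \<bullet> w t) has_real_derivative w s \<bullet> e s + e s \<bullet> w s) (at s)"
      unfolding has_real_derivative_iff_has_vector_derivative
      by (rule bounded_bilinear.has_vector_derivative[OF bounded_bilinear_inner w[OF s] w[OF s]])
    moreover have "((\<lambda>t. exp (- 2 * K * t)) has_real_derivative exp (- 2 * K * s) * (- 2 * K)) (at s)"
      by (auto intro!: derivative_eq_intros)
    ultimately have "(g has_real_derivative
        (2 * (w s \<bullet> e s) - 2 * K * (w s \<bullet> w s)) * exp (- 2 * K * s)) (at s)"
      unfolding g_def by (rule DERIV_cong[OF DERIV_mult]) (simp add: inner_commute algebra_simps)
    moreover have "w s \<bullet> e s \<le> K * (w s \<bullet> w s)"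
    proof -
      have "w s \<bullet> e s \<le> norm (w s) * norm (e s)" by (rule norm_cauchy_schwarz)
      also have "\<dots> \<le> norm (w s) * (K * norm (w s))" using e[OF s] by (intro mult_left_mono) auto
      finally show ?thesis by (simp add: power2_norm_eq_inner[symmetric] power2_eq_square mult_ac)
    qed
    ultimately show "\<exists>y. (g has_real_derivative y) (at s) \<and> y \<le> 0"
      by - (intro exI[of _ "(2 * (w s \<bullet> e s) - 2 * K * (w s \<bullet> w s)) * exp (- 2 * K * s)"] conjI
          mult_nonpos_nonneg, auto)
  qed (use t in auto)
  also have "g a = 0" by (simp add: g_def assms(3))
  finally have "(w t \<bullet> w t) * exp (- 2 * K * t) \<le> 0" by (simp add: g_def)
  then have "w t \<bullet> w t \<le> 0" by (simp add: mult_le_0_iff)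
  then show ?thesis using inner_ge_zero[of "w t"] by (metis inner_eq_zero_iff order_antisym)
qed

text \<open>
  The factor \<open>m\<close> allows for a rescaled time, so that the lemma can compare the orbit \<open>\<gamma>\<close> with
  the same orbit parametrised by the angle.
\<close>

lemma autonomous_ODE_unique:
  fixes f :: "'a::euclidean_space \<Rightarrow> 'a"
  assumes f: "Ck_on (Suc 0) f UNIV" and m: "continuous_on {a..b} m"
    and x: "\<And>t. t \<in> {a..b} \<Longrightarrow> (x has_vector_derivative m t *\<^sub>R f (x t)) (at t)"
    and y: "\<And>t. t \<in> {a..b} \<Longrightarrow> (y has_vector_derivative m t *\<^sub>R f (y t)) (at t)"
    and "x a = y a" "t \<in> {a..b}"
  shows "x t = y t"
proof -
  have "continuous_on {a..b} x" "continuous_on {a..b} y"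
    using has_vector_derivative_continuous[OF x] has_vector_derivative_continuous[OF y]
    by (auto intro!: continuous_at_imp_continuous_on)
  then have "bounded (x ` {a..b} \<union> y ` {a..b})" "bounded (m ` {a..b})"
    using m by (auto intro!: compact_imp_bounded compact_continuous_image)
  then obtain R M where R: "\<forall>q\<in>x ` {a..b} \<union> y ` {a..b}. norm q \<le> R"
    and M: "\<forall>q\<in>m ` {a..b}. norm q \<le> M"
    unfolding bounded_iff by (elim exE)
  obtain B where B: "0 \<le> B" "\<And>p q. p \<in> cball 0 R \<Longrightarrow> q \<in> cball 0 R \<Longrightarrow>
      norm (f p - f q) \<le> B * norm (p - q)"
    using Ck_on_Lipschitz[OF f, of "cball 0 R"] by auto
  have "x t - y t = 0"
  proof (rule zero_of_linear_growth[of a b "\<lambda>t. x t - y t" "\<lambda>t. m t *\<^sub>R f (x t) - m t *\<^sub>R f (y t)" "M * B"])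
    fix s assume s: "s \<in> {a..b}"
    have "norm (m s *\<^sub>R f (x s) - m s *\<^sub>R f (y s)) = \<bar>m s\<bar> * norm (f (x s) - f (y s))"
      by (simp add: scaleR_diff_right[symmetric])
    also have "\<dots> \<le> M * (B * norm (x s - y s))"
      using R M s by (intro mult_mono B(2)) (auto intro: order_trans[OF abs_ge_zero])
    finally show "norm (m s *\<^sub>R f (x s) - m s *\<^sub>R f (y s)) \<le> M * B * norm (x s - y s)"
      by (simp add: mult.assoc)
  qed (use assms in \<open>auto intro!: has_vector_derivative_diff\<close>)
  then show ?thesis by simp
qed

text \<open>
  At the first time after \<open>a\<close> at which \<open>p\<close> returns to zero from below, its derivative could not
  be negative.
\<close>

lemma negative_if_decreasing_at_zeros:
  fixes p :: "real \<Rightarrow> real"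
  assumes p: "\<And>t. t \<in> {a..b} \<Longrightarrow> (p has_real_derivative p' t) (at t)"
    and neg: "\<And>t. t \<in> {a..b} \<Longrightarrow> p t = 0 \<Longrightarrow> p' t < 0"
    and "p a = 0" "a < b"
  shows "p b < 0"
proof (rule ccontr)
  assume pb: "\<not> p b < 0"
  obtain d where d: "0 < d" "\<And>h. 0 < h \<Longrightarrow> h < d \<Longrightarrow> p (a + h) < p a"
    using DERIV_neg_dec_right[OF p neg, of a] assms(3,4) by auto
  define c where "c = a + min (d / 2) ((b - a) / 2)"
  have "p c < p a" unfolding c_def by (rule d(2)) (use d(1) assms(4) in auto)
  then have c: "a < c" "c < b" "p c < 0" using d(1) assms(3,4) by (auto simp: c_def min_def field_simps)
  have cont: "continuous_on {c..b} p"
    by (intro continuous_at_imp_continuous_on ballI DERIV_isCont[OF p]) (use c(1) in auto)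
  define Z where "Z = {t \<in> {c..b}. 0 \<le> p t}"
  have Z_eq: "Z = {c..b} \<inter> p -` {0..}" by (auto simp: Z_def)
  have "compact Z" unfolding Z_eq compact_eq_bounded_closed
    by (intro conjI bounded_Int disjI1 bounded_closed_interval
        continuous_closed_preimage[OF cont]) auto
  moreover have "b \<in> Z" using pb c by (simp add: Z_def)
  ultimately obtain s where s: "s \<in> Z" "\<And>t. t \<in> Z \<Longrightarrow> s \<le> t"
    using compact_attains_inf[of Z] by auto
  have cs: "c < s" "s \<le> b" using s(1) c(3) by (auto simp: Z_def order_less_le)
  have "p s = 0"
  proof (rule ccontr)
    assume "p s \<noteq> 0"
    then have "0 < p s" using s(1) by (simp add: Z_def)
    then obtain t where "c \<le> t" "t \<le> s" "p t = 0"
      using IVT'[of p c 0 s] c(3) cs continuous_on_subset[OF cont, of "{c..s}"] by auto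
    moreover from this have "t \<in> Z" using cs by (simp add: Z_def)
    ultimately show False using s(2)[of t] \<open>p s \<noteq> 0\<close> by auto
  qed
  have sab: "s \<in> {a..b}" using cs c by auto
  obtain d' where d': "0 < d'" "\<And>h. 0 < h \<Longrightarrow> h < d' \<Longrightarrow> p s < p (s - h)"
    using DERIV_neg_dec_left[OF p[OF sab] neg[OF sab \<open>p s = 0\<close>]] by auto
  define h where "h = min (d' / 2) (s - c)"
  have h: "0 < h" "h < d'" "c \<le> s - h" using d'(1) cs by (auto simp: h_def min_def)
  then have "s - h \<in> Z" using d'(2)[of h] \<open>p s = 0\<close> cs by (auto simp: Z_def)
  then show False using s(2) h(1) by fastforce
qed

section \<open>Functions on a tube\<close>

lemma open_tube: "open (tube \<delta>)"
proof -
  have "tube \<delta> = {-\<delta><..<\<delta>} \<times> UNIV \<times> {-\<delta><..<\<delta>}"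
    by (auto simp: tube_def abs_less_iff)
  then show ?thesis by (simp add: open_Times)
qed

lemma tube_mono: "\<delta> \<le> \<delta>' \<Longrightarrow> tube \<delta> \<subseteq> tube \<delta>'"
  by (auto simp: tube_def)

lemma angle_periodicD:
  "angle_periodic \<delta> f \<Longrightarrow> (\<rho>, \<theta>, z) \<in> tube \<delta> \<Longrightarrow> f (\<rho>, \<theta> + 2 * pi, z) = f (\<rho>, \<theta>, z)"
  by (auto simp: angle_periodic_def)

lemma periodic_int:
  fixes f :: "real \<Rightarrow> 'a"
  assumes per: "\<And>t. f (t + T) = f t"
  shows "f (t + of_int n * T) = f t"
proof -
  have pos: "f (t + of_nat k * T) = f t" for t k
  proof (induction k)
    case (Suc k)
    then show ?case using per[of "t + of_nat k * T"] by (simp add: algebra_simps)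
  qed simp
  show ?thesis
  proof (cases "0 \<le> n")
    case True
    then show ?thesis using pos[of t "nat n"] by simp
  next
    case False
    then show ?thesis using pos[of "t + of_int n * T" "nat (- n)"] by (simp add: algebra_simps)
  qed
qed

lemma angle_periodic_int:
  assumes f: "angle_periodic \<delta> f" and p: "(\<rho>, \<theta>, z) \<in> tube \<delta>"
  shows "f (\<rho>, \<theta> + 2 * pi * of_int n, z) = f (\<rho>, \<theta>, z)"
proof -
  have step: "f (\<rho>, t + 2 * pi, z) = f (\<rho>, t, z)" for t
    using f p by (auto simp: angle_periodic_def tube_def)
  from periodic_int[of "\<lambda>t. f (\<rho>, t, z)" "2 * pi" \<theta> n, OF this]
  show ?thesis by (simp add: mult.commute)
qed

text \<open>
  The tube is unbounded in the angle, but periodicity reduces the bound to one period, and after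
  shrinking the other two variables to a closed box the domain is compact.
\<close>

lemma angle_periodic_bounded:
  fixes f :: "real \<times> real \<times> real \<Rightarrow> 'b::real_normed_vector"
  assumes f: "angle_periodic \<delta> f" "continuous_on (tube \<delta>) f" and "\<delta>' < \<delta>"
  obtains B where "0 < B" "\<And>p. p \<in> tube \<delta>' \<Longrightarrow> norm (f p) \<le> B"
proof -
  define K where "K = {-\<delta>'..\<delta>'} \<times> {0..2 * pi} \<times> {-\<delta>'..\<delta>'}"
  have "compact K" unfolding K_def by (intro compact_Times) auto
  moreover have "K \<subseteq> tube \<delta>" using assms(3) by (auto simp: K_def tube_def)
  ultimately have "bounded (f ` K)"
    by (intro compact_imp_bounded compact_continuous_image continuous_on_subset[OF f(2)])
  then obtain B where B: "0 < B" "\<forall>p\<in>K. norm (f p) \<le> B" by (auto simp: bounded_pos)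
  have "norm (f p) \<le> B" if "p \<in> tube \<delta>'" for p
  proof -
    obtain \<rho> \<theta> z where p: "p = (\<rho>, \<theta>, z)" by (cases p)
    define n where "n = \<lfloor>\<theta> / (2 * pi)\<rfloor>"
    have "of_int n \<le> \<theta> / (2 * pi)" "\<theta> / (2 * pi) < of_int n + 1" by (auto simp: n_def)
    then have "2 * pi * of_int n \<le> \<theta>" "\<theta> \<le> 2 * pi * (of_int n + 1)"
      by (auto simp: field_simps)
    then have "\<theta> - 2 * pi * of_int n \<in> {0..2 * pi}" by (auto simp: algebra_simps)
    then have "(\<rho>, \<theta> - 2 * pi * of_int n, z) \<in> K" using that by (auto simp: K_def p tube_def)
    moreover have "f p = f (\<rho>, \<theta> - 2 * pi * of_int n, z)"
      using angle_periodic_int[OF f(1), of \<rho> "\<theta> - 2 * pi * of_int n" z n] that assms(3)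
      by (simp add: p tube_def)
    ultimately show ?thesis using B(2) by simp
  qed
  with B(1) show thesis using that by blast
qed

lemma angle_periodic_frechet:
  fixes f :: "real \<times> real \<times> real \<Rightarrow> 'b::real_normed_vector"
  assumes f: "angle_periodic \<delta> f" "Ck_on k f (tube \<delta>)" "1 \<le> k"
  shows "angle_periodic \<delta> (\<lambda>p. frechet_derivative f (at p))"
  unfolding angle_periodic_def
proof safe
  fix \<rho> \<theta> z assume p: "(\<rho>, \<theta>, z) \<in> tube \<delta>"
  define c where "c = (0::real, 2 * pi, 0::real)"
  have q: "(\<rho>, \<theta>, z) + c \<in> tube \<delta>" using p by (simp add: tube_def c_def)
  have "((\<lambda>p. f (p + c)) has_derivative (\<lambda>v. frechet_derivative f (at ((\<rho>, \<theta>, z) + c)) v)) (at (\<rho>, \<theta>, z))"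
    by (rule has_derivative_compose[where f = "\<lambda>p. p + c" and g = f, OF _ Ck_on_has_derivative[OF f(2,3) q]])
      (auto intro!: derivative_eq_intros)
  then have "(f has_derivative (\<lambda>v. frechet_derivative f (at ((\<rho>, \<theta>, z) + c)) v)) (at (\<rho>, \<theta>, z))"
    by (rule has_derivative_transform_within_open[OF _ open_tube p])
      (use f(1) in \<open>auto simp: angle_periodic_def c_def\<close>)
  from frechet_derivative_eqI[OF this]
  show "frechet_derivative f (at (\<rho>, \<theta> + 2 * pi, z)) = frechet_derivative f (at (\<rho>, \<theta>, z))"
    by (simp add: c_def)
qed

section \<open>Coordinates near the periodic orbit\<close>

lemma coordinates_near_mono:
  assumes W: "coordinates_near k \<delta> \<Gamma> W" and "j \<le> k" "\<delta>' \<le> \<delta>"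
  shows "coordinates_near j \<delta>' \<Gamma> W"
proof -
  have sub: "tube \<delta>' \<subseteq> tube \<delta>" by (rule tube_mono[OF assms(3)])
  have Wc: "Ck_on k W (tube \<delta>)" "angle_periodic \<delta> W"
    "\<And>p. p \<in> tube \<delta> \<Longrightarrow> bij (frechet_derivative W (at p))"
    "range (\<lambda>\<theta>. W (0, \<theta>, 0)) = \<Gamma>"
    and inj: "\<And>\<rho> \<theta> z \<rho>' \<theta>' z'. (\<rho>, \<theta>, z) \<in> tube \<delta> \<Longrightarrow> (\<rho>', \<theta>', z') \<in> tube \<delta> \<Longrightarrow>
      W (\<rho>, \<theta>, z) = W (\<rho>', \<theta>', z') \<Longrightarrow>
      \<rho> = \<rho>' \<and> z = z' \<and> (\<exists>n::int. \<theta>' = \<theta> + 2 * pi * of_int n)"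
    using W unfolding coordinates_near_def by blast+
  have "Ck_on j W (tube \<delta>')" by (rule Ck_on_subset[OF Ck_on_le[OF Wc(1) assms(2)] sub])
  moreover have "angle_periodic \<delta>' W" using Wc(2) sub unfolding angle_periodic_def by blast
  ultimately show ?thesis
    unfolding coordinates_near_def using Wc(3,4) inj sub by blast
qed

lemma polar_in_annulus:
  assumes "\<delta> < 1" "p \<in> tube \<delta>"
  shows "polar p \<in> annulus \<delta>"
proof -
  obtain r \<theta> z where p: "p = (r, \<theta>, z)" by (cases p)
  have "((1 + r) * cos \<theta>)\<^sup>2 + ((1 + r) * sin \<theta>)\<^sup>2 = (1 + r)\<^sup>2 * ((cos \<theta>)\<^sup>2 + (sin \<theta>)\<^sup>2)"
    by (simp only: power_mult_distrib distrib_left)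
  moreover have "0 < 1 + r" using assms by (auto simp: p tube_def)
  ultimately have "sqrt (((1 + r) * cos \<theta>)\<^sup>2 + ((1 + r) * sin \<theta>)\<^sup>2) = 1 + r" by simp
  then show ?thesis using assms by (simp add: p polar_def annulus_def tube_def)
qed

lemma polar_eqD:
  assumes "0 < 1 + r" "0 < 1 + r'" "polar (r, \<theta>, z) = polar (r', \<theta>', z')"
  shows "r = r'" "z = z'" "\<exists>n::int. \<theta>' = \<theta> + 2 * pi * of_int n"
proof -
  have e: "(1 + r) * cos \<theta> = (1 + r') * cos \<theta>'" "(1 + r) * sin \<theta> = (1 + r') * sin \<theta>'" "z = z'"
    using assms(3) by (auto simp: polar_def)
  have sq: "((1 + s) * cos t)\<^sup>2 + ((1 + s) * sin t)\<^sup>2 = (1 + s)\<^sup>2" for s t :: real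
  proof -
    have "((1 + s) * cos t)\<^sup>2 + ((1 + s) * sin t)\<^sup>2 = (1 + s)\<^sup>2 * ((cos t)\<^sup>2 + (sin t)\<^sup>2)"
      by (simp only: power_mult_distrib distrib_left)
    then show ?thesis by simp
  qed
  have "(1 + r)\<^sup>2 = (1 + r')\<^sup>2" using sq[of r \<theta>] sq[of r' \<theta>'] e by simp
  then show r: "r = r'" using assms(1,2) by (simp add: power2_eq_iff)
  show "z = z'" by (rule e(3))
  have "sin \<theta>' = sin \<theta> \<and> cos \<theta>' = cos \<theta>" using e r assms(1) by simp
  then show "\<exists>n::int. \<theta>' = \<theta> + 2 * pi * of_int n" by (simp add: sin_cos_eq_iff mult.commute)
qed

lemma Ck_on_polar: "open S \<Longrightarrow> Ck_on k polar S"
  unfolding polar_def split_beta by (intro Ck_on_intros)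

lemma inj_frechet_polar:
  assumes "0 < 1 + r"
  shows "inj (frechet_derivative polar (at (r, \<theta>, z)))"
proof -
  have "(polar has_derivative (\<lambda>v. (fst v * cos \<theta> - (1 + r) * sin \<theta> * fst (snd v),
      fst v * sin \<theta> + (1 + r) * cos \<theta> * fst (snd v), snd (snd v)))) (at (r, \<theta>, z))"
    unfolding polar_def split_beta
    by (auto intro!: derivative_eq_intros simp: algebra_simps)
  from frechet_derivative_eqI[OF this]
  have D: "frechet_derivative polar (at (r, \<theta>, z)) (x, y, w) =
      (x * cos \<theta> - (1 + r) * sin \<theta> * y, x * sin \<theta> + (1 + r) * cos \<theta> * y, w)" for x y w
    by simp
  have "linear (frechet_derivative polar (at (r, \<theta>, z)))"
    using Ck_on_differentiable[OF Ck_on_polar[of UNIV 1]] by (simp add: linear_frechet_derivative)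
  moreover have "v = 0" if "frechet_derivative polar (at (r, \<theta>, z)) v = 0" for v
  proof -
    obtain x y w where v: "v = (x, y, w)" by (cases v)
    have e: "x * cos \<theta> - (1 + r) * sin \<theta> * y = 0" "x * sin \<theta> + (1 + r) * cos \<theta> * y = 0" "w = 0"
      using that by (auto simp: v D zero_prod_def)
    have "x * ((cos \<theta>)\<^sup>2 + (sin \<theta>)\<^sup>2) =
        cos \<theta> * (x * cos \<theta> - (1 + r) * sin \<theta> * y) + sin \<theta> * (x * sin \<theta> + (1 + r) * cos \<theta> * y)"
      by algebra
    then have "x = 0" using e by simp
    have "(1 + r) * y * ((cos \<theta>)\<^sup>2 + (sin \<theta>)\<^sup>2) =
        cos \<theta> * (x * sin \<theta> + (1 + r) * cos \<theta> * y) - sin \<theta> * (x * cos \<theta> - (1 + r) * sin \<theta> * y)"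
      by algebra
    then have "(1 + r) * y = 0" using e by simp
    then have "y = 0" using assms by simp
    then show ?thesis using \<open>x = 0\<close> e(3) by (simp add: v zero_prod_def)
  qed
  ultimately show ?thesis by (simp add: linear_injective_0)
qed

lemma open_annulus: "open (annulus \<delta>)"
proof -
  have "annulus \<delta> = {q. \<bar>sqrt ((fst q)\<^sup>2 + (fst (snd q))\<^sup>2) - 1\<bar> < \<delta>} \<inter> {q. \<bar>snd (snd q)\<bar> < \<delta>}"
    by (auto simp: annulus_def)
  then show ?thesis by (auto intro!: open_Collect_less continuous_intros)
qed

text \<open>
  In polar coordinates around the unit circle, a rectification becomes a system of coordinates
  near the periodic orbit in which the parameter is untouched.
\<close>

lemma rectification_coordinates:
  assumes "rectification k \<delta> f1 f2 \<gamma> H F" "1 \<le> k"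
  shows "coordinates_near k \<delta> (range (\<lambda>t. at_zero (\<gamma> t))) (H \<circ> polar)"
    and "\<And>p. p \<in> tube \<delta> \<Longrightarrow> snd (snd ((H \<circ> polar) p)) = snd (snd p)"
proof -
  have \<delta>: "0 < \<delta>" "\<delta> < 1" and H: "Ck_on k H (annulus \<delta>)" "inj_on H (annulus \<delta>)"
    "\<And>q. q \<in> annulus \<delta> \<Longrightarrow> bij (frechet_derivative H (at q))"
    "\<And>q. q \<in> annulus \<delta> \<Longrightarrow> snd (snd (H q)) = snd (snd q)"
    "range (\<lambda>\<theta>. H (cos \<theta>, sin \<theta>, 0)) = range (\<lambda>t. at_zero (\<gamma> t))"
    using assms(1) by (auto simp: rectification_def)
  note pa = polar_in_annulus[OF \<delta>(2)]
  have pos: "0 < 1 + r" if "(r, \<theta>, z) \<in> tube \<delta>" for r \<theta> z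
    using that \<delta> by (auto simp: tube_def)
  show "snd (snd ((H \<circ> polar) p)) = snd (snd p)" if "p \<in> tube \<delta>" for p
    using H(4)[OF pa[OF that]] by (simp add: polar_def split_beta)
  have C: "Ck_on k (H \<circ> polar) (tube \<delta>)"
    unfolding o_def by (rule Ck_on_compose[OF open_tube open_annulus H(1) Ck_on_polar[OF open_tube] pa])
  have per: "angle_periodic \<delta> (H \<circ> polar)"
    by (simp add: angle_periodic_def polar_def)
  have bij: "bij (frechet_derivative (H \<circ> polar) (at p))" if p: "p \<in> tube \<delta>" for p
  proof -
    have dp: "polar differentiable (at p)" "H differentiable (at (polar p))"
      using Ck_on_differentiable[OF Ck_on_polar[of UNIV 1]]
        Ck_on_differentiable[OF H(1) assms(2) pa[OF p]] by auto
    obtain r \<theta> z where r: "p = (r, \<theta>, z)" by (cases p)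
    have "inj (frechet_derivative polar (at p))"
      unfolding r using inj_frechet_polar[OF pos] p r by simp
    then have "bij (frechet_derivative polar (at p))"
      using linear_injective_imp_surjective[OF linear_frechet_derivative[OF dp(1)]] by (simp add: bij_def)
    with H(3)[OF pa[OF p]] show ?thesis
      unfolding frechet_derivative_compose[OF dp] by (intro bij_comp)
  qed
  have inj: "r = r' \<and> z = z' \<and> (\<exists>n::int. \<theta>' = \<theta> + 2 * pi * of_int n)"
    if t: "(r, \<theta>, z) \<in> tube \<delta>" "(r', \<theta>', z') \<in> tube \<delta>"
      and e: "(H \<circ> polar) (r, \<theta>, z) = (H \<circ> polar) (r', \<theta>', z')" for r \<theta> z r' \<theta>' z'
  proof -
    have "polar (r, \<theta>, z) = polar (r', \<theta>', z')"
      using inj_onD[OF H(2) _ pa[OF t(1)] pa[OF t(2)]] e by simp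
    from polar_eqD[OF pos[OF t(1)] pos[OF t(2)] this] show ?thesis by blast
  qed
  have "range (\<lambda>\<theta>. (H \<circ> polar) (0, \<theta>, 0)) = range (\<lambda>t. at_zero (\<gamma> t))"
    using H(5) by (simp add: polar_def)
  with C per bij inj show "coordinates_near k \<delta> (range (\<lambda>t. at_zero (\<gamma> t))) (H \<circ> polar)"
    unfolding coordinates_near_def by blast
qed

text \<open>
  The change to the normal form followed by the cubic substitution is of this kind, \<open>r = S(\<sigma>, \<theta>, Z)\<close> together with the rescaled
  parameter \<open>z = Z / \<kappa>\<close>. That \<open>S\<^sub>\<sigma>\<close> has no zero gives the invertible derivative
  directly, and injectivity through Rolle's theorem.
\<close>

lemma radial_substitution:
  fixes S :: "real \<times> real \<times> real \<Rightarrow> real" and W :: "real \<times> real \<times> real \<Rightarrow> real \<times> real \<times> real"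
  assumes W: "coordinates_near k \<delta> \<Gamma> W" and k: "1 \<le> k" and "\<kappa> \<noteq> 0" and "0 < \<delta>'"
    and S: "Ck_on k S (tube \<delta>')" "angle_periodic \<delta>' S"
    and S_in: "\<And>\<sigma> \<theta> Z. (\<sigma>, \<theta>, Z) \<in> tube \<delta>' \<Longrightarrow> (S (\<sigma>, \<theta>, Z), \<theta>, Z / \<kappa>) \<in> tube \<delta>"
    and S\<^sub>\<sigma>: "\<And>p. p \<in> tube \<delta>' \<Longrightarrow> frechet_derivative S (at p) (1, 0, 0) \<noteq> 0"
    and S0: "\<And>\<theta>. S (0, \<theta>, 0) = 0"
  defines "\<Psi> \<equiv> \<lambda>p. (S p, fst (snd p), snd (snd p) / \<kappa>)"
  shows "coordinates_near k \<delta>' \<Gamma> (W \<circ> \<Psi>)"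
    and "Ck_on k \<Psi> (tube \<delta>')" and "\<And>p. p \<in> tube \<delta>' \<Longrightarrow> \<Psi> p \<in> tube \<delta>"
    and "\<And>p v. p \<in> tube \<delta>' \<Longrightarrow> frechet_derivative (W \<circ> \<Psi>) (at p) v =
      frechet_derivative W (at (\<Psi> p)) (frechet_derivative S (at p) v, fst (snd v), snd (snd v) / \<kappa>)"
proof -
  have Wc: "Ck_on k W (tube \<delta>)" "angle_periodic \<delta> W"
    "\<And>p. p \<in> tube \<delta> \<Longrightarrow> bij (frechet_derivative W (at p))"
    "range (\<lambda>\<theta>. W (0, \<theta>, 0)) = \<Gamma>"
    and W_inj: "\<And>\<rho> \<theta> z \<rho>' \<theta>' z'. (\<rho>, \<theta>, z) \<in> tube \<delta> \<Longrightarrow> (\<rho>', \<theta>', z') \<in> tube \<delta> \<Longrightarrow>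
      W (\<rho>, \<theta>, z) = W (\<rho>', \<theta>', z') \<Longrightarrow>
      \<rho> = \<rho>' \<and> z = z' \<and> (\<exists>n::int. \<theta>' = \<theta> + 2 * pi * of_int n)"
    using W unfolding coordinates_near_def by blast+
  show C\<Psi>: "Ck_on k \<Psi> (tube \<delta>')"
    unfolding \<Psi>_def divide_inverse by (intro Ck_on_intros S open_tube)
  show \<Psi>_in: "\<Psi> p \<in> tube \<delta>" if "p \<in> tube \<delta>'" for p
    using S_in that by (cases p) (simp add: \<Psi>_def)
  have C: "Ck_on k (W \<circ> \<Psi>) (tube \<delta>')"
    unfolding o_def by (rule Ck_on_compose[OF open_tube open_tube Wc(1) C\<Psi> \<Psi>_in])
  have \<Psi>': "frechet_derivative \<Psi> (at p) v = (frechet_derivative S (at p) v, fst (snd v), snd (snd v) / \<kappa>)"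
    if p: "p \<in> tube \<delta>'" for p v
  proof -
    have "(\<Psi> has_derivative (\<lambda>v. (frechet_derivative S (at p) v, fst (snd v), snd (snd v) / \<kappa>))) (at p)"
      unfolding \<Psi>_def
      by (intro has_derivative_Pair Ck_on_has_derivative[OF S(1) k p])
        (use assms(3) in \<open>auto intro!: derivative_eq_intros\<close>)
    from frechet_derivative_eqI[OF this] show ?thesis by simp
  qed
  have chain: "frechet_derivative (W \<circ> \<Psi>) (at p) =
      frechet_derivative W (at (\<Psi> p)) \<circ> frechet_derivative \<Psi> (at p)" if "p \<in> tube \<delta>'" for p
    by (rule frechet_derivative_compose[OF Ck_on_differentiable[OF C\<Psi> k that]
          Ck_on_differentiable[OF Wc(1) k \<Psi>_in[OF that]]])
  show "frechet_derivative (W \<circ> \<Psi>) (at p) v =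
      frechet_derivative W (at (\<Psi> p)) (frechet_derivative S (at p) v, fst (snd v), snd (snd v) / \<kappa>)"
    if "p \<in> tube \<delta>'" for p v
    by (simp add: chain[OF that] \<Psi>'[OF that])
  have bij: "bij (frechet_derivative (W \<circ> \<Psi>) (at p))" if p: "p \<in> tube \<delta>'" for p
  proof -
    have l: "linear (frechet_derivative \<Psi> (at p))" "linear (frechet_derivative S (at p))"
      using Ck_on_differentiable[OF C\<Psi> k p] Ck_on_differentiable[OF S(1) k p]
      by (auto intro: linear_frechet_derivative)
    have "v = 0" if "frechet_derivative \<Psi> (at p) v = 0" for v
    proof -
      obtain x y w where v: "v = (x, y, w)" by (cases v)
      have "y = 0" "w = 0" "frechet_derivative S (at p) v = 0"
        using that assms(3) by (auto simp: v \<Psi>'[OF p] zero_prod_def)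
      then show ?thesis using linear_triple[OF l(2), of x y w] S\<^sub>\<sigma>[OF p] by (simp add: v zero_prod_def)
    qed
    then have "inj (frechet_derivative \<Psi> (at p))" using l(1) by (simp add: linear_injective_0)
    then have "bij (frechet_derivative \<Psi> (at p))"
      using linear_injective_imp_surjective[OF l(1)] by (simp add: bij_def)
    with Wc(3)[OF \<Psi>_in[OF p]] show ?thesis unfolding chain[OF p] by (intro bij_comp)
  qed
  have per: "angle_periodic \<delta>' (W \<circ> \<Psi>)"
    unfolding angle_periodic_def
  proof safe
    fix \<sigma> \<theta> Z assume p: "(\<sigma>, \<theta>, Z) \<in> tube \<delta>'"
    have "S (\<sigma>, \<theta> + 2 * pi, Z) = S (\<sigma>, \<theta>, Z)" using S(2) p by (auto simp: angle_periodic_def)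
    then show "(W \<circ> \<Psi>) (\<sigma>, \<theta> + 2 * pi, Z) = (W \<circ> \<Psi>) (\<sigma>, \<theta>, Z)"
      using Wc(2) S_in[OF p] by (auto simp: angle_periodic_def \<Psi>_def)
  qed
  have inj: "\<sigma> = \<sigma>' \<and> Z = Z' \<and> (\<exists>n::int. \<theta>' = \<theta> + 2 * pi * of_int n)"
    if t: "(\<sigma>, \<theta>, Z) \<in> tube \<delta>'" "(\<sigma>', \<theta>', Z') \<in> tube \<delta>'"
      and e: "(W \<circ> \<Psi>) (\<sigma>, \<theta>, Z) = (W \<circ> \<Psi>) (\<sigma>', \<theta>', Z')" for \<sigma> \<theta> Z \<sigma>' \<theta>' Z'
  proof -
    have eq: "S (\<sigma>, \<theta>, Z) = S (\<sigma>', \<theta>', Z')" "Z / \<kappa> = Z' / \<kappa>"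
      and ex: "\<exists>n::int. \<theta>' = \<theta> + 2 * pi * of_int n"
      using W_inj[OF S_in[OF t(1)] S_in[OF t(2)]] e by (auto simp: \<Psi>_def)
    then obtain n :: int where n: "\<theta>' = \<theta> + 2 * pi * of_int n" by blast
    have Z: "Z = Z'" using eq(2) assms(3) by simp
    have t': "(\<sigma>', \<theta>, Z) \<in> tube \<delta>'" using t(2) Z by (simp add: tube_def)
    have eqS: "S (\<sigma>, \<theta>, Z) = S (\<sigma>', \<theta>, Z)"
      using angle_periodic_int[OF S(2) t', of n] eq(1) by (simp add: n Z)
    have no: "False" if ab: "a < b" "S (a, \<theta>, Z) = S (b, \<theta>, Z)"
      and"(a, \<theta>, Z) \<in> tube \<delta>'" "(b, \<theta>, Z) \<in> tube \<delta>'" for a b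
    proof -
      have int: "(s, \<theta>, Z) \<in> tube \<delta>'" if "a \<le> s" "s \<le> b" for s
        using that \<open>(a, \<theta>, Z) \<in> tube \<delta>'\<close> \<open>(b, \<theta>, Z) \<in> tube \<delta>'\<close> by (auto simp: tube_def)
      have D: "((\<lambda>s. S (s, \<theta>, Z)) has_real_derivative frechet_derivative S (at (s, \<theta>, Z)) (1, 0, 0)) (at s)"
        if "a \<le> s" "s \<le> b" for s
        unfolding has_real_derivative_iff_has_vector_derivative
        by (rule has_vector_derivative_frechet[OF Ck_on_differentiable[OF S(1) k int[OF that]]
              has_vector_derivative_line(1)])
      obtain s where s: "a < s" "s < b" "frechet_derivative S (at (s, \<theta>, Z)) (1, 0, 0) = 0"
      proof -
        have "continuous_on {a..b} (\<lambda>s. S (s, \<theta>, Z))"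
          by (intro continuous_at_imp_continuous_on ballI DERIV_isCont[OF D]) auto
        from Rolle_deriv[OF ab this, of "\<lambda>s. (*) (frechet_derivative S (at (s, \<theta>, Z)) (1, 0, 0))"]
        obtain s where "a < s" "s < b"
          "(*) (frechet_derivative S (at (s, \<theta>, Z)) (1, 0, 0)) = (\<lambda>v. 0)"
          using D by (auto simp: has_field_derivative_def)
        then show thesis using that by (metis mult.right_neutral)
      qed
      then show False using S\<^sub>\<sigma>[OF int[of s]] by simp
    qed
    have "\<sigma> = \<sigma>'"
      using no[of \<sigma> \<sigma>'] no[of \<sigma>' \<sigma>] eqS t(1) t' by (metis linorder_neqE_linordered_idom)
    then show ?thesis using Z ex by blast
  qed
  have "range (\<lambda>\<theta>. (W \<circ> \<Psi>) (0, \<theta>, 0)) = \<Gamma>" using Wc(4) by (simp add: \<Psi>_def S0)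
  with C per bij inj show "coordinates_near k \<delta>' \<Gamma> (W \<circ> \<Psi>)"
    unfolding coordinates_near_def by blast
qed

text \<open>
  The factor \<open>\<mu>\<close> is determined by the other, periodic, data, because \<open>X\<close> does not vanish on
  the image: an invertible derivative maps \<open>(F, 1, 0)\<close> to a nonzero vector.
\<close>

lemma time_rescaling_periodic:
  assumes W: "Ck_on k W (tube \<delta>)" "angle_periodic \<delta> W" "1 \<le> k"
    and bij: "\<And>p. p \<in> tube \<delta> \<Longrightarrow> bij (frechet_derivative W (at p))"
    and F: "angle_periodic \<delta> F"
    and eq: "\<And>p. p \<in> tube \<delta> \<Longrightarrow> frechet_derivative W (at p) (F p, 1, 0) = \<mu> p *\<^sub>R X (W p)"
  shows "angle_periodic \<delta> \<mu>"
  unfolding angle_periodic_def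
proof safe
  fix \<rho> \<theta> z assume p: "(\<rho>, \<theta>, z) \<in> tube \<delta>"
  let ?p = "(\<rho>, \<theta>, z)" and ?q = "(\<rho>, \<theta> + 2 * pi, z)"
  have q: "?q \<in> tube \<delta>" using p by (simp add: tube_def)
  have per: "W ?q = W ?p" "F ?q = F ?p" "frechet_derivative W (at ?q) = frechet_derivative W (at ?p)"
    using W(2) F angle_periodic_frechet[OF W(2,1,3)] p by (auto simp: angle_periodic_def)
  have "frechet_derivative W (at ?p) (F ?p, 1, 0) \<noteq> frechet_derivative W (at ?p) 0"
    using inj_eq[OF bij_is_inj[OF bij[OF p]]] by (simp add: zero_prod_def)
  then have "frechet_derivative W (at ?p) (F ?p, 1, 0) \<noteq> 0"
    using linear_0[OF linear_frechet_derivative[OF Ck_on_differentiable[OF W(1,3) p]]] by simp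
  then have "X (W ?p) \<noteq> 0" unfolding eq[OF p] by auto
  moreover have "\<mu> ?q *\<^sub>R X (W ?p) = \<mu> ?p *\<^sub>R X (W ?p)"
    using eq[OF q] unfolding per eq[OF p] by (rule sym)
  ultimately show "\<mu> ?q = \<mu> ?p" by (metis scaleR_cancel_right)
qed

section \<open>The first two coefficients vanish at \<open>z = 0\<close>\<close>

text \<open>
  Here \<open>p = \<phi>\<^sub>0(\<cdot>, 0)\<close> is the base curve of the normal form, and \<open>l\<close> is its coefficient
  \<open>\<lambda>\<^sub>0(0)\<close>. If \<open>l\<close> were positive, \<open>p\<close> would decrease at each of its zeros and could not return to
  zero after a full turn; negative \<open>l\<close> is excluded by symmetry. With \<open>l = 0\<close> the curve solves the same
  equation as the orbit \<open>r = 0\<close> and agrees with it by uniqueness.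
\<close>

lemma base_curve_vanishes:
  fixes F :: "real \<times> real \<times> real \<Rightarrow> real"
  assumes F: "Ck_on (Suc 0) F (tube \<delta>)" "\<And>\<theta>. F (0, \<theta>, 0) = 0" "0 < \<delta>"
    and p: "\<And>t. (p has_real_derivative F (p t, t, 0) - c t * l) (at t)"
    and c: "\<And>t. 0 < c t" and bound: "\<And>t. \<bar>p t\<bar> < \<delta>"
    and "p 0 = 0" and per: "\<And>t. p (t + 2 * pi) = p t"
  shows "l = 0" and "p t = 0"
proof -
  have p2: "p (2 * pi) = 0" using per[of 0] assms(7) by simp
  have "\<not> 0 < l"
  proof
    assume "0 < l"
    have "p (2 * pi) < 0"
    proof (rule negative_if_decreasing_at_zeros[where a = 0, OF p _ assms(7)])
      show "F (p t, t, 0) - c t * l < 0" if "p t = 0" for t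
        using that F(2) mult_pos_pos[OF c[of t] \<open>0 < l\<close>] by simp
    qed simp
    with p2 show False by simp
  qed
  moreover have "\<not> l < 0"
  proof
    assume "l < 0"
    have "- p (2 * pi) < 0"
    proof (rule negative_if_decreasing_at_zeros[where a = 0, OF DERIV_minus[OF p]])
      show "- (F (p t, t, 0) - c t * l) < 0" if "- p t = 0" for t
        using that F(2) mult_pos_neg[OF c[of t] \<open>l < 0\<close>] by simp
    qed (simp_all add: assms(7))
    with p2 show False by simp
  qed
  ultimately show l: "l = 0" by simp
  have nonneg: "p t = 0" if "0 \<le> t" for t
  proof -
    have "continuous_on {0..t} (\<lambda>t. \<bar>p t\<bar>)"
      by (intro continuous_intros continuous_at_imp_continuous_on ballI DERIV_isCont[OF p])
    moreover have "{0..t} \<noteq> {}" using that by simp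
    ultimately obtain s where s: "s \<in> {0..t}" "\<forall>x\<in>{0..t}. \<bar>p x\<bar> \<le> \<bar>p s\<bar>"
      using continuous_attains_sup[OF compact_Icc] by blast
    define K where "K = {-\<bar>p s\<bar>..\<bar>p s\<bar>} \<times> {0..t} \<times> {0::real}"
    have "compact K" "convex K" unfolding K_def by (auto intro!: compact_Times convex_Times)
    moreover have "K \<subseteq> tube \<delta>" using bound[of s] F(3) by (auto simp: K_def tube_def)
    ultimately obtain B where B: "\<And>x y. x \<in> K \<Longrightarrow> y \<in> K \<Longrightarrow> norm (F x - F y) \<le> B * norm (x - y)"
      using Ck_on_Lipschitz[OF F(1)] by metis
    show "p t = 0"
    proof (rule zero_of_linear_growth[of 0 t p "\<lambda>t. F (p t, t, 0)" B])
      fix x assume x: "x \<in> {0..t}"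
      show "(p has_vector_derivative F (p x, x, 0)) (at x)"
        using p[of x] l by (simp add: has_real_derivative_iff_has_vector_derivative)
      have "(p x, x, 0) \<in> K" "(0, x, 0) \<in> K" using bspec[OF s(2) x] x by (auto simp: K_def abs_le_iff)
      from B[OF this] show "norm (F (p x, x, 0)) \<le> B * norm (p x)"
        by (simp add: F(2) norm_Pair)
    qed (use that assms(7) in auto)
  qed
  obtain n where "- t / (2 * pi) \<le> of_nat n" using real_arch_simple by blast
  then have "0 \<le> t + 2 * pi * of_nat n" by (simp add: field_simps)
  with nonneg periodic_int[of p "2 * pi" t "int n", OF per] show "p t = 0"
    by (simp add: mult.commute)
qed

text \<open>
  Differentiating \<open>R\<^sub>\<rho> g + R\<^sub>\<theta> = F(R, \<theta>, 0)\<close> with respect to \<open>\<rho>\<close> at the orbit, where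
  \<open>g = 0\<close> and \<open>g' = l\<close>, gives \<open>R\<^sub>\<rho> l + R\<^sub>\<rho>\<^sub>\<theta> = F\<^sub>r R\<^sub>\<rho>\<close>. Here \<open>g\<close> is the
  radial speed of the normal form including its error term.
\<close>

lemma radial_rate_derivative:
  fixes R F :: "real \<times> real \<times> real \<Rightarrow> real"
  assumes R: "Ck_on (Suc (Suc 0)) R (tube \<eta>)" and "0 < \<eta>"
    and F: "Ck_on (Suc 0) F (tube \<delta>)" and "0 < \<delta>"
    and R0: "\<And>\<theta>. R (0, \<theta>, 0) = 0"
    and eq: "\<And>\<rho>. \<bar>\<rho>\<bar> < \<eta> \<Longrightarrow>
      frechet_derivative R (at (\<rho>, \<theta>, 0)) (g \<rho>, 1, 0) = F (R (\<rho>, \<theta>, 0), \<theta>, 0)"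
    and g: "(g has_real_derivative l) (at 0)" "g 0 = 0"
  shows "((\<lambda>\<theta>. frechet_derivative R (at (0, \<theta>, 0)) (1, 0, 0)) has_real_derivative
    (frechet_derivative F (at (0, \<theta>, 0)) (1, 0, 0) - l) *
      frechet_derivative R (at (0, \<theta>, 0)) (1, 0, 0)) (at \<theta>)"
proof -
  define Rr where "Rr = (\<lambda>p. frechet_derivative R (at p) (1, 0, 0))"
  define Rt where "Rt = (\<lambda>p. frechet_derivative R (at p) (0, 1, 0))"
  let ?o = "(0, \<theta>, 0) :: real \<times> real \<times> real"
  have o: "?o \<in> tube \<eta>" "?o \<in> tube \<delta>" using assms by (auto simp: tube_def)
  have C: "Ck_on (Suc 0) Rr (tube \<eta>)" "Ck_on (Suc 0) Rt (tube \<eta>)"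
    unfolding Rr_def Rt_def using R by (rule Ck_on_frechet)+
  have d: "R differentiable (at ?o)" "Rr differentiable (at ?o)" "Rt differentiable (at ?o)"
    "F differentiable (at (R ?o, \<theta>, 0))"
    using Ck_on_differentiable[OF R _ o(1)] Ck_on_differentiable[OF C(1) _ o(1)]
      Ck_on_differentiable[OF C(2) _ o(1)] Ck_on_differentiable[OF F _ o(2)] by (auto simp: R0)
  have split: "frechet_derivative R (at (\<rho>, \<theta>, 0)) (x, 1, 0) = x *\<^sub>R Rr (\<rho>, \<theta>, 0) + Rt (\<rho>, \<theta>, 0)"
    if "\<bar>\<rho>\<bar> < \<eta>" for \<rho> x
  proof -
    have "(\<rho>, \<theta>, 0) \<in> tube \<eta>" using that assms(2) by (simp add: tube_def)
    from linear_triple[OF linear_frechet_derivative[OF Ck_on_differentiable[OF R _ this]], of x 1 0]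
    show ?thesis by (simp add: Rr_def Rt_def)
  qed
  have rel: "F (R (\<rho>, \<theta>, 0), \<theta>, 0) = g \<rho> * Rr (\<rho>, \<theta>, 0) + Rt (\<rho>, \<theta>, 0)"
    if "- \<eta> < \<rho>" "\<rho> < \<eta>" for \<rho>
    using eq[of \<rho>] split[of \<rho> "g \<rho>"] that by simp
  note hv = has_vector_derivative_frechet[OF _ has_vector_derivative_line(1)]
  have "((\<lambda>\<rho>. g \<rho> *\<^sub>R Rr (\<rho>, \<theta>, 0) + Rt (\<rho>, \<theta>, 0)) has_vector_derivative
      g 0 *\<^sub>R frechet_derivative Rr (at ?o) (1, 0, 0) + l *\<^sub>R Rr ?o +
      frechet_derivative Rt (at ?o) (1, 0, 0)) (at 0)"
    by (intro has_vector_derivative_add has_vector_derivative_scaleR g hv d)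
  moreover have "((\<lambda>\<rho>. F (R (\<rho>, \<theta>, 0), \<theta>, 0)) has_vector_derivative
      frechet_derivative F (at ?o) (Rr ?o, 0, 0)) (at 0)"
  proof -
    have "((\<lambda>\<rho>. (R (\<rho>, \<theta>, 0), \<theta>, 0::real)) has_vector_derivative (Rr ?o, 0, 0)) (at 0)"
      unfolding Rr_def
      by (intro has_vector_derivative_Pair hv d has_vector_derivative_const)
    from has_vector_derivative_frechet[OF d(4) this] show ?thesis by (simp add: R0)
  qed
  then have "((\<lambda>\<rho>. g \<rho> *\<^sub>R Rr (\<rho>, \<theta>, 0) + Rt (\<rho>, \<theta>, 0)) has_vector_derivative
      frechet_derivative F (at ?o) (Rr ?o, 0, 0)) (at 0)"
    by (rule has_vector_derivative_transform_within_open[where S = "{-\<eta><..<\<eta>}"])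
      (use assms(2) in \<open>auto simp: rel\<close>)
  ultimately have "g 0 *\<^sub>R frechet_derivative Rr (at ?o) (1, 0, 0) + l *\<^sub>R Rr ?o +
      frechet_derivative Rt (at ?o) (1, 0, 0) = frechet_derivative F (at ?o) (Rr ?o, 0, 0)"
    by (rule vector_derivative_unique_at)
  moreover have "frechet_derivative F (at ?o) (Rr ?o, 0, 0) =
      Rr ?o * frechet_derivative F (at ?o) (1, 0, 0)"
    using linear_triple[OF linear_frechet_derivative[OF d(4)], of "Rr ?o" 0 0] by (simp add: R0)
  moreover have "frechet_derivative Rt (at ?o) (1, 0, 0) = frechet_derivative Rr (at ?o) (0, 1, 0)"
    unfolding Rr_def Rt_def by (rule frechet_derivative_commute[OF open_tube R o(1)])
  ultimately have "frechet_derivative Rr (at ?o) (0, 1, 0) =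
      (frechet_derivative F (at ?o) (1, 0, 0) - l) * Rr ?o"
    using g(2) by (simp add: algebra_simps)
  then show ?thesis
    using has_vector_derivative_frechet[OF d(2) has_vector_derivative_line(2)]
    by (simp add: has_real_derivative_iff_has_vector_derivative Rr_def)
qed

definition fast_divergence ::
  "(real \<times> real \<times> real \<Rightarrow> real) \<Rightarrow> (real \<times> real \<times> real \<Rightarrow> real) \<Rightarrow> real \<times> real \<times> real \<Rightarrow> real" where
  "fast_divergence f1 f2 p =
     frechet_derivative f1 (at p) (1, 0, 0) + frechet_derivative f2 (at p) (0, 1, 0)"

text \<open>
  The area spanned by the radial vector \<open>W\<^sub>r\<close> and the fast field along the orbit; it connects
  the radial rate \<open>F\<^sub>r\<close> in the polar coordinates with the divergence in the original ones.
\<close>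

definition orbit_area ::
  "(real \<times> real \<times> real \<Rightarrow> real) \<Rightarrow> (real \<times> real \<times> real \<Rightarrow> real) \<Rightarrow>
   (real \<times> real \<times> real \<Rightarrow> real \<times> real \<times> real) \<Rightarrow> real \<Rightarrow> real" where
  "orbit_area f1 f2 W \<theta> =
     fst (frechet_derivative W (at (0, \<theta>, 0)) (1, 0, 0)) * f2 (W (0, \<theta>, 0)) -
     f1 (W (0, \<theta>, 0)) * fst (snd (frechet_derivative W (at (0, \<theta>, 0)) (1, 0, 0)))"

text \<open>
  With \<open>v = W\<^sub>r\<close> and \<open>w = X(W)\<close> on the orbit, differentiating \<open>F W\<^sub>r + W\<^sub>\<theta> = \<mu> X(W)\<close> in \<open>r\<close>
  gives \<open>v' = \<mu> DX v + \<mu>\<^sub>r w - F\<^sub>r v\<close>, while \<open>w' = \<mu> DX w\<close>. The trace of \<open>\<mu> DX\<close> survives in the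
  derivative of \<open>det(v, w)\<close>, and the term along \<open>w\<close> drops out. The area is nonzero because
  \<open>W\<^sub>r\<close> and \<open>W\<^sub>\<theta> = \<mu> w\<close> are independent and horizontal.
\<close>

lemma orbit_area_derivative:
  fixes W :: "real \<times> real \<times> real \<Rightarrow> real \<times> real \<times> real"
  assumes f1: "Ck_on (Suc 0) f1 UNIV" and f2: "Ck_on (Suc 0) f2 UNIV" and "0 < \<delta>"
    and W: "Ck_on (Suc (Suc 0)) W (tube \<delta>)"
    and Wz: "\<And>p. p \<in> tube \<delta> \<Longrightarrow> snd (snd (W p)) = snd (snd p)"
    and F: "Ck_on (Suc 0) F (tube \<delta>)" "\<And>\<theta>. F (0, \<theta>, 0) = 0"
    and \<mu>: "Ck_on (Suc 0) \<mu> (tube \<delta>)"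
    and eq: "\<And>p. p \<in> tube \<delta> \<Longrightarrow>
      frechet_derivative W (at p) (F p, 1, 0) = \<mu> p *\<^sub>R fast_field f1 f2 (W p)"
    and inj: "inj (frechet_derivative W (at (0, \<theta>, 0)))"
  shows "(orbit_area f1 f2 W has_real_derivative
      (\<mu> (0, \<theta>, 0) * fast_divergence f1 f2 (W (0, \<theta>, 0)) -
       frechet_derivative F (at (0, \<theta>, 0)) (1, 0, 0)) * orbit_area f1 f2 W \<theta>) (at \<theta>)"
    and "orbit_area f1 f2 W \<theta> \<noteq> 0"
proof -
  define Wr where "Wr = (\<lambda>p. frechet_derivative W (at p) (1, 0, 0))"
  define Wt where "Wt = (\<lambda>p. frechet_derivative W (at p) (0, 1, 0))"
  define X where "X = fast_field f1 f2"
  let ?o = "(0, \<theta>, 0) :: real \<times> real \<times> real"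
  have o: "?o \<in> tube \<delta>" using assms(3) by (simp add: tube_def)
  have C: "Ck_on (Suc 0) Wr (tube \<delta>)" "Ck_on (Suc 0) Wt (tube \<delta>)"
    unfolding Wr_def Wt_def using W by (rule Ck_on_frechet)+
  have df: "f1 differentiable (at p)" "f2 differentiable (at p)" for p
    using Ck_on_differentiable[OF f1] Ck_on_differentiable[OF f2] by auto
  have X': "(X has_derivative (\<lambda>v. (frechet_derivative f1 (at p) v, frechet_derivative f2 (at p) v, 0))) (at p)" for p
    unfolding X_def fast_field_def
    by (intro has_derivative_Pair has_derivative_frechet df has_derivative_const)
  have dX: "X differentiable (at p)" for p using X'[of p] unfolding differentiable_def by blast
  have d: "W differentiable (at ?o)" "Wr differentiable (at ?o)" "Wt differentiable (at ?o)"
    "F differentiable (at ?o)" "\<mu> differentiable (at ?o)"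
    using Ck_on_differentiable[OF W _ o] Ck_on_differentiable[OF C(1) _ o] Ck_on_differentiable[OF \<mu> _ o]
      Ck_on_differentiable[OF C(2) _ o] Ck_on_differentiable[OF F(1) _ o] by auto
  have split: "frechet_derivative W (at p) (x, y, 0) = x *\<^sub>R Wr p + y *\<^sub>R Wt p"
    if "p \<in> tube \<delta>" for p x y
    using linear_triple[OF linear_frechet_derivative[OF Ck_on_differentiable[OF W _ that]], of x y 0]
    by (simp add: Wr_def Wt_def)
  note line = has_vector_derivative_line
  note hv = has_vector_derivative_frechet[OF _ line(1)]
  define v where "v = Wr ?o"
  define w where "w = X (W ?o)"
  define m where "m = \<mu> ?o"
  define mr where "mr = frechet_derivative \<mu> (at ?o) (1, 0, 0)"
  define Fr where "Fr = frechet_derivative F (at ?o) (1, 0, 0)"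
  define DX where "DX = frechet_derivative X (at (W ?o))"
  have Wt_o: "Wt ?o = m *\<^sub>R w"
    using eq[OF o] split[OF o, of 0 1] by (simp add: F(2) X_def m_def w_def)
  have vd: "((\<lambda>r. F (r, \<theta>, 0)) has_real_derivative Fr) (at 0)"
    "((\<lambda>r. \<mu> (r, \<theta>, 0)) has_real_derivative mr) (at 0)"
    using hv[OF d(4)] hv[OF d(5)]
    by (simp_all add: has_real_derivative_iff_has_vector_derivative Fr_def mr_def)
  have "((\<lambda>r. F (r, \<theta>, 0) *\<^sub>R Wr (r, \<theta>, 0) + Wt (r, \<theta>, 0)) has_vector_derivative
      F ?o *\<^sub>R frechet_derivative Wr (at ?o) (1, 0, 0) + Fr *\<^sub>R Wr ?o +
      frechet_derivative Wt (at ?o) (1, 0, 0)) (at 0)"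
    by (intro has_vector_derivative_add has_vector_derivative_scaleR vd hv d)
  moreover have "((\<lambda>r. \<mu> (r, \<theta>, 0) *\<^sub>R X (W (r, \<theta>, 0))) has_vector_derivative
      m *\<^sub>R DX v + mr *\<^sub>R w) (at 0)"
    unfolding m_def w_def DX_def v_def Wr_def
    by (intro has_vector_derivative_scaleR vd has_vector_derivative_frechet dX
        has_vector_derivative_frechet[OF _ line(1)] d)
  then have "((\<lambda>r. F (r, \<theta>, 0) *\<^sub>R Wr (r, \<theta>, 0) + Wt (r, \<theta>, 0)) has_vector_derivative
      m *\<^sub>R DX v + mr *\<^sub>R w) (at 0)"
  proof (rule has_vector_derivative_transform_within_open[where S = "{-\<delta><..<\<delta>}"])
    fix r assume "r \<in> {-\<delta><..<\<delta>}"
    then have "(r, \<theta>, 0) \<in> tube \<delta>" using assms(3) by (auto simp: tube_def abs_less_iff)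
    from eq[OF this] split[OF this, of "F (r, \<theta>, 0)" 1]
    show "\<mu> (r, \<theta>, 0) *\<^sub>R X (W (r, \<theta>, 0)) = F (r, \<theta>, 0) *\<^sub>R Wr (r, \<theta>, 0) + Wt (r, \<theta>, 0)"
      by (simp add: X_def)
  qed (use assms(3) in auto)
  ultimately have "F ?o *\<^sub>R frechet_derivative Wr (at ?o) (1, 0, 0) + Fr *\<^sub>R Wr ?o +
      frechet_derivative Wt (at ?o) (1, 0, 0) = m *\<^sub>R DX v + mr *\<^sub>R w"
    by (rule vector_derivative_unique_at)
  moreover have "frechet_derivative Wt (at ?o) (1, 0, 0) = frechet_derivative Wr (at ?o) (0, 1, 0)"
    unfolding Wr_def Wt_def by (rule frechet_derivative_commute[OF open_tube W o])
  ultimately have "frechet_derivative Wr (at ?o) (0, 1, 0) = m *\<^sub>R DX v + mr *\<^sub>R w - Fr *\<^sub>R v"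
    by (simp add: F(2) v_def algebra_simps)
  then have v': "((\<lambda>t. Wr (0, t, 0)) has_vector_derivative m *\<^sub>R DX v + mr *\<^sub>R w - Fr *\<^sub>R v) (at \<theta>)"
    using has_vector_derivative_frechet[OF d(2) line(2)] by simp
  have w': "((\<lambda>t. X (W (0, t, 0))) has_vector_derivative m *\<^sub>R DX w) (at \<theta>)"
  proof -
    have "((\<lambda>t. W (0, t, 0)) has_vector_derivative m *\<^sub>R w) (at \<theta>)"
      using has_vector_derivative_frechet[OF d(1) line(2)] Wt_o by (simp add: Wt_def)
    from has_vector_derivative_frechet[OF dX this]
    show ?thesis using linear_cmul[OF linear_frechet_derivative[OF dX]] by (simp add: DX_def)
  qed
  have v3: "snd (snd v) = 0"
  proof -
    have "((\<lambda>r. snd (snd (W (r, \<theta>, 0)))) has_vector_derivative snd (snd v)) (at 0)"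
      unfolding v_def Wr_def
      by (intro bounded_linear.has_vector_derivative[OF bounded_linear_snd] hv d)
    moreover have "((\<lambda>r. snd (snd (W (r, \<theta>, 0)))) has_vector_derivative 0) (at 0)"
      by (rule has_vector_derivative_transform_within_open[OF has_vector_derivative_const[of 0],
            where S = "{-\<delta><..<\<delta>}"])
        (use assms(3) in \<open>auto simp: Wz tube_def abs_less_iff\<close>)
    ultimately show ?thesis by (rule vector_derivative_unique_at)
  qed
  obtain v1 v2 where v: "v = (v1, v2, 0)" using v3 by (cases v) auto
  obtain w1 w2 where w: "w = (w1, w2, 0)" by (auto simp: w_def X_def fast_field_def)
  have Wr_o: "Wr ?o = (v1, v2, 0)" and X_o: "X (W ?o) = (w1, w2, 0)"
    using v w by (simp_all only: v_def w_def)
  define a b c e where abc: "a = frechet_derivative f1 (at (W ?o)) (1, 0, 0)"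
    "b = frechet_derivative f1 (at (W ?o)) (0, 1, 0)" "c = frechet_derivative f2 (at (W ?o)) (1, 0, 0)"
    "e = frechet_derivative f2 (at (W ?o)) (0, 1, 0)"
  have DX: "DX (x, y, 0) = (x * a + y * b, x * c + y * e, 0)" for x y
    using linear_triple[OF linear_frechet_derivative[OF df(1)], of "W ?o" x y 0]
      linear_triple[OF linear_frechet_derivative[OF df(2)], of "W ?o" x y 0]
    by (simp add: DX_def frechet_derivative_eqI[OF X'] abc)
  have area: "orbit_area f1 f2 W = (\<lambda>t. fst (Wr (0, t, 0)) * fst (snd (X (W (0, t, 0)))) -
      fst (X (W (0, t, 0))) * fst (snd (Wr (0, t, 0))))"
    by (simp add: fun_eq_iff orbit_area_def Wr_def X_def fast_field_def)
  have area_o: "orbit_area f1 f2 W \<theta> = v1 * w2 - w1 * v2"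
    unfolding area by (simp add: Wr_o X_o)
  note comp = bounded_linear.has_vector_derivative[OF bounded_linear_fst]
    bounded_linear.has_vector_derivative[OF bounded_linear_snd]
  have "((\<lambda>t. fst (Wr (0, t, 0))) has_real_derivative m * (v1 * a + v2 * b) + mr * w1 - Fr * v1) (at \<theta>)"
    "((\<lambda>t. fst (snd (Wr (0, t, 0)))) has_real_derivative m * (v1 * c + v2 * e) + mr * w2 - Fr * v2) (at \<theta>)"
    "((\<lambda>t. fst (X (W (0, t, 0)))) has_real_derivative m * (w1 * a + w2 * b)) (at \<theta>)"
    "((\<lambda>t. fst (snd (X (W (0, t, 0))))) has_real_derivative m * (w1 * c + w2 * e)) (at \<theta>)"
    using comp(1)[OF v'] comp(1)[OF comp(2)[OF v']] comp(1)[OF w'] comp(1)[OF comp(2)[OF w']]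
    by (simp_all add: has_real_derivative_iff_has_vector_derivative v w DX)
  note D = this
  have "(orbit_area f1 f2 W has_real_derivative (m * (a + e) - Fr) * (v1 * w2 - w1 * v2)) (at \<theta>)"
    unfolding area
    by (rule DERIV_cong[OF DERIV_diff[OF DERIV_mult[OF D(1) D(4)] DERIV_mult[OF D(3) D(2)]]])
      (simp add: Wr_o X_o algebra_simps)
  then show "(orbit_area f1 f2 W has_real_derivative
      (\<mu> ?o * fast_divergence f1 f2 (W ?o) - frechet_derivative F (at ?o) (1, 0, 0)) *
      orbit_area f1 f2 W \<theta>) (at \<theta>)"
    unfolding area_o by (simp add: m_def Fr_def abc fast_divergence_def)
  show "orbit_area f1 f2 W \<theta> \<noteq> 0"
  proof
    assume "orbit_area f1 f2 W \<theta> = 0"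
    then have 0: "v1 * w2 = w1 * v2" by (simp add: area_o)
    define L where "L = frechet_derivative W (at ?o)"
    have L_eq: "L p = L q \<longleftrightarrow> p = q" for p q
      unfolding L_def by (rule inj_eq[OF inj])
    have L: "L (x, y, 0) = x *\<^sub>R v + (y * m) *\<^sub>R w" for x y
      using split[OF o, of x y] Wt_o by (simp add: L_def v_def)
    have "L (m * w1, - v1, 0) = L (0, 0, 0)" "L (m * w2, - v2, 0) = L (0, 0, 0)"
      using 0 by (auto simp: L v w algebra_simps)
    then have "v1 = 0" "v2 = 0" by (simp_all add: L_eq)
    then have "L (1, 0, 0) = L (0, 0, 0)" by (simp add: L v w zero_prod_def)
    then show False by (simp add: L_eq)
  qed
qed

text \<open>
  Liouville's formula: the determinant of the fundamental matrix is \<open>exp A\<close> for the antiderivative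
  \<open>A\<close> of the divergence. The product of the two multipliers is \<open>1\<close>, hence \<open>A\<close> vanishes at \<open>T\<close>, and
  by periodicity of the divergence at every multiple of \<open>T\<close>.
\<close>

lemma divergence_potential:
  assumes f1: "Ck_on (Suc 0) f1 UNIV" and f2: "Ck_on (Suc 0) f2 UNIV"
    and \<gamma>: "fast_periodic_solution f1 f2 \<gamma> T"
    and mult: "nontrivial_floquet_multiplier f1 f2 \<gamma> T 1"
  obtains A where "\<And>t. (A has_real_derivative fast_divergence f1 f2 (at_zero (\<gamma> t))) (at t)"
    "\<And>n::int. A (of_int n * T) = 0"
proof -
  define a where "a = (\<lambda>t. fast_divergence f1 f2 (at_zero (\<gamma> t)))"
  have \<gamma>': "(\<gamma> has_vector_derivative (f1 (at_zero (\<gamma> t)), f2 (at_zero (\<gamma> t)))) (at t)"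
    and per: "\<gamma> (t + T) = \<gamma> t" for t
    using \<gamma> by (auto simp: fast_periodic_solution_def)
  have "continuous_on UNIV (fast_divergence f1 f2)"
    unfolding fast_divergence_def
    by (intro continuous_intros Ck_on_continuous[OF Ck_on_frechet[OF f1]]
        Ck_on_continuous[OF Ck_on_frechet[OF f2]])
  moreover have "continuous_on UNIV (\<lambda>t. at_zero (\<gamma> t))"
    using has_vector_derivative_continuous[OF \<gamma>'] unfolding at_zero_def
    by (intro continuous_intros continuous_at_imp_continuous_on ballI)
  ultimately have "continuous_on UNIV a"
    unfolding a_def by (rule continuous_on_compose2) auto
  then have "isCont a t" for t by (simp add: continuous_on_eq_continuous_at)
  then obtain A0 where A0: "\<And>t. (A0 has_vector_derivative a t) (at t)"
    using einterval_antiderivative[of "-\<infinity>" "\<infinity>" a] by auto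
  define A where "A = (\<lambda>t. A0 t - A0 0)"
  have A: "(A has_real_derivative a t) (at t)" for t
    using A0[of t] unfolding A_def has_real_derivative_iff_has_vector_derivative
    by (auto intro!: derivative_eq_intros)
  obtain X where X: "X 0 = mat 1"
    "\<And>t. (X has_vector_derivative (fast_jacobian f1 f2 (\<gamma> t) ** X t)) (at t)"
    "\<And>s. det (mat s - X T) = (s - 1) * (s - 1)"
    using mult unfolding nontrivial_floquet_multiplier_def by blast
  have comp: "((\<lambda>t. X t $ i $ j) has_real_derivative (fast_jacobian f1 f2 (\<gamma> t) ** X t) $ i $ j) (at t)"
    for i j t
    unfolding has_real_derivative_iff_has_vector_derivative
    by (intro bounded_linear.has_vector_derivative[OF bounded_linear_vec_nth] X(2))
  (* the trace of the Jacobian is the divergence *)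
  have det': "((\<lambda>t. det (X t)) has_real_derivative a t * det (X t)) (at t)" for t
    unfolding det_2
    by (rule DERIV_cong[OF DERIV_diff[OF DERIV_mult[OF comp comp] DERIV_mult[OF comp comp]]])
      (simp add: matrix_matrix_mult_def sum_2 fast_jacobian_def a_def fast_divergence_def algebra_simps)
  have "\<forall>t. ((\<lambda>t. det (X t) * exp (- A t)) has_real_derivative 0) (at t)"
    by (auto intro!: derivative_eq_intros det' A)
  then have "det (X T) * exp (- A T) = det (X 0) * exp (- A 0)"
    by (rule DERIV_isconst_all)
  moreover have "det (X T) = 1"
    using X(3)[of 0] by (simp add: det_2 mat_def)
  ultimately have AT: "A T = 0" by (simp add: X(1) A_def)
  have "((\<lambda>t. A (t + T) - A t) has_real_derivative a (t + T) * 1 - a t) (at t)" for t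
    by (intro DERIV_diff A DERIV_chain'[where g = A, OF _ A]) (auto intro!: derivative_eq_intros)
  then have "\<forall>t. ((\<lambda>t. A (t + T) - A t) has_real_derivative 0) (at t)"
    by (simp add: a_def per)
  then have "A (t + T) - A t = A (0 + T) - A 0" for t
    by (rule DERIV_isconst_all)
  then have "A (t + T) = A t" for t using AT by (simp add: A_def)
  from periodic_int[of A T 0, OF this] have "A (of_int n * T) = 0" for n by (simp add: A_def)
  with A show thesis using that unfolding a_def by blast
qed

lemma return_time_multiple_of_period:
  assumes "fast_periodic_solution f1 f2 \<gamma> T" "\<gamma> s = \<gamma> 0"
  shows "\<exists>n::int. s = of_int n * T"
proof -
  have T: "0 < T" "\<And>t. \<gamma> (t + T) = \<gamma> t" "\<And>t. 0 < t \<Longrightarrow> t < T \<Longrightarrow> \<gamma> t \<noteq> \<gamma> 0"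
    using assms(1) by (auto simp: fast_periodic_solution_def)
  define n where "n = \<lfloor>s / T\<rfloor>"
  define r where "r = s - of_int n * T"
  have "of_int n \<le> s / T" "s / T < of_int n + 1" by (auto simp: n_def)
  then have r: "0 \<le> r" "r < T" using T(1) by (auto simp: r_def field_simps)
  have "\<gamma> r = \<gamma> 0" using periodic_int[of \<gamma> T r n, OF T(2)] assms(2) by (simp add: r_def)
  then have "r = 0" using T(3)[of r] r by fastforce
  then show ?thesis by (auto simp: r_def)
qed

text \<open>
  The function \<open>c\<close> stands for \<open>R\<^sub>\<rho>\<close> along the orbit and \<open>l\<close> for \<open>\<lambda>\<^sub>1(0)\<close>. In the product of
  \<open>c\<close> and the orbit area the terms \<open>F\<^sub>r\<close> cancel; what remains grows like
  \<open>exp(A(\<tau>(\<theta>)) - l \<theta>)\<close>, where \<open>\<tau>\<close> is the time elapsed along the orbit. Over one turn both factors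
  return to their values and \<open>\<tau>\<close> increases by a multiple of \<open>T\<close>, at which \<open>A\<close> vanishes, so
  \<open>exp(2 \<pi> l) = 1\<close>.
\<close>

lemma linear_coefficient_vanishes:
  fixes W :: "real \<times> real \<times> real \<Rightarrow> real \<times> real \<times> real"
  assumes f1: "Ck_on (Suc 0) f1 UNIV" and f2: "Ck_on (Suc 0) f2 UNIV"
    and \<gamma>: "fast_periodic_solution f1 f2 \<gamma> T"
    and mult: "nontrivial_floquet_multiplier f1 f2 \<gamma> T 1"
    and "0 < \<delta>"
    and W: "Ck_on (Suc (Suc 0)) W (tube \<delta>)" "angle_periodic \<delta> W"
    and Wz: "\<And>p. p \<in> tube \<delta> \<Longrightarrow> snd (snd (W p)) = snd (snd p)"
    and Worb: "range (\<lambda>\<theta>. W (0, \<theta>, 0)) = range (\<lambda>t. at_zero (\<gamma> t))"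
    and F: "Ck_on (Suc 0) F (tube \<delta>)" "\<And>\<theta>. F (0, \<theta>, 0) = 0"
    and \<mu>: "Ck_on (Suc 0) \<mu> (tube \<delta>)"
    and eq: "\<And>p. p \<in> tube \<delta> \<Longrightarrow>
      frechet_derivative W (at p) (F p, 1, 0) = \<mu> p *\<^sub>R fast_field f1 f2 (W p)"
    and inj: "\<And>\<theta>. inj (frechet_derivative W (at (0, \<theta>, 0)))"
    and c: "\<And>\<theta>. (c has_real_derivative
      (frechet_derivative F (at (0, \<theta>, 0)) (1, 0, 0) - l) * c \<theta>) (at \<theta>)"
      "\<And>\<theta>. c \<theta> \<noteq> 0" "\<And>\<theta>. c (\<theta> + 2 * pi) = c \<theta>"
  shows "l = 0"
proof -
  obtain A where A: "\<And>t. (A has_real_derivative fast_divergence f1 f2 (at_zero (\<gamma> t))) (at t)"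
    "\<And>n::int. A (of_int n * T) = 0"
    using divergence_potential[OF f1 f2 \<gamma> mult] by metis
  have o: "(0, \<theta>, 0) \<in> tube \<delta>" for \<theta> using assms(5) by (simp add: tube_def)
  (* The angle is counted from the point of the orbit at time 0, so that a return to this point
     can be read off from minimality of the period. *)
  have "at_zero (\<gamma> 0) \<in> range (\<lambda>\<theta>. W (0, \<theta>, 0))" unfolding Worb by simp
  then obtain \<theta>0 where \<theta>0: "at_zero (\<gamma> 0) = W (0, \<theta>0, 0)" by (rule imageE)
  define m where "m = (\<lambda>\<theta>. \<mu> (0, \<theta>, 0))"
  have "continuous_on UNIV m"
    unfolding m_def
    by (rule continuous_on_compose2[OF Ck_on_continuous[OF \<mu>]]) (use o in \<open>auto intro!: continuous_intros\<close>)
  then have "isCont m t" for t by (simp add: continuous_on_eq_continuous_at)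
  then obtain \<tau>0 where \<tau>0: "\<And>t. (\<tau>0 has_vector_derivative m t) (at t)"
    using einterval_antiderivative[of "-\<infinity>" "\<infinity>" m] by auto
  define \<tau> where "\<tau> = (\<lambda>t. \<tau>0 t - \<tau>0 \<theta>0)"
  have \<tau>: "(\<tau> has_real_derivative m t) (at t)" for t
    using \<tau>0[of t] unfolding \<tau>_def has_real_derivative_iff_has_vector_derivative
    by (auto intro!: derivative_eq_intros)
  define f where "f = (\<lambda>w. (f1 (at_zero w), f2 (at_zero w)))"
  have "Ck_on (Suc 0) at_zero UNIV"
    unfolding at_zero_def by (intro Ck_on_intros open_UNIV)
  then have f: "Ck_on (Suc 0) f UNIV"
    unfolding f_def
    by (intro Ck_on_Pair open_UNIV Ck_on_compose[OF open_UNIV open_UNIV f1]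
        Ck_on_compose[OF open_UNIV open_UNIV f2]) auto
  define y where "y = (\<lambda>\<theta>. (fst (W (0, \<theta>, 0)), fst (snd (W (0, \<theta>, 0)))))"
  have W_y: "W (0, \<theta>, 0) = at_zero (y \<theta>)" for \<theta>
    using Wz[OF o[of \<theta>]] by (simp add: y_def at_zero_def prod_eq_iff)
  have y': "(y has_vector_derivative m \<theta> *\<^sub>R f (y \<theta>)) (at \<theta>)" for \<theta>
  proof -
    have W': "((\<lambda>t. W (0, t, 0)) has_vector_derivative m \<theta> *\<^sub>R fast_field f1 f2 (W (0, \<theta>, 0))) (at \<theta>)"
      using has_vector_derivative_frechet[OF Ck_on_differentiable[OF W(1) _ o[of \<theta>]]
          has_vector_derivative_line(2)] eq[OF o[of \<theta>]]
      by (simp add: F(2) m_def)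
    note comp = bounded_linear.has_vector_derivative[OF bounded_linear_fst]
      bounded_linear.has_vector_derivative[OF bounded_linear_snd]
    from has_vector_derivative_Pair[OF comp(1)[OF W'] comp(1)[OF comp(2)[OF W']]]
    show ?thesis unfolding y_def[symmetric] by (simp add: fast_field_def W_y f_def)
  qed
  have \<gamma>': "((\<lambda>\<theta>. \<gamma> (\<tau> \<theta>)) has_vector_derivative m \<theta> *\<^sub>R f (\<gamma> (\<tau> \<theta>))) (at \<theta>)" for \<theta>
  proof -
    have "(\<gamma> has_vector_derivative f (\<gamma> t)) (at t)" for t
      using \<gamma> by (simp add: fast_periodic_solution_def f_def)
    from vector_diff_chain_at[OF \<tau>[unfolded has_real_derivative_iff_has_vector_derivative] this]
    show ?thesis by (simp add: o_def)
  qed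
  have \<gamma>_y: "\<gamma> (\<tau> \<theta>) = y \<theta>" if "\<theta> \<in> {\<theta>0..\<theta>0 + 2 * pi}" for \<theta>
  proof (rule autonomous_ODE_unique[OF f _ \<gamma>' y' _ that])
    show "continuous_on {\<theta>0..\<theta>0 + 2 * pi} m"
      using \<open>continuous_on UNIV m\<close> continuous_on_subset by blast
    show "\<gamma> (\<tau> \<theta>0) = y \<theta>0"
      using \<theta>0[symmetric] W_y[of \<theta>0] by (simp add: \<tau>_def at_zero_def prod_eq_iff)
  qed
  have W_per: "W (0, \<theta> + 2 * pi, 0) = W (0, \<theta>, 0)" for \<theta>
    using W(2) o[of \<theta>] by (auto simp: angle_periodic_def)
  have "\<gamma> (\<tau> (\<theta>0 + 2 * pi)) = \<gamma> 0"
    using \<gamma>_y[of "\<theta>0 + 2 * pi"] \<gamma>_y[of \<theta>0] by (simp add: y_def W_per \<tau>_def)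
  then obtain n :: int where n: "\<tau> (\<theta>0 + 2 * pi) = of_int n * T"
    using return_time_multiple_of_period[OF \<gamma>] by blast
  define q where "q = orbit_area f1 f2 W"
  have q': "(q has_real_derivative (m \<theta> * fast_divergence f1 f2 (W (0, \<theta>, 0)) -
      frechet_derivative F (at (0, \<theta>, 0)) (1, 0, 0)) * q \<theta>) (at \<theta>)" for \<theta>
    unfolding q_def m_def by (rule orbit_area_derivative(1)[OF f1 f2 assms(5) W(1) Wz F \<mu> eq inj])
  have q_nz: "q \<theta> \<noteq> 0" for \<theta>
    unfolding q_def by (rule orbit_area_derivative(2)[OF f1 f2 assms(5) W(1) Wz F \<mu> eq inj])
  have q_per: "q (\<theta> + 2 * pi) = q \<theta>" for \<theta>
    using angle_periodic_frechet[OF W(2,1)] o[of \<theta>]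
    by (auto simp: q_def orbit_area_def W_per angle_periodic_def)
  define J where "J = (\<lambda>\<theta>. q \<theta> * c \<theta> * exp (l * \<theta> - A (\<tau> \<theta>)))"
  have J': "(J has_real_derivative 0) (at \<theta>)" if "\<theta> \<in> {\<theta>0..\<theta>0 + 2 * pi}" for \<theta>
  proof -
    have "((\<lambda>\<theta>. A (\<tau> \<theta>)) has_real_derivative fast_divergence f1 f2 (W (0, \<theta>, 0)) * m \<theta>) (at \<theta>)"
      using DERIV_chain'[where g = A and x = \<theta>, OF \<tau> A(1)] by (simp add: \<gamma>_y[OF that] W_y)
    note D = DERIV_mult[OF DERIV_mult[OF q' c(1)] DERIV_fun_exp[OF DERIV_diff[OF DERIV_cmult_Id this]]]
    show ?thesis unfolding J_def by (rule DERIV_cong[OF D]) (simp add: algebra_simps)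
  qed
  have "J (\<theta>0 + 2 * pi) = J \<theta>0"
    by (rule DERIV_isconst_end)
      (auto intro!: J' continuous_at_imp_continuous_on DERIV_isCont[OF J'])
  moreover have "A (\<tau> (\<theta>0 + 2 * pi)) = 0" "A (\<tau> \<theta>0) = 0"
    using A(2)[of n] A(2)[of 0] by (simp_all add: n, simp add: \<tau>_def)
  ultimately have "l * (\<theta>0 + 2 * pi) = l * \<theta>0"
    using q_nz[of \<theta>0] c(2)[of \<theta>0] by (simp add: J_def q_per c(3))
  then show ?thesis by simp
qed

lemma DERIV_zero_if_superlinear:
  fixes e :: "real \<Rightarrow> real"
  assumes "0 < \<eta>" and e: "\<And>h. \<bar>h\<bar> < \<eta> \<Longrightarrow> \<bar>e h\<bar> \<le> C * \<bar>h\<bar> ^ (Suc (Suc n))"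
  shows "(e has_real_derivative 0) (at 0)"
proof -
  have "e 0 = 0" using e[of 0] assms(1) by simp
  have "((\<lambda>h. e h / h) \<longlongrightarrow> 0) (at 0)"
  proof (rule Lim_null_comparison)
    show "\<forall>\<^sub>F h in at 0. norm (e h / h) \<le> C * \<bar>h\<bar> ^ Suc n"
    proof -
      have "norm (e h / h) \<le> C * \<bar>h\<bar> ^ Suc n" if "h \<noteq> 0" "\<bar>h\<bar> < \<eta>" for h
        using e[OF that(2)] that(1) by (simp add: field_simps)
      then show ?thesis using assms(1) by (auto simp: eventually_at dist_real_def intro!: exI[of _ \<eta>])
    qed
    have "((\<lambda>h. C * \<bar>h\<bar> ^ Suc n) \<longlongrightarrow> C * \<bar>0::real\<bar> ^ Suc n) (at 0)"
      by (intro tendsto_intros)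
    then show "((\<lambda>h::real. C * \<bar>h\<bar> ^ Suc n) \<longlongrightarrow> 0) (at 0)" by simp
  qed
  then show ?thesis using \<open>e 0 = 0\<close> by (simp add: DERIV_def)
qed

lemma DERIV_polynomial_at_zero:
  fixes a :: "nat \<Rightarrow> real"
  assumes "1 \<le> N"
  shows "((\<lambda>x. \<Sum>j\<le>N. a j * x ^ j) has_real_derivative a 1) (at 0)"
proof -
  have "((\<lambda>x. \<Sum>j\<le>N. a j * x ^ j) has_real_derivative (\<Sum>j\<le>N. a j * (real j * 0 ^ (j - 1)))) (at 0)"
    by (auto intro!: derivative_eq_intros simp: mult_ac)
  also have "(\<Sum>j\<le>N. a j * (real j * 0 ^ (j - 1))) = (\<Sum>j\<le>N. if j = 1 then a 1 else 0)"
  proof (rule sum.cong[OF refl])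
    fix j :: nat
    consider "j = 0" | "j = 1" | i where "j = Suc (Suc i)" by (metis One_nat_def not0_implies_Suc)
    then show "a j * (real j * 0 ^ (j - 1)) = (if j = 1 then a 1 else 0)" by cases auto
  qed
  also have "\<dots> = a 1" using assms by simp
  finally show ?thesis .
qed

text \<open>
  The error term has order at least two in \<open>\<rho>\<close>, so it disturbs neither the value nor the
  derivative of the radial equation at \<open>\<rho> = 0\<close>.
\<close>

lemma low_coefficients_vanish:
  assumes f1: "Ck_on (Suc 0) f1 UNIV" and f2: "Ck_on (Suc 0) f2 UNIV"
    and \<gamma>: "fast_periodic_solution f1 f2 \<gamma> T"
    and mult: "nontrivial_floquet_multiplier f1 f2 \<gamma> T 1"
    and rect: "rectification (Suc (Suc k)) \<delta> f1 f2 \<gamma> H F"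
    and "0 < \<eta>" "1 \<le> N"
    and R: "Ck_on (Suc (Suc 0)) R (tube \<eta>)" "angle_periodic \<eta> R" "R (0, 0, 0) = 0"
    and R_in: "\<And>p. p \<in> tube \<eta> \<Longrightarrow> \<bar>R p\<bar> < \<delta>"
    and R\<^sub>\<rho>: "\<And>p. p \<in> tube \<eta> \<Longrightarrow> 0 < frechet_derivative R (at p) (1, 0, 0)"
    and E: "\<And>\<rho> \<theta> z. (\<rho>, \<theta>, z) \<in> tube \<eta> \<Longrightarrow> \<bar>E (\<rho>, \<theta>, z)\<bar> \<le> C * \<bar>\<rho>\<bar> ^ (N + 1)"
    and nf: "\<And>\<rho> \<theta> z. (\<rho>, \<theta>, z) \<in> tube \<eta> \<Longrightarrow>
      frechet_derivative R (at (\<rho>, \<theta>, z)) ((\<Sum>j\<le>N. lam j z * \<rho> ^ j) + E (\<rho>, \<theta>, z), 1, 0) =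
      F (R (\<rho>, \<theta>, z), \<theta>, z)"
  shows "lam 0 0 = 0" "lam 1 0 = 0" "R (0, \<theta>, 0) = 0"
proof -
  have \<delta>: "0 < \<delta>" and F: "Ck_on (Suc (Suc k)) F (tube \<delta>)" "\<And>\<theta>. F (0, \<theta>, 0) = 0"
    and oe: "orbital_equivalence (Suc (Suc k)) (tube \<delta>) (H \<circ> polar) (fast_field f1 f2) (\<lambda>p. (F p, 1, 0))"
    using rect by (auto simp: rectification_def)
  have F1: "Ck_on (Suc 0) F (tube \<delta>)" by (rule Ck_on_le[OF F(1)]) simp
  note W = rectification_coordinates[OF rect]
  have Wc: "Ck_on (Suc (Suc k)) (H \<circ> polar) (tube \<delta>)" "angle_periodic \<delta> (H \<circ> polar)"
    "\<And>p. p \<in> tube \<delta> \<Longrightarrow> bij (frechet_derivative (H \<circ> polar) (at p))"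
    "range (\<lambda>\<theta>. (H \<circ> polar) (0, \<theta>, 0)) = range (\<lambda>t. at_zero (\<gamma> t))"
    using W(1) unfolding coordinates_near_def by auto
  obtain \<mu> where \<mu>: "Ck_on (Suc (Suc k)) \<mu> (tube \<delta>)"
    "\<And>p. p \<in> tube \<delta> \<Longrightarrow> frechet_derivative (H \<circ> polar) (at p) (F p, 1, 0) =
      \<mu> p *\<^sub>R fast_field f1 f2 ((H \<circ> polar) p)"
    using oe unfolding orbital_equivalence_def by blast
  have o: "(0, \<theta>, 0) \<in> tube \<eta>" for \<theta> using \<open>0 < \<eta>\<close> by (simp add: tube_def)
  have o\<delta>: "(0, \<theta>, 0) \<in> tube \<delta>" for \<theta> using \<delta> by (simp add: tube_def)
  define c where "c = (\<lambda>\<theta>. frechet_derivative R (at (0, \<theta>, 0)) (1, 0, 0))"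
  have G0: "(\<Sum>j\<le>N. lam j z * 0 ^ j) = lam 0 z" for z
  proof -
    have "(\<Sum>j\<le>N. lam j z * 0 ^ j) = (\<Sum>j\<le>N. if j = 0 then lam 0 z else 0)"
      by (rule sum.cong) auto
    then show ?thesis by simp
  qed
  have E0: "E (0, \<theta>, 0) = 0" for \<theta> using E[OF o[of \<theta>]] by simp
  have split: "frechet_derivative R (at (0, \<theta>, 0)) (x, 1, 0) =
      c \<theta> * x + frechet_derivative R (at (0, \<theta>, 0)) (0, 1, 0)" for \<theta> x
    using linear_triple[OF linear_frechet_derivative[OF Ck_on_differentiable[OF R(1) _ o[of \<theta>]]], of x 1 0]
    by (simp add: c_def mult.commute)
  have base: "((\<lambda>\<theta>. R (0, \<theta>, 0)) has_real_derivative F (R (0, t, 0), t, 0) - c t * lam 0 0) (at t)" for t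
  proof -
    have "((\<lambda>\<theta>. R (0, \<theta>, 0)) has_real_derivative frechet_derivative R (at (0, t, 0)) (0, 1, 0)) (at t)"
      unfolding has_real_derivative_iff_has_vector_derivative
      by (rule has_vector_derivative_frechet[OF Ck_on_differentiable[OF R(1) _ o]
            has_vector_derivative_line(2)]) simp
    moreover have "frechet_derivative R (at (0, t, 0)) (0, 1, 0) = F (R (0, t, 0), t, 0) - c t * lam 0 0"
      using nf[OF o[of t]] split[of t "lam 0 0"] by (simp add: G0 E0)
    ultimately show ?thesis by simp
  qed
  have c_pos: "0 < c \<theta>" for \<theta> using R\<^sub>\<rho>[OF o] by (simp add: c_def)
  have R_per: "R (0, \<theta> + 2 * pi, 0) = R (0, \<theta>, 0)" for \<theta>
    by (rule angle_periodicD[OF R(2) o])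
  note bc = base_curve_vanishes[where F = F, OF F1 F(2) \<delta> base c_pos R_in[OF o] R(3) R_per]
  show l0: "lam 0 0 = 0" by (rule bc(1))
  show R0: "R (0, \<theta>, 0) = 0" for \<theta> by (rule bc(2))
  have c': "(c has_real_derivative
      (frechet_derivative F (at (0, \<theta>, 0)) (1, 0, 0) - lam 1 0) * c \<theta>) (at \<theta>)" for \<theta>
    unfolding c_def
  proof (rule radial_rate_derivative[OF R(1) \<open>0 < \<eta>\<close> F1 \<delta> R0])
    define e where "e = (\<lambda>\<rho>. E (\<rho>, \<theta>, 0))"
    have "\<bar>e \<rho>\<bar> \<le> C * \<bar>\<rho>\<bar> ^ Suc (Suc (N - 1))" if "\<bar>\<rho>\<bar> < \<eta>" for \<rho>
      using E[of \<rho> \<theta> 0] that \<open>0 < \<eta>\<close> \<open>1 \<le> N\<close> by (simp add: tube_def e_def)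
    from DERIV_add[OF DERIV_polynomial_at_zero[OF \<open>1 \<le> N\<close>, of "\<lambda>j. lam j 0"]
        DERIV_zero_if_superlinear[OF \<open>0 < \<eta>\<close> this]]
    show "((\<lambda>\<rho>. (\<Sum>j\<le>N. lam j 0 * \<rho> ^ j) + e \<rho>) has_real_derivative lam 1 0) (at 0)"
      by simp
    show "(\<Sum>j\<le>N. lam j 0 * 0 ^ j) + e 0 = 0" by (simp only: G0 l0 e_def E0)
    fix \<rho> :: real assume "\<bar>\<rho>\<bar> < \<eta>"
    then show "frechet_derivative R (at (\<rho>, \<theta>, 0)) ((\<Sum>j\<le>N. lam j 0 * \<rho> ^ j) + e \<rho>, 1, 0) =
        F (R (\<rho>, \<theta>, 0), \<theta>, 0)"
      using nf[of \<rho> \<theta> 0] by (simp add: tube_def e_def)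
  qed
  show "lam 1 0 = 0"
  proof (rule linear_coefficient_vanishes[OF f1 f2 \<gamma> mult \<delta> _ Wc(2) W(2) Wc(4) F1 F(2) _ \<mu>(2) _ c'])
    show "Ck_on (Suc (Suc 0)) (H \<circ> polar) (tube \<delta>)" "Ck_on (Suc 0) \<mu> (tube \<delta>)"
      by (rule Ck_on_le[OF Wc(1)] Ck_on_le[OF \<mu>(1)], simp)+
    show "inj (frechet_derivative (H \<circ> polar) (at (0, \<theta>, 0)))" for \<theta>
      by (rule bij_is_inj[OF Wc(3)[OF o\<delta>]])
    show "c \<theta> \<noteq> 0" for \<theta> using c_pos[of \<theta>] by simp
    show "c (\<theta> + 2 * pi) = c \<theta>" for \<theta>
      using angle_periodicD[OF angle_periodic_frechet[OF R(2,1)] o[of \<theta>]] by (simp add: c_def)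
  qed auto
qed

section \<open>The cubic change of the radial variable\<close>

text \<open>
  These three equations say that the substitution \<open>\<rho> = b\<^sub>1 \<sigma> + b\<^sub>2 \<sigma>\<^sup>2 + b\<^sub>3 \<sigma>\<^sup>3\<close> turns
  \<open>l\<^sub>0 + l\<^sub>1 \<rho> + l\<^sub>2 \<rho>\<^sup>2\<close> into \<open>Z - \<sigma>\<^sup>2\<close> up to order two in \<open>\<sigma>\<close>, where \<open>Z = \<kappa> z\<close>.
  They are solved one after the other, each time by a division by \<open>z\<close>. The first two divisions are
  possible as \<open>l\<^sub>0\<close> and \<open>l\<^sub>1\<close> vanish at zero. For the third the left-hand side has to vanish at
  zero, that is \<open>b\<^sub>1(0) = -1 / l\<^sub>2(0)\<close>, and this determines \<open>\<kappa>\<close>.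
\<close>

lemma cubic_normalization:
  fixes l :: "nat \<Rightarrow> real \<Rightarrow> real"
  assumes "0 < \<eta>" and l: "\<And>j. j \<le> 2 \<Longrightarrow> Ck_on (Suc (Suc k)) (l j) {-\<eta><..<\<eta>}"
    and z: "l 0 0 = 0" "l 1 0 = 0" and nz: "deriv (l 0) 0 \<noteq> 0" "l 2 0 \<noteq> 0"
  obtains \<kappa> b1 b2 b3 where "\<kappa> \<noteq> 0" "b1 0 \<noteq> 0"
    "Ck_on k b1 {-\<eta><..<\<eta>}" "Ck_on k b2 {-\<eta><..<\<eta>}" "Ck_on k b3 {-\<eta><..<\<eta>}"
    "\<And>z. z \<in> {-\<eta><..<\<eta>} \<Longrightarrow> l 0 z = \<kappa> * z * b1 z"
    "\<And>z. z \<in> {-\<eta><..<\<eta>} \<Longrightarrow> l 1 z * b1 z = 2 * (\<kappa> * z) * b2 z"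
    "\<And>z. z \<in> {-\<eta><..<\<eta>} \<Longrightarrow> b1 z + l 1 z * b2 z + l 2 z * (b1 z)\<^sup>2 = 3 * (\<kappa> * z) * b3 z"
proof -
  let ?I = "{-\<eta><..<\<eta>}"
  define \<kappa> where "\<kappa> = - l 2 0 * deriv (l 0) 0"
  have \<kappa>: "\<kappa> \<noteq> 0" using nz by (simp add: \<kappa>_def)
  obtain q0 where q0: "Ck_on (Suc k) q0 ?I" "\<And>z. z \<in> ?I \<Longrightarrow> l 0 z = z * q0 z" "q0 0 = deriv (l 0) 0"
    by (rule Hadamard_quotient[OF assms(1) l[of 0] z(1)]) auto
  obtain q1 where q1: "Ck_on (Suc k) q1 ?I" "\<And>z. z \<in> ?I \<Longrightarrow> l 1 z = z * q1 z"
    by (rule Hadamard_quotient[OF assms(1) l[of 1] z(2)]) auto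
  define b1 where "b1 = (\<lambda>z. q0 z * (1 / \<kappa>))"
  define b2 where "b2 = (\<lambda>z. q1 z * b1 z * (1 / (2 * \<kappa>)))"
  define c where "c = (\<lambda>z. b1 z + l 1 z * b2 z + l 2 z * (b1 z)\<^sup>2)"
  have C: "Ck_on (Suc k) b1 ?I" unfolding b1_def by (intro Ck_on_intros q0) auto
  then have C2: "Ck_on (Suc k) b2 ?I" unfolding b2_def by (intro Ck_on_intros q1) auto
  have "Ck_on (Suc k) c ?I"
    unfolding c_def by (intro Ck_on_intros C C2 Ck_on_SucD[OF l]) auto
  moreover have b10: "b1 0 = - 1 / l 2 0" using nz by (simp add: b1_def q0(3) \<kappa>_def)
  have "c 0 = 0" using nz(2) by (simp add: c_def b10 z power2_eq_square del: One_nat_def)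
  ultimately obtain q2 where q2: "Ck_on k q2 ?I" "\<And>z. z \<in> ?I \<Longrightarrow> c z = z * q2 z"
    using Hadamard_quotient[OF assms(1)] by metis
  define b3 where "b3 = (\<lambda>z. q2 z * (1 / (3 * \<kappa>)))"
  show thesis
  proof
    show "\<kappa> \<noteq> 0" by (rule \<kappa>)
    show "b1 0 \<noteq> 0" using b10 nz(2) by simp
    show "Ck_on k b1 ?I" "Ck_on k b2 ?I" using C C2 by (auto intro: Ck_on_SucD simp del: Ck_on.simps)
    show "Ck_on k b3 ?I" unfolding b3_def by (intro Ck_on_intros q2) auto
    fix z assume z: "z \<in> ?I"
    show "l 0 z = \<kappa> * z * b1 z" using q0(2)[OF z] \<kappa> by (simp add: b1_def)
    show "l 1 z * b1 z = 2 * (\<kappa> * z) * b2 z" using q1(2)[OF z] \<kappa> by (simp add: b2_def)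
    show "b1 z + l 1 z * b2 z + l 2 z * (b1 z)\<^sup>2 = 3 * (\<kappa> * z) * b3 z"
      using q2(2)[OF z] \<kappa> by (simp add: b3_def c_def)
  qed
qed

text \<open>
  The three hypotheses are exactly the vanishing of the coefficients of \<open>1\<close>, \<open>s\<close> and \<open>s\<^sup>2\<close>.
\<close>

lemma cubic_substitution_residual:
  fixes s Z :: real
  assumes "l0 = Z * b1" "l1 * b1 = 2 * Z * b2" "b1 + l1 * b2 + l2 * b1\<^sup>2 = 3 * Z * b3"
  defines "B \<equiv> b1 + b2 * s + b3 * s\<^sup>2"
  shows "l0 + l1 * (s * B) + l2 * (s * B)\<^sup>2 - (Z - s\<^sup>2) * (b1 + 2 * b2 * s + 3 * b3 * s\<^sup>2) =
    s ^ 3 * (l1 * b3 + 2 * b2 + 2 * l2 * b1 * b2 + s * (3 * b3 + l2 * (b2\<^sup>2 + 2 * b1 * b3)) +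
      s\<^sup>2 * (2 * l2 * b2 * b3) + s ^ 3 * (l2 * b3\<^sup>2))"
proof -
  have "l0 + l1 * (s * B) + l2 * (s * B)\<^sup>2 - (Z - s\<^sup>2) * (b1 + 2 * b2 * s + 3 * b3 * s\<^sup>2) -
    s ^ 3 * (l1 * b3 + 2 * b2 + 2 * l2 * b1 * b2 + s * (3 * b3 + l2 * (b2\<^sup>2 + 2 * b1 * b3)) +
      s\<^sup>2 * (2 * l2 * b2 * b3) + s ^ 3 * (l2 * b3\<^sup>2)) =
    (l0 - Z * b1) + s * (l1 * b1 - 2 * Z * b2) +
      s\<^sup>2 * (b1 + l1 * b2 + l2 * b1\<^sup>2 - 3 * Z * b3)"
    unfolding B_def by (simp add: algebra_simps power2_eq_square power3_eq_cube)
  also have "\<dots> = 0" using assms(1-3) by simp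
  finally show ?thesis by simp
qed

text \<open>
  The substitution fixes \<open>\<rho> = 0\<close> for every parameter value, so powers of \<open>\<rho>\<close>, and with them
  the error term \<open>E\<close>, turn into powers of \<open>\<sigma>\<close>. A shift of \<open>\<rho>\<close> that removes the linear term,
  the usual way to bring a fold to normal form, would instead leave a trace of \<open>E\<close>, depending on
  the angle, at \<open>\<sigma> = 0\<close>. The last conclusion is stated for any radial speed \<open>w\<close> that solves the
  transformed equation, since \<open>w\<close> is determined by it.
\<close>

lemma cubic_substitution:
  fixes R F :: "real \<times> real \<times> real \<Rightarrow> real"
  assumes "3 \<le> N" and "0 < \<eta>" "\<eta> \<le> \<delta>"
    and R: "Ck_on (Suc k) R (tube \<eta>)" "angle_periodic \<eta> R" "\<And>\<theta>. R (0, \<theta>, 0) = 0"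
    and R_in: "\<And>p. p \<in> tube \<eta> \<Longrightarrow> \<bar>R p\<bar> < \<delta>"
    and R\<^sub>\<rho>: "\<And>p. p \<in> tube \<eta> \<Longrightarrow> 0 < frechet_derivative R (at p) (1, 0, 0)"
    and E: "\<And>\<rho> \<theta> z. (\<rho>, \<theta>, z) \<in> tube \<eta> \<Longrightarrow> \<bar>E (\<rho>, \<theta>, z)\<bar> \<le> C * \<bar>\<rho>\<bar> ^ (N + 1)"
    and nf: "\<And>\<rho> \<theta> z. (\<rho>, \<theta>, z) \<in> tube \<eta> \<Longrightarrow>
      frechet_derivative R (at (\<rho>, \<theta>, z)) ((\<Sum>j\<le>N. lam j z * \<rho> ^ j) + E (\<rho>, \<theta>, z), 1, 0) =
      F (R (\<rho>, \<theta>, z), \<theta>, z)"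
    and lam: "\<And>j. j \<le> N \<Longrightarrow> Ck_on (Suc (Suc (Suc k))) (lam j) {-\<eta><..<\<eta>}"
    and lam0: "lam 0 0 = 0" "lam 1 0 = 0" "deriv (lam 0) 0 \<noteq> 0" "lam 2 0 \<noteq> 0"
  obtains \<kappa> \<delta>' S C' where "\<kappa> \<noteq> 0" "0 < \<delta>'" "0 \<le> C'"
    "Ck_on (Suc k) S (tube \<delta>')" "angle_periodic \<delta>' S" "\<And>\<theta>. S (0, \<theta>, 0) = 0"
    "\<And>\<sigma> \<theta> Z. (\<sigma>, \<theta>, Z) \<in> tube \<delta>' \<Longrightarrow> (S (\<sigma>, \<theta>, Z), \<theta>, Z / \<kappa>) \<in> tube \<delta>"
    "\<And>p. p \<in> tube \<delta>' \<Longrightarrow> frechet_derivative S (at p) (1, 0, 0) \<noteq> 0"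
    "\<And>\<sigma> \<theta> Z w. (\<sigma>, \<theta>, Z) \<in> tube \<delta>' \<Longrightarrow>
      frechet_derivative S (at (\<sigma>, \<theta>, Z)) (w, 1, 0) = F (S (\<sigma>, \<theta>, Z), \<theta>, Z / \<kappa>) \<Longrightarrow>
      \<bar>w - (Z - \<sigma>\<^sup>2)\<bar> \<le> C' * \<bar>\<sigma>\<bar> ^ 3"
proof -
  have lam2: "Ck_on (Suc (Suc (Suc k))) (lam j) {-\<eta><..<\<eta>}" if "j \<le> 2" for j
    using lam[of j] that assms(1) by simp
  obtain \<kappa> b1 b2 b3 where \<kappa>: "\<kappa> \<noteq> 0" and b10: "b1 0 \<noteq> 0"
    and b: "Ck_on (Suc k) b1 {-\<eta><..<\<eta>}" "Ck_on (Suc k) b2 {-\<eta><..<\<eta>}" "Ck_on (Suc k) b3 {-\<eta><..<\<eta>}"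
    and rel: "\<And>z. z \<in> {-\<eta><..<\<eta>} \<Longrightarrow> lam 0 z = \<kappa> * z * b1 z"
    "\<And>z. z \<in> {-\<eta><..<\<eta>} \<Longrightarrow> lam 1 z * b1 z = 2 * (\<kappa> * z) * b2 z"
    "\<And>z. z \<in> {-\<eta><..<\<eta>} \<Longrightarrow> b1 z + lam 1 z * b2 z + lam 2 z * (b1 z)\<^sup>2 = 3 * (\<kappa> * z) * b3 z"
    by (rule cubic_normalization[OF \<open>0 < \<eta>\<close> lam2 lam0]) (assumption, rule that)
  define z where "z = (\<lambda>p::real \<times> real \<times> real. snd (snd p) / \<kappa>)"
  define B where "B = (\<lambda>p. b1 (z p) + b2 (z p) * fst p + b3 (z p) * (fst p)\<^sup>2)"
  define r where "r = (\<lambda>p. fst p * B p)"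
  define rs where "rs = (\<lambda>p. b1 (z p) + 2 * b2 (z p) * fst p + 3 * b3 (z p) * (fst p)\<^sup>2)"
  define \<eta>1 where "\<eta>1 = \<eta> * \<bar>\<kappa>\<bar>"
  have \<eta>1: "0 < \<eta>1" using \<open>0 < \<eta>\<close> \<kappa> by (simp add: \<eta>1_def)
  have z_in: "z p \<in> {-\<eta><..<\<eta>}" if "p \<in> tube \<eta>1" for p
  proof -
    have "\<bar>snd (snd p)\<bar> < \<eta> * \<bar>\<kappa>\<bar>" using that by (auto simp: tube_def \<eta>1_def)
    then have "\<bar>z p\<bar> < \<eta>" using \<kappa> by (simp add: z_def field_simps)
    then show ?thesis by (simp add: abs_less_iff)
  qed
  have Cz: "Ck_on j z (tube \<eta>1)" for j
    unfolding z_def divide_inverse by (intro Ck_on_intros open_tube)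
  have comp: "Ck_on j (\<lambda>p. h (z p)) (tube \<eta>1)" if "Ck_on j h {-\<eta><..<\<eta>}" for h :: "real \<Rightarrow> real" and j
    by (rule Ck_on_compose[OF open_tube _ that Cz z_in]) auto
  have CB: "Ck_on (Suc k) B (tube \<eta>1)" and Crs: "Ck_on (Suc k) rs (tube \<eta>1)"
    unfolding B_def rs_def by (intro Ck_on_intros open_tube comp b)+
  have Cr: "Ck_on (Suc k) r (tube \<eta>1)"
    unfolding r_def by (intro Ck_on_intros open_tube CB)
  have flat: "z (\<sigma>, \<theta>, Z) = z (\<sigma>, 0, Z)" "B (\<sigma>, \<theta>, Z) = B (\<sigma>, 0, Z)" "r (\<sigma>, \<theta>, Z) = r (\<sigma>, 0, Z)"
    "rs (\<sigma>, \<theta>, Z) = rs (\<sigma>, 0, Z)" for \<sigma> \<theta> Z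
    by (simp_all add: z_def B_def r_def rs_def)
  define \<beta> where "\<beta> = \<bar>b1 0\<bar> / 2"
  have \<beta>: "0 < \<beta>" using b10 by (simp add: \<beta>_def)
  (* Near the origin the substitution stays in the domain of R and has a radial derivative
     bounded away from zero; neither r nor rs depends on the angle. *)
  define V where "V = tube \<eta>1 \<inter> (\<lambda>p. (r p, rs p)) -` ({-\<eta><..<\<eta>} \<times> {y. \<beta> < \<bar>y\<bar>})"
  have "open V" unfolding V_def
    by (intro continuous_open_preimage open_tube continuous_on_Pair Ck_on_continuous[OF Cr]
        Ck_on_continuous[OF Crs] open_Times open_Collect_less continuous_intros)
  moreover have "(0, 0, 0) \<in> V"
    using \<eta>1 \<beta> \<open>0 < \<eta>\<close> by (auto simp: V_def tube_def r_def rs_def z_def \<beta>_def)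
  ultimately obtain e where e: "0 < e" "ball (0, 0, 0) e \<subseteq> V" using openE by blast
  define \<delta>1 where "\<delta>1 = e / 2"
  have V: "p \<in> tube \<eta>1" "\<bar>r p\<bar> < \<eta>" "\<beta> < \<bar>rs p\<bar>" if "p \<in> tube \<delta>1" for p
  proof -
    obtain \<sigma> \<theta> Z where p: "p = (\<sigma>, \<theta>, Z)" by (cases p)
    have "dist (0, 0, 0) (\<sigma>, 0, Z) \<le> \<bar>\<sigma>\<bar> + \<bar>Z\<bar>"
      by (simp add: dist_Pair_Pair dist_real_def sqrt_sum_squares_le_sum_abs[of \<sigma> Z, simplified])
    also have "\<dots> < e" using that by (simp add: p tube_def \<delta>1_def)
    finally have "(\<sigma>, 0, Z) \<in> V" using e(2) by auto
    then show "p \<in> tube \<eta>1" "\<bar>r p\<bar> < \<eta>" "\<beta> < \<bar>rs p\<bar>"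
      unfolding p flat(3)[of \<sigma> \<theta>] flat(4)[of \<sigma> \<theta>] by (auto simp: V_def tube_def abs_less_iff)
  qed
  define Q where "Q = (\<lambda>p. (r p, fst (snd p), z p))"
  define S where "S = (\<lambda>p. R (Q p))"
  have sub: "tube \<delta>1 \<subseteq> tube \<eta>1" using V(1) by auto
  have CQ: "Ck_on (Suc k) Q (tube \<delta>1)"
    unfolding Q_def by (rule Ck_on_subset[OF _ sub]) (intro Ck_on_intros open_tube Cr Cz)
  have Q_in: "Q p \<in> tube \<eta>" if "p \<in> tube \<delta>1" for p
    using V(2)[OF that] z_in[OF V(1)[OF that]] by (simp add: Q_def tube_def abs_less_iff)
  have CS: "Ck_on (Suc k) S (tube \<delta>1)"
    unfolding S_def by (rule Ck_on_compose[OF open_tube open_tube R(1) CQ Q_in])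
  have S_per: "angle_periodic \<delta>1 S"
    unfolding angle_periodic_def
  proof safe
    fix \<sigma> \<theta> Z assume "(\<sigma>, \<theta>, Z) \<in> tube \<delta>1"
    from angle_periodicD[OF R(2) Q_in[OF this, unfolded Q_def]]
    show "S (\<sigma>, \<theta> + 2 * pi, Z) = S (\<sigma>, \<theta>, Z)"
      by (simp add: S_def Q_def flat(1)[of \<sigma> "\<theta> + 2 * pi"] flat(1)[of \<sigma> \<theta>]
          flat(3)[of \<sigma> "\<theta> + 2 * pi"] flat(3)[of \<sigma> \<theta>])
  qed
  have S': "frechet_derivative S (at p) (x, y, 0) = frechet_derivative R (at (Q p)) (x * rs p, y, 0)"
    if p: "p \<in> tube \<delta>1" for p x y
  proof -
    obtain \<sigma> \<theta> Z where pp: "p = (\<sigma>, \<theta>, Z)" by (cases p)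
    have dr: "r differentiable (at p)"
      by (rule Ck_on_differentiable[OF Cr _ V(1)[OF p]]) simp
    have "((\<lambda>s. r (s, \<theta>, Z)) has_real_derivative rs p) (at \<sigma>)"
      unfolding r_def B_def rs_def pp z_def
      by (auto intro!: derivative_eq_intros simp: algebra_simps power2_eq_square)
    moreover have "((\<lambda>s. r (s, \<theta>, Z)) has_real_derivative frechet_derivative r (at p) (1, 0, 0)) (at \<sigma>)"
      unfolding has_real_derivative_iff_has_vector_derivative pp
      by (rule has_vector_derivative_frechet[OF dr[unfolded pp] has_vector_derivative_line(1)])
    ultimately have r1: "frechet_derivative r (at p) (1, 0, 0) = rs p" by (rule DERIV_unique[symmetric])
    have "((\<lambda>t. r (\<sigma>, t, Z)) has_real_derivative 0) (at \<theta>)"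
      by (simp add: r_def B_def z_def)
    moreover have "((\<lambda>t. r (\<sigma>, t, Z)) has_real_derivative frechet_derivative r (at p) (0, 1, 0)) (at \<theta>)"
      unfolding has_real_derivative_iff_has_vector_derivative pp
      by (rule has_vector_derivative_frechet[OF dr[unfolded pp] has_vector_derivative_line(2)])
    ultimately have r2: "frechet_derivative r (at p) (0, 1, 0) = 0" by (rule DERIV_unique[symmetric])
    have rxy: "frechet_derivative r (at p) (x, y, 0) = x * rs p"
      using linear_triple[OF linear_frechet_derivative[OF dr], of x y 0] r1 r2 by simp
    have "(Q has_derivative (\<lambda>v. (frechet_derivative r (at p) v, fst (snd v), snd (snd v) / \<kappa>))) (at p)"
      unfolding Q_def z_def
      by (intro has_derivative_Pair has_derivative_frechet dr)
        (use \<kappa> in \<open>auto intro!: derivative_eq_intros\<close>)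
    from diff_chain_at[OF this Ck_on_has_derivative[OF R(1) _ Q_in[OF p]]]
    have "frechet_derivative S (at p) = frechet_derivative R (at (Q p)) \<circ>
        (\<lambda>v. (frechet_derivative r (at p) v, fst (snd v), snd (snd v) / \<kappa>))"
      by (intro frechet_derivative_eqI) (simp add: S_def o_def)
    then show ?thesis by (simp add: rxy)
  qed
  have linR: "linear (frechet_derivative R (at (Q p)))" if "p \<in> tube \<delta>1" for p
    using Ck_on_differentiable[OF R(1) _ Q_in[OF that]] by (simp add: linear_frechet_derivative)
  have linS: "linear (frechet_derivative S (at p))" if "p \<in> tube \<delta>1" for p
    using Ck_on_differentiable[OF CS _ that] by (simp add: linear_frechet_derivative)
  have S\<^sub>\<sigma>: "frechet_derivative S (at p) (1, 0, 0) \<noteq> 0" if p: "p \<in> tube \<delta>1" for p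
  proof -
    have "frechet_derivative S (at p) (1, 0, 0) = rs p * frechet_derivative R (at (Q p)) (1, 0, 0)"
      using S'[OF p, of 1 0] linear_triple[OF linR[OF p], of "rs p" 0 0] by simp
    then show ?thesis using R\<^sub>\<rho>[OF Q_in[OF p]] V(3)[OF p] \<beta> by simp
  qed
  (* P is the cofactor of the residual, t collects the terms of degree at least three, and K controls
     the error term; all are independent of the angle, hence bounded on a smaller tube. *)
  define P where "P = (\<lambda>p. lam 1 (z p) * b3 (z p) + 2 * b2 (z p) + 2 * lam 2 (z p) * b1 (z p) * b2 (z p) +
      fst p * (3 * b3 (z p) + lam 2 (z p) * ((b2 (z p))\<^sup>2 + 2 * b1 (z p) * b3 (z p))) +
      (fst p)\<^sup>2 * (2 * lam 2 (z p) * b2 (z p) * b3 (z p)) + fst p ^ 3 * (lam 2 (z p) * (b3 (z p))\<^sup>2))"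
  define t where "t = (\<lambda>p. \<Sum>j=3..N. lam j (z p) * r p ^ (j - 3))"
  define M where "M = (\<lambda>p. P p + B p ^ 3 * t p)"
  define K where "K = (\<lambda>p. B p ^ 3 * r p ^ (N - 2))"
  have Cb: "Ck_on 0 (\<lambda>p. b1 (z p)) (tube \<eta>1)" "Ck_on 0 (\<lambda>p. b2 (z p)) (tube \<eta>1)"
    "Ck_on 0 (\<lambda>p. b3 (z p)) (tube \<eta>1)"
    by (rule Ck_on_le[OF comp[OF b(1)]] Ck_on_le[OF comp[OF b(2)]] Ck_on_le[OF comp[OF b(3)]], simp)+
  have Cl: "Ck_on 0 (\<lambda>p. lam j (z p)) (tube \<eta>1)" if "j \<le> N" for j
    by (rule Ck_on_le[OF comp[OF lam[OF that]]]) simp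
  have Cl12: "Ck_on 0 (\<lambda>p. lam 1 (z p)) (tube \<eta>1)" "Ck_on 0 (\<lambda>p. lam 2 (z p)) (tube \<eta>1)"
    by (rule Cl, use assms(1) in simp)+
  have Cr0: "Ck_on 0 r (tube \<eta>1)" and CB0: "Ck_on 0 B (tube \<eta>1)"
    by (rule Ck_on_le[OF Cr] Ck_on_le[OF CB], simp)+
  have "Ck_on 0 P (tube \<eta>1)"
    unfolding P_def by (intro Ck_on_intros open_tube Cb Cl12)
  moreover have "Ck_on 0 t (tube \<eta>1)"
    unfolding t_def by (intro Ck_on_intros open_tube Cr0 Cl) auto
  ultimately have "Ck_on 0 M (tube \<eta>1)"
    unfolding M_def by (intro Ck_on_add Ck_on_mult Ck_on_power open_tube CB0)
  moreover have "Ck_on 0 K (tube \<eta>1)"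
    unfolding K_def by (intro Ck_on_intros open_tube CB0 Cr0)
  ultimately have MK: "continuous_on (tube \<delta>1) M" "continuous_on (tube \<delta>1) K"
    by (auto intro: continuous_on_subset[OF _ sub])
  have per: "angle_periodic \<delta>1 M" "angle_periodic \<delta>1 K"
    by (auto simp: angle_periodic_def M_def K_def P_def t_def z_def B_def r_def)
  define \<delta>' where "\<delta>' = \<delta>1 / 2"
  have \<delta>': "0 < \<delta>'" "\<delta>' < \<delta>1" using e by (auto simp: \<delta>'_def \<delta>1_def)
  obtain BM where BM: "0 < BM" "\<And>p. p \<in> tube \<delta>' \<Longrightarrow> norm (M p) \<le> BM"
    using angle_periodic_bounded[OF per(1) MK(1) \<delta>'(2)] by metis
  obtain BK where BK: "0 < BK" "\<And>p. p \<in> tube \<delta>' \<Longrightarrow> norm (K p) \<le> BK"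
    using angle_periodic_bounded[OF per(2) MK(2) \<delta>'(2)] by metis
  have sub': "tube \<delta>' \<subseteq> tube \<delta>1" using \<delta>' by (intro tube_mono) simp
  define C' where "C' = (BM + \<bar>C\<bar> * BK) / \<beta>"
  show thesis
  proof
    show "\<kappa> \<noteq> 0" "0 < \<delta>'" by fact+
    show "0 \<le> C'" using BM BK \<beta> by (simp add: C'_def)
    show "Ck_on (Suc k) S (tube \<delta>')" by (rule Ck_on_subset[OF CS sub'])
    show "angle_periodic \<delta>' S" using S_per sub' unfolding angle_periodic_def by blast
    show "S (0, \<theta>, 0) = 0" for \<theta> using R(3) by (simp add: S_def Q_def r_def z_def)
    show "frechet_derivative S (at p) (1, 0, 0) \<noteq> 0" if "p \<in> tube \<delta>'" for p
      using S\<^sub>\<sigma> sub' that by blast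
  next
    fix \<sigma> \<theta> Z assume "(\<sigma>, \<theta>, Z) \<in> tube \<delta>'"
    then have p: "(\<sigma>, \<theta>, Z) \<in> tube \<delta>1" using sub' by blast
    have "z (\<sigma>, \<theta>, Z) \<in> {-\<eta><..<\<eta>}" by (rule z_in[OF V(1)[OF p]])
    then have "\<bar>Z / \<kappa>\<bar> < \<eta>" unfolding z_def by (simp only: snd_conv greaterThanLessThan_iff abs_less_iff) simp
    then show "(S (\<sigma>, \<theta>, Z), \<theta>, Z / \<kappa>) \<in> tube \<delta>"
      using R_in[OF Q_in[OF p]] \<open>\<eta> \<le> \<delta>\<close> by (simp add: tube_def S_def)
  next
    fix \<sigma> \<theta> Z w
    assume p': "(\<sigma>, \<theta>, Z) \<in> tube \<delta>'"
      and w: "frechet_derivative S (at (\<sigma>, \<theta>, Z)) (w, 1, 0) = F (S (\<sigma>, \<theta>, Z), \<theta>, Z / \<kappa>)"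
    let ?p = "(\<sigma>, \<theta>, Z)"
    have p: "?p \<in> tube \<delta>1" using p' sub' by blast
    define G where "G = (\<Sum>j\<le>N. lam j (z ?p) * r ?p ^ j)"
    define Ep where "Ep = E (Q ?p)"
    have Qp: "Q ?p = (r ?p, \<theta>, z ?p)" by (simp add: Q_def)
    have rs: "rs ?p \<noteq> 0" using V(3)[OF p] \<beta> by auto
    have "frechet_derivative S (at ?p) ((G + Ep) / rs ?p, 1, 0) = frechet_derivative S (at ?p) (w, 1, 0)"
      using S'[OF p, of "(G + Ep) / rs ?p" 1] nf[OF Q_in[OF p, unfolded Qp]] rs w
      by (simp add: G_def Ep_def Qp S_def z_def)
    then have "(G + Ep) / rs ?p * frechet_derivative S (at ?p) (1, 0, 0) =
        w * frechet_derivative S (at ?p) (1, 0, 0)"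
      using linear_triple[OF linS[OF p], of "(G + Ep) / rs ?p" 1 0] linear_triple[OF linS[OF p], of w 1 0]
      by simp
    then have "w = (G + Ep) / rs ?p" by (rule mult_right_cancel[OF S\<^sub>\<sigma>[OF p], THEN iffD1, symmetric])
    then have w_rs: "w * rs ?p = G + Ep" using rs by simp
    have zI: "z ?p \<in> {-\<eta><..<\<eta>}" by (rule z_in[OF V(1)[OF p]])
    have \<kappa>z: "\<kappa> * z ?p = Z" using \<kappa> by (simp add: z_def)
    have "G = lam 0 (z ?p) + lam 1 (z ?p) * r ?p + lam 2 (z ?p) * (r ?p)\<^sup>2 + r ?p ^ 3 * t ?p"
    proof -
      have "{..N} = {0, 1, 2} \<union> {3..N}" using assms(1) by auto
      then have "G = (\<Sum>j\<in>{0, 1, 2}. lam j (z ?p) * r ?p ^ j) + (\<Sum>j=3..N. lam j (z ?p) * r ?p ^ j)"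
        unfolding G_def by (simp only:) (subst sum.union_disjoint, auto)
      moreover have "(\<Sum>j=3..N. lam j (z ?p) * r ?p ^ j) = r ?p ^ 3 * t ?p"
        unfolding t_def sum_distrib_left
        by (rule sum.cong) (auto simp: power_add[symmetric] mult.left_commute)
      ultimately show ?thesis by (simp add: add.assoc)
    qed
    also have "\<dots> = (Z - \<sigma>\<^sup>2) * rs ?p + \<sigma> ^ 3 * P ?p + r ?p ^ 3 * t ?p"
      using cubic_substitution_residual[OF rel[OF zI, unfolded \<kappa>z], of \<sigma>]
      by (simp add: r_def B_def rs_def P_def)
    finally have "(w - (Z - \<sigma>\<^sup>2)) * rs ?p = \<sigma> ^ 3 * M ?p + Ep"
      using w_rs by (simp add: M_def r_def power_mult_distrib algebra_simps)
    then have "\<bar>w - (Z - \<sigma>\<^sup>2)\<bar> * \<bar>rs ?p\<bar> = \<bar>\<sigma> ^ 3 * M ?p + Ep\<bar>"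
      by (simp only: abs_mult[symmetric])
    also have "\<dots> \<le> \<bar>\<sigma> ^ 3 * M ?p\<bar> + \<bar>Ep\<bar>" by (rule abs_triangle_ineq)
    also have "\<bar>\<sigma> ^ 3 * M ?p\<bar> \<le> \<bar>\<sigma>\<bar> ^ 3 * BM"
      using BM(2)[OF p'] by (simp add: abs_mult power_abs mult_left_mono)
    also have "\<bar>Ep\<bar> \<le> \<bar>\<sigma>\<bar> ^ 3 * (\<bar>C\<bar> * BK)"
    proof -
      have "\<bar>Ep\<bar> \<le> C * \<bar>r ?p\<bar> ^ (N + 1)"
        unfolding Ep_def Qp by (rule E[OF Q_in[OF p, unfolded Qp]])
      also have "\<dots> \<le> \<bar>C\<bar> * \<bar>r ?p\<bar> ^ (N + 1)" by (intro mult_right_mono) auto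
      also have "\<bar>r ?p\<bar> ^ (N + 1) = \<bar>r ?p\<bar> ^ 3 * \<bar>r ?p\<bar> ^ (N - 2)"
        using assms(1) by (simp add: power_add[symmetric])
      also have "\<dots> = \<bar>\<sigma>\<bar> ^ 3 * \<bar>K ?p\<bar>"
        by (simp add: K_def abs_mult power_abs r_def[of] power_mult_distrib)
      also have "\<bar>C\<bar> * (\<bar>\<sigma>\<bar> ^ 3 * \<bar>K ?p\<bar>) \<le> \<bar>C\<bar> * (\<bar>\<sigma>\<bar> ^ 3 * BK)"
        using BK(2)[OF p'] by (intro mult_left_mono) auto
      finally show ?thesis by (simp add: mult_ac)
    qed
    finally have *: "\<bar>w - (Z - \<sigma>\<^sup>2)\<bar> * \<bar>rs ?p\<bar> \<le> \<bar>\<sigma>\<bar> ^ 3 * (BM + \<bar>C\<bar> * BK)"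
      by (simp add: algebra_simps)
    have "\<bar>w - (Z - \<sigma>\<^sup>2)\<bar> * \<beta> \<le> \<bar>w - (Z - \<sigma>\<^sup>2)\<bar> * \<bar>rs ?p\<bar>"
      using V(3)[OF p] by (intro mult_left_mono) auto
    with * have "\<bar>w - (Z - \<sigma>\<^sup>2)\<bar> * \<beta> \<le> \<bar>\<sigma>\<bar> ^ 3 * (BM + \<bar>C\<bar> * BK)" by simp
    then show "\<bar>w - (Z - \<sigma>\<^sup>2)\<bar> \<le> C' * \<bar>\<sigma>\<bar> ^ 3"
      using \<beta> by (simp add: C'_def field_simps)
  qed
qed

section \<open>Fold coordinates for the fast system\<close>

lemma Ck_on_radial_change:
  assumes \<phi>: "\<And>i. i \<le> N \<Longrightarrow> Ck_on k (\<phi> i) (UNIV \<times> {-\<eta><..<\<eta>})" and "1 \<le> N"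
  shows "Ck_on k (radial_change N \<phi>) (tube \<eta>)"
proof -
  have "Ck_on k (\<lambda>p. \<phi> i (snd p)) (tube \<eta>)" if "i \<le> N" for i
    by (rule Ck_on_compose[OF open_tube _ \<phi>[OF that] Ck_on_snd[OF open_tube Ck_on_ident[OF open_tube]]])
      (auto simp: tube_def abs_less_iff open_Times)
  then show ?thesis
    unfolding radial_change_def split_beta prod.collapse using assms(2)
    by (intro Ck_on_intros open_tube) auto
qed

text \<open>
  The composition of the rectification, the change to the normal form and the cubic substitution:
  coordinates in which the fast field is, up to a factor, \<open>(\<omega>, 1, 0)\<close> with
  \<open>\<omega> = Z - \<sigma>\<^sup>2 + O(\<sigma>\<^sup>3)\<close>. The speed \<open>\<omega>\<close> is obtained by solving the transformed equation, not
  from the normal form, because the error term of the latter is not known to be smooth.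
\<close>

lemma fold_coordinates:
  assumes "3 \<le> N"
    and f1: "Ck_on (Suc 0) f1 UNIV" and f2: "Ck_on (Suc 0) f2 UNIV"
    and \<gamma>: "fast_periodic_solution f1 f2 \<gamma> T"
    and mult: "nontrivial_floquet_multiplier f1 f2 \<gamma> T 1"
    and lam: "coefficient_functions (Suc (Suc (Suc m))) N f1 f2 \<gamma> lam"
    and nd: "deriv (lam 0) 0 \<noteq> 0" "lam 2 0 \<noteq> 0"
  obtains \<delta> \<kappa> \<Phi> \<omega> \<nu> C where "0 < \<delta>" "\<kappa> \<noteq> 0" "0 \<le> C"
    "coordinates_near (Suc m) \<delta> (range (\<lambda>t. at_zero (\<gamma> t))) \<Phi>"
    "\<And>p. p \<in> tube \<delta> \<Longrightarrow> snd (snd (\<Phi> p)) = snd (snd p) / \<kappa>"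
    "Ck_on m \<omega> (tube \<delta>)" "angle_periodic \<delta> \<omega>"
    "Ck_on m \<nu> (tube \<delta>)" "angle_periodic \<delta> \<nu>" "\<And>p. p \<in> tube \<delta> \<Longrightarrow> \<nu> p \<noteq> 0"
    "\<And>p. p \<in> tube \<delta> \<Longrightarrow>
      frechet_derivative \<Phi> (at p) (\<omega> p, 1, 0) = \<nu> p *\<^sub>R fast_field f1 f2 (\<Phi> p)"
    "\<And>\<sigma> \<theta> Z. (\<sigma>, \<theta>, Z) \<in> tube \<delta> \<Longrightarrow> \<bar>\<omega> (\<sigma>, \<theta>, Z) - (Z - \<sigma>\<^sup>2)\<bar> \<le> C * \<bar>\<sigma>\<bar> ^ 3"
proof -
  let ?k = "Suc (Suc (Suc m))"
  obtain \<delta>0 H F where rect: "rectification ?k \<delta>0 f1 f2 \<gamma> H F"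
    and nform: "fast_normal_form ?k N \<delta>0 F lam"
    using lam unfolding coefficient_functions_def by blast
  have F: "Ck_on ?k F (tube \<delta>0)" "angle_periodic \<delta>0 F"
    and oe: "orbital_equivalence ?k (tube \<delta>0) (H \<circ> polar) (fast_field f1 f2) (\<lambda>p. (F p, 1, 0))"
    using rect by (auto simp: rectification_def)
  define W where "W = H \<circ> polar"
  have W: "coordinates_near ?k \<delta>0 (range (\<lambda>t. at_zero (\<gamma> t))) W"
    "\<And>p. p \<in> tube \<delta>0 \<Longrightarrow> snd (snd (W p)) = snd (snd p)"
    using rectification_coordinates[OF rect] by (auto simp: W_def)
  have Wc: "Ck_on ?k W (tube \<delta>0)" "angle_periodic \<delta>0 W"
    "\<And>p. p \<in> tube \<delta>0 \<Longrightarrow> bij (frechet_derivative W (at p))"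
    using W(1) unfolding coordinates_near_def by auto
  obtain \<mu> where \<mu>: "Ck_on ?k \<mu> (tube \<delta>0)" "\<And>p. p \<in> tube \<delta>0 \<Longrightarrow> \<mu> p \<noteq> 0"
    "\<And>p. p \<in> tube \<delta>0 \<Longrightarrow> frechet_derivative W (at p) (F p, 1, 0) = \<mu> p *\<^sub>R fast_field f1 f2 (W p)"
    using oe unfolding orbital_equivalence_def W_def by blast
  have \<mu>_per: "angle_periodic \<delta>0 \<mu>"
    by (rule time_rescaling_periodic[OF Wc(1,2) _ Wc(3) F(2) \<mu>(3)]) simp
  obtain \<eta> \<phi> E C where \<eta>: "0 < \<eta>" "\<eta> \<le> \<delta>0"
    and \<phi>: "\<And>i. i \<le> N \<Longrightarrow> Ck_on ?k (\<phi> i) (UNIV \<times> {-\<eta><..<\<eta>})"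
      "\<And>i z. i \<le> N \<Longrightarrow> z \<in> {-\<eta><..<\<eta>} \<Longrightarrow> \<phi> i (0, z) = 0"
      "\<And>i z \<theta>. i \<le> N \<Longrightarrow> z \<in> {-\<eta><..<\<eta>} \<Longrightarrow> \<phi> i (\<theta> + 2 * pi, z) = \<phi> i (\<theta>, z)"
    and Clam: "\<And>j. j \<le> N \<Longrightarrow> Ck_on ?k (lam j) {-\<eta><..<\<eta>}"
    and nf0: "\<forall>(\<rho>, \<theta>, z) \<in> tube \<eta>.
           \<bar>radial_change N \<phi> (\<rho>, \<theta>, z)\<bar> < \<delta>0 \<and>
           0 < frechet_derivative (radial_change N \<phi>) (at (\<rho>, \<theta>, z)) (1, 0, 0) \<and>
           \<bar>E (\<rho>, \<theta>, z)\<bar> \<le> C * \<bar>\<rho>\<bar> ^ (N + 1) \<and>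
           frechet_derivative (radial_change N \<phi>) (at (\<rho>, \<theta>, z))
             ((\<Sum>j\<le>N. lam j z * \<rho> ^ j) + E (\<rho>, \<theta>, z), 1, 0)
           = F (radial_change N \<phi> (\<rho>, \<theta>, z), \<theta>, z)"
    using nform unfolding fast_normal_form_def by blast
  define R where "R = radial_change N \<phi>"
  have nf: "\<bar>R (\<rho>, \<theta>, z)\<bar> < \<delta>0" "0 < frechet_derivative R (at (\<rho>, \<theta>, z)) (1, 0, 0)"
    "\<bar>E (\<rho>, \<theta>, z)\<bar> \<le> C * \<bar>\<rho>\<bar> ^ (N + 1)"
    "frechet_derivative R (at (\<rho>, \<theta>, z)) ((\<Sum>j\<le>N. lam j z * \<rho> ^ j) + E (\<rho>, \<theta>, z), 1, 0) =
      F (R (\<rho>, \<theta>, z), \<theta>, z)"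
    if "(\<rho>, \<theta>, z) \<in> tube \<eta>" for \<rho> \<theta> z
    using bspec[OF nf0 that] unfolding R_def by auto
  have R: "Ck_on ?k R (tube \<eta>)"
    unfolding R_def using assms(1) by (intro Ck_on_radial_change \<phi>) auto
  have R_per: "angle_periodic \<eta> R"
    using assms(1) by (auto simp: angle_periodic_def R_def radial_change_def tube_def abs_less_iff \<phi>(3))
  have R_o: "R (0, 0, 0) = 0"
  proof -
    have "(\<Sum>i=2..N. 0 ^ i * \<phi> i (0, 0)) = 0" by (rule sum.neutral) auto
    then show ?thesis using \<phi>(2)[of 0 0] \<eta>(1) by (simp add: R_def radial_change_def)
  qed
  note low = low_coefficients_vanish[OF f1 f2 \<gamma> mult rect \<eta>(1) _ _ R_per R_o _ _ nf(3,4)]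
  have R2: "Ck_on (Suc (Suc 0)) R (tube \<eta>)" by (rule Ck_on_le[OF R]) simp
  have lam0: "lam 0 0 = 0" and lam1: "lam 1 0 = 0" and R0: "R (0, \<theta>, 0) = 0" for \<theta>
    by (rule low; use assms(1) R2 nf(1,2) in \<open>auto simp del: Ck_on.simps\<close>)+
  obtain \<kappa> \<delta> S C' where \<kappa>: "\<kappa> \<noteq> 0" and \<delta>: "0 < \<delta>" and C': "0 \<le> C'"
    and S: "Ck_on (Suc m) S (tube \<delta>)" "angle_periodic \<delta> S" "\<And>\<theta>. S (0, \<theta>, 0) = 0"
    and S_in: "\<And>\<sigma> \<theta> Z. (\<sigma>, \<theta>, Z) \<in> tube \<delta> \<Longrightarrow> (S (\<sigma>, \<theta>, Z), \<theta>, Z / \<kappa>) \<in> tube \<delta>0"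
    and S\<^sub>\<sigma>: "\<And>p. p \<in> tube \<delta> \<Longrightarrow> frechet_derivative S (at p) (1, 0, 0) \<noteq> 0"
    and S_w: "\<And>\<sigma> \<theta> Z w. (\<sigma>, \<theta>, Z) \<in> tube \<delta> \<Longrightarrow>
      frechet_derivative S (at (\<sigma>, \<theta>, Z)) (w, 1, 0) = F (S (\<sigma>, \<theta>, Z), \<theta>, Z / \<kappa>) \<Longrightarrow>
      \<bar>w - (Z - \<sigma>\<^sup>2)\<bar> \<le> C' * \<bar>\<sigma>\<bar> ^ 3"
  proof (rule cubic_substitution[OF assms(1) \<eta> _ R_per R0 _ _ nf(3,4) Clam lam0 lam1 nd])
    show "Ck_on (Suc m) R (tube \<eta>)" by (rule Ck_on_le[OF R]) simp
  qed (use nf(1,2) that in auto)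
  define \<Psi> where "\<Psi> = (\<lambda>p. (S p, fst (snd p), snd (snd p) / \<kappa>))"
  have W': "coordinates_near (Suc m) \<delta>0 (range (\<lambda>t. at_zero (\<gamma> t))) W"
    by (rule coordinates_near_mono[OF W(1)]) simp_all
  have m1: "1 \<le> Suc m" by simp
  note sub = radial_substitution[OF W' m1 \<kappa> \<delta> S(1,2) S_in S\<^sub>\<sigma> S(3)]
  have \<Phi>: "coordinates_near (Suc m) \<delta> (range (\<lambda>t. at_zero (\<gamma> t))) (W \<circ> \<Psi>)"
    unfolding \<Psi>_def by (rule sub(1))
  have "Ck_on (Suc m) \<Psi> (tube \<delta>)"
    unfolding \<Psi>_def by (rule sub(2))
  then have C\<Psi>: "Ck_on m \<Psi> (tube \<delta>)" by (rule Ck_on_SucD)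
  have \<Psi>_in: "\<Psi> p \<in> tube \<delta>0" if "p \<in> tube \<delta>" for p
    unfolding \<Psi>_def by (rule sub(3), assumption, assumption, rule that)
  have \<Phi>': "frechet_derivative (W \<circ> \<Psi>) (at p) v =
      frechet_derivative W (at (\<Psi> p)) (frechet_derivative S (at p) v, fst (snd v), snd (snd v) / \<kappa>)"
    if "p \<in> tube \<delta>" for p v
    unfolding \<Psi>_def by (rule sub(4), assumption, assumption, rule that)
  define Ss where "Ss = (\<lambda>p. frechet_derivative S (at p) (1, 0, 0))"
  define St where "St = (\<lambda>p. frechet_derivative S (at p) (0, 1, 0))"
  define \<omega> where "\<omega> = (\<lambda>p. (F (\<Psi> p) - St p) / Ss p)"
  have \<Psi>_per: "\<Psi> (\<sigma>, \<theta> + 2 * pi, Z) = (S (\<sigma>, \<theta>, Z), \<theta> + 2 * pi, Z / \<kappa>)"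
    if "(\<sigma>, \<theta>, Z) \<in> tube \<delta>" for \<sigma> \<theta> Z
    using angle_periodicD[OF S(2) that] by (simp add: \<Psi>_def)
  have comp: "Ck_on m (\<lambda>p. h (\<Psi> p)) (tube \<delta>)" if "Ck_on ?k h (tube \<delta>0)" for h :: "_ \<Rightarrow> real"
    by (rule Ck_on_compose[OF open_tube open_tube Ck_on_le[OF that] C\<Psi> \<Psi>_in]) simp
  have per: "angle_periodic \<delta> (\<lambda>p. h (\<Psi> p))" if "angle_periodic \<delta>0 h" for h :: "_ \<Rightarrow> real"
    unfolding angle_periodic_def
    using angle_periodicD[OF that S_in] by (auto simp: \<Psi>_per) (simp add: \<Psi>_def)
  have S_split: "frechet_derivative S (at p) (w, 1, 0) = w * Ss p + St p" if "p \<in> tube \<delta>" for p w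
    using linear_triple[OF linear_frechet_derivative[OF Ck_on_differentiable[OF S(1) _ that]], of w 1 0]
    by (simp add: Ss_def St_def)
  have S\<omega>: "frechet_derivative S (at p) (\<omega> p, 1, 0) = F (\<Psi> p)" if "p \<in> tube \<delta>" for p
    using S\<^sub>\<sigma>[OF that] by (simp add: S_split[OF that] \<omega>_def Ss_def)
  show thesis
  proof
    show "0 < \<delta>" "\<kappa> \<noteq> 0" "0 \<le> C'" by fact+
    show "coordinates_near (Suc m) \<delta> (range (\<lambda>t. at_zero (\<gamma> t))) (W \<circ> \<Psi>)" by (rule \<Phi>)
    show "snd (snd ((W \<circ> \<Psi>) p)) = snd (snd p) / \<kappa>" if "p \<in> tube \<delta>" for p
      using W(2)[OF \<Psi>_in[OF that]] by (simp add: \<Psi>_def)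
    show "Ck_on m \<omega> (tube \<delta>)"
      unfolding \<omega>_def
      by (intro Ck_on_divide Ck_on_diff open_tube comp F(1))
        (use S\<^sub>\<sigma> Ck_on_frechet[OF S(1)] in \<open>auto simp: Ss_def St_def\<close>)
    show "angle_periodic \<delta> \<omega>"
      unfolding angle_periodic_def
      using angle_periodicD[OF per[OF F(2)]] angle_periodicD[OF angle_periodic_frechet[OF S(2,1)]]
      by (auto simp: \<omega>_def Ss_def St_def)
    show "Ck_on m (\<lambda>p. \<mu> (\<Psi> p)) (tube \<delta>)" by (rule comp[OF \<mu>(1)])
    show "angle_periodic \<delta> (\<lambda>p. \<mu> (\<Psi> p))" by (rule per[OF \<mu>_per])
    show "\<mu> (\<Psi> p) \<noteq> 0" if "p \<in> tube \<delta>" for p by (rule \<mu>(2)[OF \<Psi>_in[OF that]])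
    show "frechet_derivative (W \<circ> \<Psi>) (at p) (\<omega> p, 1, 0) = \<mu> (\<Psi> p) *\<^sub>R fast_field f1 f2 ((W \<circ> \<Psi>) p)"
      if "p \<in> tube \<delta>" for p
      using \<mu>(3)[OF \<Psi>_in[OF that]] by (simp add: \<Phi>'[OF that] S\<omega>[OF that])
    show "\<bar>\<omega> (\<sigma>, \<theta>, Z) - (Z - \<sigma>\<^sup>2)\<bar> \<le> C' * \<bar>\<sigma>\<bar> ^ 3" if "(\<sigma>, \<theta>, Z) \<in> tube \<delta>" for \<sigma> \<theta> Z
      by (rule S_w[OF that]) (simp add: S\<omega>[OF that], simp add: \<Psi>_def)
  qed
qed

section \<open>The slow drift as a perturbation\<close>

text \<open>
  The field \<open>(a, b, \<kappa>)\<close> is the slow direction \<open>(0, 0, 1)\<close> in the new coordinates. The third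
  component is known, and the other two follow from Cramer's rule, which also shows their smoothness.
\<close>

lemma vertical_field:
  fixes \<Phi> :: "real \<times> real \<times> real \<Rightarrow> real \<times> real \<times> real"
  assumes \<Phi>: "Ck_on (Suc m) \<Phi> (tube \<delta>)" "angle_periodic \<delta> \<Phi>"
    and inj: "\<And>p. p \<in> tube \<delta> \<Longrightarrow> inj (frechet_derivative \<Phi> (at p))"
    and \<Phi>3: "\<And>p. p \<in> tube \<delta> \<Longrightarrow> snd (snd (\<Phi> p)) = snd (snd p) / \<kappa>" and \<kappa>: "\<kappa> \<noteq> 0"
  obtains a b where "Ck_on m a (tube \<delta>)" "Ck_on m b (tube \<delta>)"
    "angle_periodic \<delta> a" "angle_periodic \<delta> b"
    "\<And>p. p \<in> tube \<delta> \<Longrightarrow> frechet_derivative \<Phi> (at p) (a p, b p, \<kappa>) = (0, 0, 1)"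
proof -
  define u where "u = (\<lambda>p. frechet_derivative \<Phi> (at p) (1, 0, 0))"
  define v where "v = (\<lambda>p. frechet_derivative \<Phi> (at p) (0, 1, 0))"
  define w where "w = (\<lambda>p. frechet_derivative \<Phi> (at p) (0, 0, 1))"
  define x y where xy: "x = (\<lambda>q::real \<times> real \<times> real. fst q)" "y = (\<lambda>q::real \<times> real \<times> real. fst (snd q))"
  define \<Delta> where "\<Delta> = (\<lambda>p. x (u p) * y (v p) - y (u p) * x (v p))"
  define a where "a = (\<lambda>p. - \<kappa> * (x (w p) * y (v p) - y (w p) * x (v p)) / \<Delta> p)"
  define b where "b = (\<lambda>p. - \<kappa> * (x (u p) * y (w p) - y (u p) * x (w p)) / \<Delta> p)"
  have lin: "linear (frechet_derivative \<Phi> (at p))" if "p \<in> tube \<delta>" for p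
    using Ck_on_differentiable[OF \<Phi>(1) _ that] by (simp add: linear_frechet_derivative)
  have C: "Ck_on m u (tube \<delta>)" "Ck_on m v (tube \<delta>)" "Ck_on m w (tube \<delta>)"
    unfolding u_def v_def w_def by (rule Ck_on_frechet[OF \<Phi>(1)])+
  have split: "frechet_derivative \<Phi> (at p) (r, s, t) = r *\<^sub>R u p + s *\<^sub>R v p + t *\<^sub>R w p"
    if "p \<in> tube \<delta>" for p r s t
    unfolding u_def v_def w_def by (rule linear_triple[OF lin[OF that]])
  have third: "snd (snd (frechet_derivative \<Phi> (at p) q)) = snd (snd q) / \<kappa>" if p: "p \<in> tube \<delta>" for p q
  proof -
    have "((\<lambda>p. snd (snd (\<Phi> p))) has_derivative (\<lambda>q. snd (snd (frechet_derivative \<Phi> (at p) q)))) (at p)"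
      by (intro has_derivative_snd Ck_on_has_derivative[OF \<Phi>(1) _ p]) simp
    moreover have "((\<lambda>p. snd (snd p) / \<kappa>) has_derivative (\<lambda>q. snd (snd q) / \<kappa>)) (at p)"
      using \<kappa> by (auto intro!: derivative_eq_intros)
    then have "((\<lambda>p. snd (snd (\<Phi> p))) has_derivative (\<lambda>q. snd (snd q) / \<kappa>)) (at p)"
      by (rule has_derivative_transform_within_open[OF _ open_tube p]) (simp add: \<Phi>3)
    ultimately have "(\<lambda>q. snd (snd (frechet_derivative \<Phi> (at p) q))) = (\<lambda>q. snd (snd q) / \<kappa>)"
      by (rule has_derivative_unique)
    then show ?thesis by (rule fun_cong)
  qed
  have \<Delta>: "\<Delta> p \<noteq> 0" if p: "p \<in> tube \<delta>" for p
  proof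
    assume "\<Delta> p = 0"
    then have 0: "x (u p) * y (v p) = y (u p) * x (v p)" by (simp add: \<Delta>_def)
    define L where "L = frechet_derivative \<Phi> (at p)"
    have L_eq: "L q = L q' \<longleftrightarrow> q = q'" for q q'
      unfolding L_def by (rule inj_eq[OF inj[OF p]])
    have L3: "snd (snd (u p)) = 0" "snd (snd (v p)) = 0"
      by (simp_all add: u_def v_def third[OF p])
    have L: "L (r, s, 0) = (r * x (u p) + s * x (v p), r * y (u p) + s * y (v p), 0)" for r s
      using split[OF p, of r s 0] L3 by (simp add: L_def xy prod_eq_iff)
    have "L (y (v p), - y (u p), 0) = L (0, 0, 0)" "L (x (v p), - x (u p), 0) = L (0, 0, 0)"
      using 0 by (auto simp: L algebra_simps)
    then have "y (u p) = 0" "x (u p) = 0" by (simp_all add: L_eq)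
    then have "L (1, 0, 0) = L (0, 0, 0)" by (simp add: L)
    then show False by (simp add: L_eq)
  qed
  have Cxy: "Ck_on m (\<lambda>p. x (h p)) (tube \<delta>)" "Ck_on m (\<lambda>p. y (h p)) (tube \<delta>)"
    if "Ck_on m h (tube \<delta>)" for h
    unfolding xy by (intro Ck_on_intros open_tube that)+
  have C\<Delta>: "Ck_on m \<Delta> (tube \<delta>)"
    unfolding \<Delta>_def by (intro Ck_on_intros open_tube Cxy C)
  have "Ck_on m a (tube \<delta>)"
    unfolding a_def
    by (rule Ck_on_divide[OF open_tube _ C\<Delta> \<Delta>]) (intro Ck_on_intros open_tube Cxy C)
  moreover have "Ck_on m b (tube \<delta>)"
    unfolding b_def
    by (rule Ck_on_divide[OF open_tube _ C\<Delta> \<Delta>]) (intro Ck_on_intros open_tube Cxy C)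
  moreover have "angle_periodic \<delta> a" "angle_periodic \<delta> b"
    using angle_periodic_frechet[OF \<Phi>(2,1)]
    by (auto simp: angle_periodic_def a_def b_def \<Delta>_def u_def v_def w_def)
  moreover have "frechet_derivative \<Phi> (at p) (a p, b p, \<kappa>) = (0, 0, 1)" if p: "p \<in> tube \<delta>" for p
  proof -
    have L3: "snd (snd (u p)) = 0" "snd (snd (v p)) = 0" "snd (snd (w p)) = 1 / \<kappa>"
      by (simp_all add: u_def v_def w_def third[OF p])
    have D: "a p * \<Delta> p = - \<kappa> * (x (w p) * y (v p) - y (w p) * x (v p))"
      "b p * \<Delta> p = - \<kappa> * (x (u p) * y (w p) - y (u p) * x (w p))"
      using \<Delta>[OF p] by (simp_all add: a_def b_def)
    have "(a p * x (u p) + b p * x (v p) + \<kappa> * x (w p)) * \<Delta> p =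
        (a p * \<Delta> p) * x (u p) + (b p * \<Delta> p) * x (v p) + \<kappa> * x (w p) * \<Delta> p"
      by (simp add: algebra_simps)
    also have "\<dots> = 0" unfolding D unfolding \<Delta>_def by (simp add: algebra_simps)
    finally have 1: "a p * x (u p) + b p * x (v p) + \<kappa> * x (w p) = 0" using \<Delta>[OF p] by simp
    have "(a p * y (u p) + b p * y (v p) + \<kappa> * y (w p)) * \<Delta> p =
        (a p * \<Delta> p) * y (u p) + (b p * \<Delta> p) * y (v p) + \<kappa> * y (w p) * \<Delta> p"
      by (simp add: algebra_simps)
    also have "\<dots> = 0" unfolding D unfolding \<Delta>_def by (simp add: algebra_simps)
    finally have 2: "a p * y (u p) + b p * y (v p) + \<kappa> * y (w p) = 0" using \<Delta>[OF p] by simp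
    show ?thesis using 1 2 L3 \<kappa> unfolding split[OF p] xy by (simp add: prod_eq_iff)
  qed
  ultimately show thesis by (rule that)
qed

text \<open>
  In the coordinates \<open>\<Phi>\<close> the full field is a multiple of
  \<open>(\<omega> + \<epsilon> s a, 1 + \<epsilon> s b, \<epsilon> s \<kappa>)\<close> with \<open>s = \<nu> g\<close>. Dividing by the angular component, which is
  close to \<open>1\<close> for small \<open>\<epsilon>\<close>, restores unit angular speed and changes the radial speed by
  \<open>\<epsilon> (s a - \<omega> s b) / (1 + \<epsilon> s b)\<close>. On a smaller tube periodicity makes all bounds uniform.
\<close>

lemma slow_drift_perturbation:
  fixes \<Phi> :: "real \<times> real \<times> real \<Rightarrow> real \<times> real \<times> real"
  assumes \<Phi>: "Ck_on (Suc m) \<Phi> (tube \<delta>)" "angle_periodic \<delta> \<Phi>"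
    and inj: "\<And>p. p \<in> tube \<delta> \<Longrightarrow> inj (frechet_derivative \<Phi> (at p))"
    and \<Phi>3: "\<And>p. p \<in> tube \<delta> \<Longrightarrow> snd (snd (\<Phi> p)) = snd (snd p) / \<kappa>" and \<kappa>: "\<kappa> \<noteq> 0"
    and g: "Ck_on m g UNIV"
    and \<omega>: "Ck_on m \<omega> (tube \<delta>)" "angle_periodic \<delta> \<omega>"
    and \<nu>: "Ck_on m \<nu> (tube \<delta>)" "angle_periodic \<delta> \<nu>" "\<And>p. p \<in> tube \<delta> \<Longrightarrow> \<nu> p \<noteq> 0"
    and eq: "\<And>p. p \<in> tube \<delta> \<Longrightarrow>
      frechet_derivative \<Phi> (at p) (\<omega> p, 1, 0) = \<nu> p *\<^sub>R fast_field f1 f2 (\<Phi> p)"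
    and \<delta>': "\<delta>' < \<delta>"
  obtains \<epsilon>0 C h2 gt where "0 < \<epsilon>0" "0 \<le> C"
    "Ck_on m (\<lambda>(\<epsilon>, p). h2 \<epsilon> p) ({-\<epsilon>0<..<\<epsilon>0} \<times> tube \<delta>')"
    "Ck_on m (\<lambda>(\<epsilon>, p). gt \<epsilon> p) ({-\<epsilon>0<..<\<epsilon>0} \<times> tube \<delta>')"
    "\<And>\<epsilon>. angle_periodic \<delta>' (h2 \<epsilon>)" "\<And>\<epsilon>. angle_periodic \<delta>' (gt \<epsilon>)"
    "\<And>\<epsilon> p. 0 < \<epsilon> \<Longrightarrow> \<epsilon> < \<epsilon>0 \<Longrightarrow> p \<in> tube \<delta>' \<Longrightarrow> \<bar>h2 \<epsilon> p\<bar> \<le> C * \<epsilon>"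
    "\<And>\<epsilon>. 0 < \<epsilon> \<Longrightarrow> \<epsilon> < \<epsilon>0 \<Longrightarrow> orbital_equivalence m (tube \<delta>') \<Phi> (slow_fast_field f1 f2 g \<epsilon>)
      (\<lambda>p. (\<omega> p + h2 \<epsilon> p, 1, \<epsilon> * gt \<epsilon> p))"
proof -
  obtain a b where ab: "Ck_on m a (tube \<delta>)" "Ck_on m b (tube \<delta>)"
    "angle_periodic \<delta> a" "angle_periodic \<delta> b"
    "\<And>p. p \<in> tube \<delta> \<Longrightarrow> frechet_derivative \<Phi> (at p) (a p, b p, \<kappa>) = (0, 0, 1)"
    using vertical_field[OF \<Phi> inj \<Phi>3 \<kappa>] by metis
  define s where "s = (\<lambda>p. \<nu> p * g (\<Phi> p))"
  have s: "Ck_on m s (tube \<delta>)" unfolding s_def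
    by (intro Ck_on_mult open_tube \<nu> Ck_on_compose[OF open_tube open_UNIV g Ck_on_SucD[OF \<Phi>(1)]]) auto
  have s_per: "angle_periodic \<delta> s" 
    unfolding angle_periodic_def[of _ s]
    by (auto simp: s_def angle_periodicD[OF \<nu>(2)] angle_periodicD[OF \<Phi>(2)])
  define d where "d = (\<lambda>p. s p * b p)"
  define e where "e = (\<lambda>p. s p * a p - \<omega> p * s p * b p)"
  have C: "Ck_on m d (tube \<delta>)" "Ck_on m e (tube \<delta>)"
    unfolding d_def e_def by (intro Ck_on_intros open_tube s ab \<omega>)+
  have per: "angle_periodic \<delta> d" "angle_periodic \<delta> e"
    unfolding angle_periodic_def
    by (auto simp: d_def e_def angle_periodicD[OF s_per] angle_periodicD[OF ab(3)]
        angle_periodicD[OF ab(4)] angle_periodicD[OF \<omega>(2)])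
  obtain B where B: "0 < B" "\<And>p. p \<in> tube \<delta>' \<Longrightarrow> norm (d p) \<le> B"
    using angle_periodic_bounded[OF per(1) Ck_on_continuous[OF C(1)] \<delta>'] by metis
  obtain B' where B': "0 < B'" "\<And>p. p \<in> tube \<delta>' \<Longrightarrow> norm (e p) \<le> B'"
    using angle_periodic_bounded[OF per(2) Ck_on_continuous[OF C(2)] \<delta>'] by metis
  (* keeps the angular component at least 1/2 *)
  define \<epsilon>0 where "\<epsilon>0 = 1 / (2 * B)"
  have den: "1 / 2 \<le> 1 + \<epsilon> * d p" if "\<bar>\<epsilon>\<bar> < \<epsilon>0" "p \<in> tube \<delta>'" for \<epsilon> p
  proof -
    have "\<bar>\<epsilon> * d p\<bar> \<le> \<epsilon>0 * B"
      unfolding abs_mult using that B by (intro mult_mono) auto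
    then show ?thesis using B(1) by (simp add: \<epsilon>0_def abs_le_iff)
  qed
  have sub: "tube \<delta>' \<subseteq> tube \<delta>" using \<delta>' by (intro tube_mono) simp
  define h2 where "h2 = (\<lambda>\<epsilon> p. \<epsilon> * e p / (1 + \<epsilon> * d p))"
  define gt where "gt = (\<lambda>\<epsilon> p. \<kappa> * s p / (1 + \<epsilon> * d p))"
  let ?D = "{-\<epsilon>0<..<\<epsilon>0} \<times> tube \<delta>'"
  have oD: "open ?D" by (intro open_Times open_tube) simp
  have lift: "Ck_on m (\<lambda>q. h (snd q)) ?D" if "Ck_on m h (tube \<delta>)" for h :: "real \<times> real \<times> real \<Rightarrow> real"
    by (rule Ck_on_compose[OF oD open_tube that Ck_on_snd[OF oD Ck_on_ident[OF oD]]]) (use sub in auto)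
  have denD: "1 + fst q * d (snd q) \<noteq> 0" if "q \<in> ?D" for q
    using den[of "fst q" "snd q"] that by (auto simp: abs_less_iff)
  show thesis
  proof
    show "0 < \<epsilon>0" using B(1) by (simp add: \<epsilon>0_def)
    show "0 \<le> 2 * B'" using B'(1) by simp
    show "Ck_on m (\<lambda>(\<epsilon>, p). h2 \<epsilon> p) ?D" "Ck_on m (\<lambda>(\<epsilon>, p). gt \<epsilon> p) ?D"
      unfolding split_beta h2_def gt_def
      by (intro Ck_on_divide[OF oD _ _ denD] Ck_on_mult Ck_on_add Ck_on_const Ck_on_fst Ck_on_ident
          oD lift C s; assumption)+
    show "angle_periodic \<delta>' (h2 \<epsilon>)" "angle_periodic \<delta>' (gt \<epsilon>)" for \<epsilon>
      unfolding angle_periodic_def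
      by (auto simp: h2_def gt_def angle_periodicD[OF s_per] angle_periodicD[OF per(1)]
          angle_periodicD[OF per(2)] subsetD[OF sub])
  next
    fix \<epsilon> p assume \<epsilon>: "0 < \<epsilon>" "\<epsilon> < \<epsilon>0" and p: "p \<in> tube \<delta>'"
    have dn: "1 / 2 \<le> 1 + \<epsilon> * d p" using den[of \<epsilon> p] \<epsilon> p by simp
    have "\<bar>h2 \<epsilon> p\<bar> = \<epsilon> * \<bar>e p\<bar> / (1 + \<epsilon> * d p)"
      using dn \<epsilon> by (simp add: h2_def abs_mult)
    also have "\<dots> \<le> \<epsilon> * B' / (1 / 2)"
      using dn \<epsilon> B'(1) B'(2)[OF p] by (intro frac_le mult_left_mono) auto
    finally show "\<bar>h2 \<epsilon> p\<bar> \<le> 2 * B' * \<epsilon>" by (simp add: mult_ac)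
  next
    fix \<epsilon> assume \<epsilon>: "0 < \<epsilon>" "\<epsilon> < \<epsilon>0"
    have nz: "1 + \<epsilon> * d p \<noteq> 0" if "p \<in> tube \<delta>'" for p using den[of \<epsilon> p] \<epsilon> that by auto
    define \<nu>' where "\<nu>' = (\<lambda>p. \<nu> p / (1 + \<epsilon> * d p))"
    have "Ck_on m \<nu>' (tube \<delta>')"
      unfolding \<nu>'_def
      by (intro Ck_on_divide open_tube nz Ck_on_add Ck_on_const Ck_on_mult
          Ck_on_subset[OF C(1) sub] Ck_on_subset[OF \<nu>(1) sub])
    moreover have "\<nu>' p \<noteq> 0 \<and> frechet_derivative \<Phi> (at p) (\<omega> p + h2 \<epsilon> p, 1, \<epsilon> * gt \<epsilon> p) =
        \<nu>' p *\<^sub>R slow_fast_field f1 f2 g \<epsilon> (\<Phi> p)" if p': "p \<in> tube \<delta>'" for p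
    proof -
      have p: "p \<in> tube \<delta>" using p' sub by auto
      note n = nz[OF p']
      define L where "L = frechet_derivative \<Phi> (at p)"
      have lin: "linear L"
        unfolding L_def using Ck_on_differentiable[OF \<Phi>(1) _ p] by (simp add: linear_frechet_derivative)
      have "(\<omega> p + h2 \<epsilon> p, 1, \<epsilon> * gt \<epsilon> p) =
          (1 / (1 + \<epsilon> * d p)) *\<^sub>R ((\<omega> p, 1, 0) + (\<epsilon> * s p) *\<^sub>R (a p, b p, \<kappa>))"
        using n by (simp add: h2_def gt_def d_def e_def field_simps)
      then have "L (\<omega> p + h2 \<epsilon> p, 1, \<epsilon> * gt \<epsilon> p) =
          (1 / (1 + \<epsilon> * d p)) *\<^sub>R (L (\<omega> p, 1, 0) + (\<epsilon> * s p) *\<^sub>R L (a p, b p, \<kappa>))"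
        by (simp only: linear_cmul[OF lin] linear_add[OF lin])
      also have "\<dots> = (1 / (1 + \<epsilon> * d p)) *\<^sub>R (\<nu> p *\<^sub>R fast_field f1 f2 (\<Phi> p) + (\<epsilon> * s p) *\<^sub>R (0, 0, 1))"
        unfolding L_def eq[OF p] ab(5)[OF p] ..
      also have "\<dots> = \<nu>' p *\<^sub>R slow_fast_field f1 f2 g \<epsilon> (\<Phi> p)"
        by (simp add: \<nu>'_def fast_field_def slow_fast_field_def s_def)
      finally show ?thesis using n \<nu>(3)[OF p] by (simp add: \<nu>'_def L_def)
    qed
    ultimately show "orbital_equivalence m (tube \<delta>') \<Phi> (slow_fast_field f1 f2 g \<epsilon>)
        (\<lambda>p. (\<omega> p + h2 \<epsilon> p, 1, \<epsilon> * gt \<epsilon> p))"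
      unfolding orbital_equivalence_def by blast
  qed
qed

section \<open>The normal form of the slow/fast system\<close>

theorem theorem6p1:
  fixes N m :: nat
  assumes "3 \<le> N" and "1 \<le> m"
  shows "\<exists>k. \<forall>(f1 :: real \<times> real \<times> real \<Rightarrow> real) f2 g (\<gamma> :: real \<Rightarrow> real \<times> real) T lam.
    Ck_on k f1 UNIV \<and> Ck_on k f2 UNIV \<and> Ck_on k g UNIV \<and>
    fast_periodic_solution f1 f2 \<gamma> T \<and>
    nontrivial_floquet_multiplier f1 f2 \<gamma> T 1 \<and>
    coefficient_functions k N f1 f2 \<gamma> lam \<and>
    deriv (lam 0) 0 \<noteq> 0 \<and> lam 2 0 \<noteq> 0 \<longrightarrow>
    (\<exists>\<epsilon>0>0. \<exists>\<delta>>0. \<exists>C \<Phi> h1 h2 gt.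
       coordinates_near m \<delta> (range (\<lambda>t. at_zero (\<gamma> t))) \<Phi> \<and>
       Ck_on m h1 (tube \<delta>) \<and> angle_periodic \<delta> h1 \<and>
       Ck_on m (\<lambda>(\<epsilon>, p). h2 \<epsilon> p) ({-\<epsilon>0<..<\<epsilon>0} \<times> tube \<delta>) \<and>
       Ck_on m (\<lambda>(\<epsilon>, p). gt \<epsilon> p) ({-\<epsilon>0<..<\<epsilon>0} \<times> tube \<delta>) \<and>
       (\<forall>(\<rho>, \<theta>, z) \<in> tube \<delta>. \<bar>h1 (\<rho>, \<theta>, z)\<bar> \<le> C * \<bar>\<rho>\<bar> ^ 3) \<and>
       (\<forall>\<epsilon>. 0 < \<epsilon> \<and> \<epsilon> < \<epsilon>0 \<longrightarrow>
          angle_periodic \<delta> (h2 \<epsilon>) \<and> angle_periodic \<delta> (gt \<epsilon>) \<and>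
          (\<forall>p\<in>tube \<delta>. \<bar>h2 \<epsilon> p\<bar> \<le> C * \<epsilon>) \<and>
          orbital_equivalence m (tube \<delta>) \<Phi> (slow_fast_field f1 f2 g \<epsilon>)
            (\<lambda>(\<rho>, \<theta>, z). (z - \<rho>\<^sup>2 + h1 (\<rho>, \<theta>, z) + h2 \<epsilon> (\<rho>, \<theta>, z), 1,
                          \<epsilon> * gt \<epsilon> (\<rho>, \<theta>, z)))))"
\<comment> \<open>Two derivatives are spent on the Hadamard quotients in the cubic substitution, and one on
  expressing the field in the new coordinates.\<close>
proof (rule exI[of _ "Suc (Suc (Suc m))"], intro allI impI, elim conjE)
  fix f1 f2 g :: "real \<times> real \<times> real \<Rightarrow> real" and \<gamma> :: "real \<Rightarrow> real \<times> real" and T lam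
  let ?k = "Suc (Suc (Suc m))" and ?\<Gamma> = "range (\<lambda>t. at_zero (\<gamma> t))"
  assume f: "Ck_on ?k f1 UNIV" "Ck_on ?k f2 UNIV" "Ck_on ?k g UNIV"
    and \<gamma>: "fast_periodic_solution f1 f2 \<gamma> T" "nontrivial_floquet_multiplier f1 f2 \<gamma> T 1"
    and lam: "coefficient_functions ?k N f1 f2 \<gamma> lam" "deriv (lam 0) 0 \<noteq> 0" "lam 2 0 \<noteq> 0"
  have f': "Ck_on (Suc 0) f1 UNIV" "Ck_on (Suc 0) f2 UNIV" "Ck_on m g UNIV"
    by (rule Ck_on_le[OF f(1)] Ck_on_le[OF f(2)] Ck_on_le[OF f(3)], simp)+
  obtain \<delta>0 \<kappa> \<Phi> \<omega> \<nu> C where \<delta>0: "0 < \<delta>0" and \<kappa>: "\<kappa> \<noteq> 0" and C: "0 \<le> C"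
    and \<Phi>: "coordinates_near (Suc m) \<delta>0 ?\<Gamma> \<Phi>"
      "\<And>p. p \<in> tube \<delta>0 \<Longrightarrow> snd (snd (\<Phi> p)) = snd (snd p) / \<kappa>"
    and \<omega>: "Ck_on m \<omega> (tube \<delta>0)" "angle_periodic \<delta>0 \<omega>"
    and \<nu>: "Ck_on m \<nu> (tube \<delta>0)" "angle_periodic \<delta>0 \<nu>" "\<And>p. p \<in> tube \<delta>0 \<Longrightarrow> \<nu> p \<noteq> 0"
    and eq: "\<And>p. p \<in> tube \<delta>0 \<Longrightarrow>
      frechet_derivative \<Phi> (at p) (\<omega> p, 1, 0) = \<nu> p *\<^sub>R fast_field f1 f2 (\<Phi> p)"
    and cubic: "\<And>\<sigma> \<theta> Z. (\<sigma>, \<theta>, Z) \<in> tube \<delta>0 \<Longrightarrow>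
      \<bar>\<omega> (\<sigma>, \<theta>, Z) - (Z - \<sigma>\<^sup>2)\<bar> \<le> C * \<bar>\<sigma>\<bar> ^ 3"
    by (rule fold_coordinates[OF assms(1) f'(1,2) \<gamma> lam]) (rule that)
  have \<Phi>c: "Ck_on (Suc m) \<Phi> (tube \<delta>0)" "angle_periodic \<delta>0 \<Phi>"
    "\<And>p. p \<in> tube \<delta>0 \<Longrightarrow> bij (frechet_derivative \<Phi> (at p))"
    using \<Phi>(1) unfolding coordinates_near_def by auto
  define \<delta> where "\<delta> = \<delta>0 / 2"
  have \<delta>: "0 < \<delta>" "\<delta> < \<delta>0" using \<delta>0 by (auto simp: \<delta>_def)
  have sub: "tube \<delta> \<subseteq> tube \<delta>0" using \<delta> by (intro tube_mono) simp
  obtain \<epsilon>0 C' h2 gt where h: "0 < \<epsilon>0" "0 \<le> C'"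
    "Ck_on m (\<lambda>(\<epsilon>, p). h2 \<epsilon> p) ({-\<epsilon>0<..<\<epsilon>0} \<times> tube \<delta>)"
    "Ck_on m (\<lambda>(\<epsilon>, p). gt \<epsilon> p) ({-\<epsilon>0<..<\<epsilon>0} \<times> tube \<delta>)"
    "\<And>\<epsilon>. angle_periodic \<delta> (h2 \<epsilon>)" "\<And>\<epsilon>. angle_periodic \<delta> (gt \<epsilon>)"
    "\<And>\<epsilon> p. 0 < \<epsilon> \<Longrightarrow> \<epsilon> < \<epsilon>0 \<Longrightarrow> p \<in> tube \<delta> \<Longrightarrow> \<bar>h2 \<epsilon> p\<bar> \<le> C' * \<epsilon>"
    "\<And>\<epsilon>. 0 < \<epsilon> \<Longrightarrow> \<epsilon> < \<epsilon>0 \<Longrightarrow> orbital_equivalence m (tube \<delta>) \<Phi> (slow_fast_field f1 f2 g \<epsilon>)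
      (\<lambda>p. (\<omega> p + h2 \<epsilon> p, 1, \<epsilon> * gt \<epsilon> p))"
    by (rule slow_drift_perturbation[OF \<Phi>c(1,2) bij_is_inj[OF \<Phi>c(3)] \<Phi>(2) \<kappa> f'(3) \<omega> \<nu> eq \<delta>(2)])
      (assumption+, rule that)
  define h1 where "h1 = (\<lambda>p. \<omega> p - (snd (snd p) - (fst p)\<^sup>2))"
  define K where "K = max C C'"
  have "coordinates_near m \<delta> ?\<Gamma> \<Phi>"
    by (rule coordinates_near_mono[OF \<Phi>(1)]) (use \<delta> in auto)
  moreover have "Ck_on m h1 (tube \<delta>)"
    unfolding h1_def by (intro Ck_on_intros open_tube Ck_on_subset[OF \<omega>(1) sub])
  moreover have "angle_periodic \<delta> h1"
    unfolding angle_periodic_def by (auto simp: h1_def angle_periodicD[OF \<omega>(2)] subsetD[OF sub])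
  moreover have "\<forall>(\<rho>, \<theta>, z) \<in> tube \<delta>. \<bar>h1 (\<rho>, \<theta>, z)\<bar> \<le> K * \<bar>\<rho>\<bar> ^ 3"
  proof safe
    fix \<rho> \<theta> z assume "(\<rho>, \<theta>, z) \<in> tube \<delta>"
    then have "\<bar>h1 (\<rho>, \<theta>, z)\<bar> \<le> C * \<bar>\<rho>\<bar> ^ 3" using cubic sub by (auto simp: h1_def)
    also have "\<dots> \<le> K * \<bar>\<rho>\<bar> ^ 3" by (intro mult_right_mono) (auto simp: K_def)
    finally show "\<bar>h1 (\<rho>, \<theta>, z)\<bar> \<le> K * \<bar>\<rho>\<bar> ^ 3" .
  qed
  moreover have "\<bar>h2 \<epsilon> p\<bar> \<le> K * \<epsilon>" if "0 < \<epsilon>" "\<epsilon> < \<epsilon>0" "p \<in> tube \<delta>" for \<epsilon> p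
  proof -
    have "C' * \<epsilon> \<le> K * \<epsilon>" using that(1) by (intro mult_right_mono) (auto simp: K_def)
    then show ?thesis using h(7)[OF that] by simp
  qed
  moreover have "orbital_equivalence m (tube \<delta>) \<Phi> (slow_fast_field f1 f2 g \<epsilon>) (\<lambda>(\<rho>, \<theta>, z).
      (z - \<rho>\<^sup>2 + h1 (\<rho>, \<theta>, z) + h2 \<epsilon> (\<rho>, \<theta>, z), 1, \<epsilon> * gt \<epsilon> (\<rho>, \<theta>, z)))"
    if "0 < \<epsilon>" "\<epsilon> < \<epsilon>0" for \<epsilon>
  proof -
    have "(\<lambda>p. (\<omega> p + h2 \<epsilon> p, 1, \<epsilon> * gt \<epsilon> p)) = (\<lambda>(\<rho>, \<theta>, z).
      (z - \<rho>\<^sup>2 + h1 (\<rho>, \<theta>, z) + h2 \<epsilon> (\<rho>, \<theta>, z), 1, \<epsilon> * gt \<epsilon> (\<rho>, \<theta>, z)))"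
      by (auto simp: h1_def)
    from subst[where P = "orbital_equivalence m (tube \<delta>) \<Phi> (slow_fast_field f1 f2 g \<epsilon>)",
        OF this h(8)[OF that]]
    show ?thesis .
  qed
  ultimately show "\<exists>\<epsilon>0>0. \<exists>\<delta>>0. \<exists>C \<Phi> h1 h2 gt.
       coordinates_near m \<delta> ?\<Gamma> \<Phi> \<and>
       Ck_on m h1 (tube \<delta>) \<and> angle_periodic \<delta> h1 \<and>
       Ck_on m (\<lambda>(\<epsilon>, p). h2 \<epsilon> p) ({-\<epsilon>0<..<\<epsilon>0} \<times> tube \<delta>) \<and>
       Ck_on m (\<lambda>(\<epsilon>, p). gt \<epsilon> p) ({-\<epsilon>0<..<\<epsilon>0} \<times> tube \<delta>) \<and>
       (\<forall>(\<rho>, \<theta>, z) \<in> tube \<delta>. \<bar>h1 (\<rho>, \<theta>, z)\<bar> \<le> C * \<bar>\<rho>\<bar> ^ 3) \<and>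
       (\<forall>\<epsilon>. 0 < \<epsilon> \<and> \<epsilon> < \<epsilon>0 \<longrightarrow>
          angle_periodic \<delta> (h2 \<epsilon>) \<and> angle_periodic \<delta> (gt \<epsilon>) \<and>
          (\<forall>p\<in>tube \<delta>. \<bar>h2 \<epsilon> p\<bar> \<le> C * \<epsilon>) \<and>
          orbital_equivalence m (tube \<delta>) \<Phi> (slow_fast_field f1 f2 g \<epsilon>)
            (\<lambda>(\<rho>, \<theta>, z). (z - \<rho>\<^sup>2 + h1 (\<rho>, \<theta>, z) + h2 \<epsilon> (\<rho>, \<theta>, z), 1,
                          \<epsilon> * gt \<epsilon> (\<rho>, \<theta>, z))))"
    using h(1,3-6) \<delta>(1)
    by - (rule exI[of _ \<epsilon>0], rule conjI, assumption, rule exI[of _ \<delta>], rule conjI, assumption,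
        rule exI[of _ K], rule exI[of _ \<Phi>], rule exI[of _ h1], rule exI[of _ h2], rule exI[of _ gt],
        simp)
qed

end
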